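(* Let $R=S/I_2(M)$ be the coordinate ring of the rational normal $2$-scroll $\mathcal{S}(m-1,n-m-1)$ and $p=n-m$. The sequence $$\mathcal{F}_\bullet:\ \cdots\xrightarrow{\partial_6}R^{(n-2)^3(n-3)^2}\xrightarrow{\partial_5}R^{(n-2)^3(n-3)}\xrightarrow{\partial_4}R^{(n-2)^3}\xrightarrow{\partial_3}R^{n^2-3n+3}\xrightarrow{\partial_2}R^n\xrightarrow{\partial_1}R\xrightarrow{\partial_0}\Bbbk\to0,$$ where $\partial_0$ is the natural projection and $$\partial_1=[x_1\ x_2\ \cdots\ x_n],\qquad \partial_2=\left[\begin{array}{c|c}\begin{array}{cc}\partial_{I_1,1}&\mathbf 0\\ \mathbf 0&\partial_{I_2,1}\end{array}&\alpha_0\end{array}\right],\qquad \partial_{i+1}=\left[\begin{array}{c|c}\begin{array}{cc}\partial_{I_1,i}&\mathbf 0\\ \mathbf 0&\partial_{I_2,i}\end{array}&\alpha_{i-1}\\ \hline \mathbf 0&-\partial_{J,i-1}\end{array}\right]\ (i\ge2),$$ is the minimal free resolution of $\Bbbk$ over $R$.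
   Context: Let $\Bbbk$ be a field, $m,p\ge2$ integers, $n=m+p$, $S=\Bbbk[x_1,\dots,x_n]$ (standard grading), $$M=\left[\begin{array}{cccc|cccc}x_1&x_2&\ldots&x_{m-1}&x_{m+1}&x_{m+2}&\ldots&x_{n-1}\\ x_2&x_3&\ldots&x_m&x_{m+2}&x_{m+3}&\ldots&x_n\end{array}\right],$$ $I_2(M)$ the ideal generated by the $2\times 2$ minors of $M$, $R=S/I_2(M)$, and $\Bbbk=R/\langle x_1,\dots,x_n\rangle$. Matrices act on column vectors; $\mathbf 0$ is a zero block, $\mathbb{1}_\ell$ the $\ell\times\ell$ identity matrix, $\bigoplus$ of matrices means block-diagonal concatenation, and $A^{\oplus d}$ is the direct sum of $d$ copies of $A$ (empty if $d=0$). Define the following matrices over $R$. $\varphi_0=\begin{bmatrix}x_2&x_3&\ldots&x_m&x_{m+2}&\ldots&x_n\\-x_1&-x_2&\ldots&-x_{m-1}&-x_{m+1}&\ldots&-x_{n-1}\end{bmatrix}\in R^{2\times(n-2)}$. For $d\ge1$, $\Phi_d\in R^{d\times(d-1)(n-2)}$ is the matrix whose submatrix in rows $j,j+1$ and columns $(j-1)(n-2)+1,\dots,j(n-2)$ is $\varphi_0$ for each $1\le j\le d-1$, all other entries being $0$ ($\Phi_1$ has no columns). $\varphi_1=\left[\begin{array}{c|c|c}\Phi_{m-1}&N_1&\mathbf 0\\ \hline \mathbf 0&N_2&\Phi_{p-1}\end{array}\right]\in R^{(n-2)\times(n-2)(n-3)}$, where $N_1\in R^{(m-1)\times(n-2)}$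 has entries $(N_1)_{i,i}=x_{m+1}$ for $1\le i\le m-1$, $(N_1)_{m-1,j}=x_{j+2}$ for $m\le j\le n-2$, and $0$ elsewhere; and $N_2\in R^{(p-1)\times(n-2)}$ has entries $(N_2)_{1,j}=-x_j$ for $1\le j\le m$, $(N_2)_{i,m-1+i}=-x_m$ for $2\le i\le p-1$, and $0$ elsewhere. For $0\le i\le m-3$, $u_i\in R^{(m-2)(n-2)\times(n-2)}$ has row number $i(n-2)+m$ equal to the first row $(x_1,\dots,x_{m-1},x_{m+1},\dots,x_{n-1})$ of $M$ and all other rows zero. For $0\le i\le p-3$, $v_i\in R^{(p-2)(n-2)\times(n-2)}$ has row number $i(n-2)+m-1$ equal to $(-x_2,\dots,-x_m,-x_{m+2},\dots,-x_n)$ and all other rows zero. $\varphi_2=\left[\begin{array}{c|c|c}\varphi_1^{\oplus(m-2)}&U&\mathbf 0\\ \hline \mathbf 0&-\Phi_{n-2}&\mathbf 0\\ \hline \mathbf 0&V&\varphi_1^{\oplus(p-2)}\end{array}\right]\in R^{(n-2)(n-3)\times(n-2)(n-3)^2}$, where $U=[\,u_0\ u_1\ \cdots\ u_{m-3}\ \mathbf 0\,]$ (with $u$'s in the first $m-2$ blocks of $n-2$ columns) and $V=[\,\mathbf 0\ v_0\ v_1\ \cdots\ v_{p-3}\,]$ (with $v$'s in the last $p-2$ blocks of $n-2$ columns) each have $(n-3)(n-2)$ columns. For $i\ge3$, $\varphi_i=\varphi_{i-1}^{\oplus(m-2)}\oplus\varphi_{i-2}^{\oplus(n-3)}\oplus\varphi_{i-1}^{\oplus(p-2)}\in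 R^{(n-2)(n-3)^{i-1}\times(n-2)(n-3)^i}$. Set $\partial_{J,1}=\Phi_{n-1}$, $\partial_{J,i}=\varphi_{i-1}^{\oplus(n-2)}$ for $i\ge2$; $\partial_{I_1,1}=\Phi_m$, $\partial_{I_1,i}=\varphi_{i-1}^{\oplus(m-1)}$ for $i\ge2$; $\partial_{I_2,1}=\Phi_p$, $\partial_{I_2,i}=\varphi_{i-1}^{\oplus(p-1)}$ for $i\ge2$. $\alpha_0\in R^{n\times(n-1)}$ has entries $(\alpha_0)_{i,i}=x_{m+1}$ for $1\le i\le m$, $(\alpha_0)_{m,j}=x_{j+1}$ for $m+1\le j\le n-1$, $(\alpha_0)_{m+1,j}=-x_j$ for $1\le j\le m$, $(\alpha_0)_{m+i,m-1+i}=-x_m$ for $2\le i\le p$, and $0$ elsewhere. For $i\ge1$, $\alpha_i=\begin{bmatrix}x_{m+1}\cdot\mathbb 1_{(m-1)(n-2)(n-3)^{i-1}}&\mathbf 0\\ \mathbf 0&-x_m\cdot\mathbb 1_{(p-1)(n-2)(n-3)^{i-1}}\end{bmatrix}.$ *)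

theory Defs
  imports
    "Jordan_Normal_Form.Determinant"
    "HOL-Algebra.QuotRing"
    "HOL-Library.Poly_Mapping"
begin

section \<open>Minimal graded free resolutions\<close>

text \<open>
  The types of vectors and matrices of Jordan_Normal_Form serve as containers for entries in the
  carrier of a ring R of HOL-Algebra. The free module R^r consists of column vectors, and matrices
  act on them from the left, using the operations of R.
\<close>

definition free_module :: "('a, 'c) ring_scheme \<Rightarrow> nat \<Rightarrow> ('a, 'a vec) module" where
  "free_module R r =
    \<lparr>carrier = {v \<in> carrier_vec r. \<forall>j<r. v $ j \<in> carrier R},
     mult = undefined, one = undefined,
     zero = vec r (\<lambda>_. \<zero>\<^bsub>R\<^esub>),
     add = (\<lambda>v w. vec r (\<lambda>j. v $ j \<oplus>\<^bsub>R\<^esub> w $ j)),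
     module.smult = (\<lambda>a v. vec r (\<lambda>j. a \<otimes>\<^bsub>R\<^esub> v $ j))\<rparr>"

definition mat_act :: "('a, 'c) ring_scheme \<Rightarrow> 'a mat \<Rightarrow> 'a vec \<Rightarrow> 'a vec" where
  "mat_act R A v =
    vec (dim_row A) (\<lambda>i. finsum R (\<lambda>j. A $$ (i, j) \<otimes>\<^bsub>R\<^esub> v $ j) {..<dim_col A})"

definition module_homs ::
  "('a, 'c) ring_scheme \<Rightarrow> ('a, 'm, 'd) module_scheme \<Rightarrow> ('a, 'n, 'e) module_scheme \<Rightarrow> ('m \<Rightarrow> 'n) set"
where
  "module_homs R M N = {f \<in> carrier M \<rightarrow> carrier N.
    (\<forall>v\<in>carrier M. \<forall>w\<in>carrier M. f (v \<oplus>\<^bsub>M\<^esub> w) = f v \<oplus>\<^bsub>N\<^esub> f w) \<and>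
    (\<forall>a\<in>carrier R. \<forall>v\<in>carrier M. f (a \<odot>\<^bsub>M\<^esub> v) = a \<odot>\<^bsub>N\<^esub> f v)}"

definition quotient_module :: "('a, 'c) ring_scheme \<Rightarrow> 'a set \<Rightarrow> ('a, 'a set) module" where
  "quotient_module R J =
    \<lparr>carrier = carrier (R Quot J),
     mult = (\<otimes>\<^bsub>R Quot J\<^esub>), one = \<one>\<^bsub>R Quot J\<^esub>,
     zero = \<zero>\<^bsub>R Quot J\<^esub>, add = (\<oplus>\<^bsub>R Quot J\<^esub>),
     module.smult = (\<lambda>a X. (J +>\<^bsub>R\<^esub> a) \<otimes>\<^bsub>R Quot J\<^esub> X)\<rparr>"

text \<open>
  The degree t component of the direct sum of the R(-s j) for j < r, where gr d is the degree d
  component of R.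
\<close>

definition free_module_component ::
  "('a, 'c) ring_scheme \<Rightarrow> (int \<Rightarrow> 'a set) \<Rightarrow> nat \<Rightarrow> (nat \<Rightarrow> int) \<Rightarrow> int \<Rightarrow> 'a vec set"
where
  "free_module_component R gr r s t =
    {v \<in> carrier (free_module R r). \<forall>j<r. v $ j \<in> gr (t - s j)}"

text \<open>
  Let R be a ring with grading gr and homogeneous maximal ideal mx, and N an R-module with grading
  grN. The complex with terms R^(rk i) in homological degree i, differentials D i from R^(rk i) to
  R^(rk (i - 1)) for i > 0, and augmentation aug is a minimal graded free resolution of N iff it is
  exact (including at N), all maps are homogeneous of degree 0 for some choice s i j of the
  degrees of the basis elements, and the image of each D (i + 1) lies in mx R^(rk i), i.e. consists
  of vectors with entries in mx. (The value D 0 plays no role.)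
\<close>

definition minimal_graded_free_resolution ::
  "('a, 'c) ring_scheme \<Rightarrow> (int \<Rightarrow> 'a set) \<Rightarrow> 'a set \<Rightarrow>
   ('a, 'm, 'd) module_scheme \<Rightarrow> (int \<Rightarrow> 'm set) \<Rightarrow>
   (nat \<Rightarrow> nat) \<Rightarrow> (nat \<Rightarrow> 'a mat) \<Rightarrow> ('a vec \<Rightarrow> 'm) \<Rightarrow> bool"
where
  "minimal_graded_free_resolution R gr mx N grN rk D aug \<longleftrightarrow>
    module R N \<and>
    (\<forall>i. D (i + 1) \<in> carrier_mat (rk i) (rk (i + 1)) \<and> elements_mat (D (i + 1)) \<subseteq> carrier R) \<and>
    aug \<in> module_homs R (free_module R (rk 0)) N \<and>
    aug ` carrier (free_module R (rk 0)) = carrier N \<and>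
    {v \<in> carrier (free_module R (rk 0)). aug v = \<zero>\<^bsub>N\<^esub>} =
      mat_act R (D 1) ` carrier (free_module R (rk 1)) \<and>
    (\<forall>i. {v \<in> carrier (free_module R (rk (i + 1))).
            mat_act R (D (i + 1)) v = \<zero>\<^bsub>free_module R (rk i)\<^esub>} =
         mat_act R (D (i + 2)) ` carrier (free_module R (rk (i + 2)))) \<and>
    (\<exists>s. (\<forall>t. aug ` free_module_component R gr (rk 0) (s 0) t \<subseteq> grN t) \<and>
         (\<forall>i t. mat_act R (D (i + 1)) ` free_module_component R gr (rk (i + 1)) (s (i + 1)) t
                \<subseteq> free_module_component R gr (rk i) (s i) t)) \<and>
    (\<forall>i. mat_act R (D (i + 1)) ` carrier (free_module R (rk (i + 1)))
         \<subseteq> {v \<in> carrier (free_module R (rk i)). \<forall>j<rk i. v $ j \<in> mx})"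


section \<open>The coordinate ring of the rational normal scroll\<close>

text \<open>
  Polynomials in variables var i (i a natural number); a key of such a polynomial is a monomial,
  given by its exponents. The variables of S are var 1, ..., var (m + p).
\<close>

type_synonym 'k mpol = "(nat \<Rightarrow>\<^sub>0 nat) \<Rightarrow>\<^sub>0 'k"

definition var :: "nat \<Rightarrow> 'k::field mpol" where
  "var i = Poly_Mapping.single (Poly_Mapping.single i 1) 1"

definition S_ring :: "nat \<Rightarrow> 'k::field mpol ring" where
  "S_ring n =
    \<lparr>carrier = {f. \<forall>t\<in>Poly_Mapping.keys f. Poly_Mapping.keys t \<subseteq> {1..n}},
     mult = (*), one = 1, zero = 0, add = (+)\<rparr>"

definition monomial_degree :: "(nat \<Rightarrow>\<^sub>0 nat) \<Rightarrow> nat" where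
  "monomial_degree t = (\<Sum>i\<in>Poly_Mapping.keys t. Poly_Mapping.lookup t i)"

definition S_component :: "nat \<Rightarrow> int \<Rightarrow> 'k::field mpol set" where
  "S_component n d =
    {f \<in> carrier (S_ring n). \<forall>t\<in>Poly_Mapping.keys f. int (monomial_degree t) = d}"

text \<open>Matrices given by 1-based entries.\<close>

definition mat1 :: "nat \<Rightarrow> nat \<Rightarrow> (nat \<Rightarrow> nat \<Rightarrow> 'a) \<Rightarrow> 'a mat" where
  "mat1 nr nc f = mat nr nc (\<lambda>(i, j). f (i + 1) (j + 1))"

definition scroll_matrix :: "nat \<Rightarrow> nat \<Rightarrow> 'k::field mpol mat" where
  "scroll_matrix m p = mat1 2 (m + p - 2) (\<lambda>i j.
     if j \<le> m - 1 then (if i = 1 then var j else var (j + 1))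
     else (if i = 1 then var (j + 1) else var (j + 2)))"

text \<open>The minors of size 2 of a matrix with two rows.\<close>

definition minors2 :: "'a::comm_ring_1 mat \<Rightarrow> 'a set" where
  "minors2 A = {det (mat_of_cols 2 [col A i, col A j]) | i j. i < j \<and> j < dim_col A}"

definition scroll_ideal :: "nat \<Rightarrow> nat \<Rightarrow> 'k::field mpol set" where
  "scroll_ideal m p = Idl\<^bsub>S_ring (m + p)\<^esub> (minors2 (scroll_matrix m p))"

definition scroll_ring :: "nat \<Rightarrow> nat \<Rightarrow> 'k::field mpol set ring" where
  "scroll_ring m p = S_ring (m + p) Quot scroll_ideal m p"

definition residue_class :: "nat \<Rightarrow> nat \<Rightarrow> 'k::field mpol \<Rightarrow> 'k mpol set" where
  "residue_class m p f = scroll_ideal m p +>\<^bsub>S_ring (m + p)\<^esub> f"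

definition scroll_component :: "nat \<Rightarrow> nat \<Rightarrow> int \<Rightarrow> 'k::field mpol set set" where
  "scroll_component m p d = residue_class m p ` S_component (m + p) d"

definition scroll_maximal_ideal :: "nat \<Rightarrow> nat \<Rightarrow> 'k::field mpol set set" where
  "scroll_maximal_ideal m p =
    Idl\<^bsub>scroll_ring m p\<^esub> {residue_class m p (var i) | i. i \<in> {1..m + p}}"

text \<open>The residue field as a module over the scroll ring, concentrated in degree 0.\<close>

definition residue_module ::
  "nat \<Rightarrow> nat \<Rightarrow> ('k::field mpol set, 'k mpol set set) module" where
  "residue_module m p = quotient_module (scroll_ring m p) (scroll_maximal_ideal m p)"

definition residue_projection :: "nat \<Rightarrow> nat \<Rightarrow> 'k::field mpol set \<Rightarrow> 'k mpol set set" where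
  "residue_projection m p a = scroll_maximal_ideal m p +>\<^bsub>scroll_ring m p\<^esub> a"

definition residue_component :: "nat \<Rightarrow> nat \<Rightarrow> int \<Rightarrow> 'k::field mpol set set set" where
  "residue_component m p d = residue_projection m p ` scroll_component m p d"


section \<open>The matrices\<close>

text \<open>
  All matrices have entries 0 and plus or minus a variable. They are given by these representatives
  in S; only the differentials at the end are reduced modulo the scroll ideal.
\<close>

definition append_cols :: "'a::zero mat \<Rightarrow> 'a mat \<Rightarrow> 'a mat" (infixr \<open>@\<^sub>c\<close> 66) where
  "A @\<^sub>c B = four_block_mat A B (0\<^sub>m 0 (dim_col A)) (0\<^sub>m 0 (dim_col B))"

definition copies :: "nat \<Rightarrow> 'a::zero mat \<Rightarrow> 'a mat" where
  "copies d A = diag_block_mat (replicate d A)"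

definition phi0 :: "nat \<Rightarrow> nat \<Rightarrow> 'k::field mpol mat" where
  "phi0 m p = mat1 2 (m + p - 2) (\<lambda>i j.
     if i = 1 then (if j \<le> m - 1 then var (j + 1) else var (j + 2))
     else (if j \<le> m - 1 then - var j else - var (j + 1)))"

text \<open>In 0-based indices, column c belongs to the copy of phi0 number c div (n - 2), which
  occupies the rows with that number and the next one.\<close>

definition Phi :: "nat \<Rightarrow> nat \<Rightarrow> nat \<Rightarrow> 'k::field mpol mat" where
  "Phi m p d = (let w = m + p - 2 in
     mat d ((d - 1) * w) (\<lambda>(r, c).
       if r = c div w then phi0 m p $$ (0, c mod w)
       else if r = c div w + 1 then phi0 m p $$ (1, c mod w)
       else 0))"

definition N1 :: "nat \<Rightarrow> nat \<Rightarrow> 'k::field mpol mat" where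
  "N1 m p = mat1 (m - 1) (m + p - 2) (\<lambda>i j.
     if i = j then var (m + 1)
     else if i = m - 1 \<and> j \<ge> m then var (j + 2)
     else 0)"

definition N2 :: "nat \<Rightarrow> nat \<Rightarrow> 'k::field mpol mat" where
  "N2 m p = mat1 (p - 1) (m + p - 2) (\<lambda>i j.
     if i = 1 \<and> j \<le> m then - var j
     else if i \<ge> 2 \<and> j = m - 1 + i then - var m
     else 0)"

definition phi1 :: "nat \<Rightarrow> nat \<Rightarrow> 'k::field mpol mat" where
  "phi1 m p = (let w = m + p - 2 in
     (Phi m p (m - 1) @\<^sub>c N1 m p @\<^sub>c 0\<^sub>m (m - 1) ((p - 2) * w)) @\<^sub>r
     (0\<^sub>m (p - 1) ((m - 2) * w) @\<^sub>c N2 m p @\<^sub>c Phi m p (p - 1)))"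

definition u_block :: "nat \<Rightarrow> nat \<Rightarrow> nat \<Rightarrow> 'k::field mpol mat" where
  "u_block m p i = mat1 ((m - 2) * (m + p - 2)) (m + p - 2) (\<lambda>r j.
     if r = i * (m + p - 2) + m then (if j \<le> m - 1 then var j else var (j + 1)) else 0)"

definition v_block :: "nat \<Rightarrow> nat \<Rightarrow> nat \<Rightarrow> 'k::field mpol mat" where
  "v_block m p i = mat1 ((p - 2) * (m + p - 2)) (m + p - 2) (\<lambda>r j.
     if r = i * (m + p - 2) + m - 1 then (if j \<le> m - 1 then - var (j + 1) else - var (j + 2)) else 0)"

text \<open>The zero blocks of U and V make the total number of columns (n - 3)(n - 2): the remaining
  numbers of blocks are (n - 3) - (m - 2) = p - 1 and (n - 3) - (p - 2) = m - 1.\<close>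

definition U_mat :: "nat \<Rightarrow> nat \<Rightarrow> 'k::field mpol mat" where
  "U_mat m p = (let w = m + p - 2 in
     foldr (@\<^sub>c) (map (u_block m p) [0..<m - 2]) (0\<^sub>m ((m - 2) * w) ((p - 1) * w)))"

definition V_mat :: "nat \<Rightarrow> nat \<Rightarrow> 'k::field mpol mat" where
  "V_mat m p = (let w = m + p - 2 in
     0\<^sub>m ((p - 2) * w) ((m - 1) * w) @\<^sub>c
     foldr (@\<^sub>c) (map (v_block m p) [0..<p - 2]) (0\<^sub>m ((p - 2) * w) 0))"

definition phi2 :: "nat \<Rightarrow> nat \<Rightarrow> 'k::field mpol mat" where
  "phi2 m p = (let
     A = copies (m - 2) (phi1 m p);
     B = copies (p - 2) (phi1 m p);
     C = - Phi m p (m + p - 2)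
   in (A @\<^sub>c U_mat m p @\<^sub>c 0\<^sub>m (dim_row A) (dim_col B)) @\<^sub>r
      (0\<^sub>m (dim_row C) (dim_col A) @\<^sub>c C @\<^sub>c 0\<^sub>m (dim_row C) (dim_col B)) @\<^sub>r
      (0\<^sub>m (dim_row B) (dim_col A) @\<^sub>c V_mat m p @\<^sub>c B))"

fun phi :: "nat \<Rightarrow> nat \<Rightarrow> nat \<Rightarrow> 'k::field mpol mat" where
  "phi m p 0 = phi0 m p"
| "phi m p (Suc 0) = phi1 m p"
| "phi m p (Suc (Suc 0)) = phi2 m p"
| "phi m p (Suc (Suc (Suc i))) = diag_block_mat
     [copies (m - 2) (phi m p (Suc (Suc i))),
      copies (m + p - 3) (phi m p (Suc i)),
      copies (p - 2) (phi m p (Suc (Suc i)))]"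

text \<open>For i > 0, the matrices of the differentials number i for J, I1 and I2 are obtained with
  d = n - 1, d = m and d = p, respectively.\<close>

definition partial_block :: "nat \<Rightarrow> nat \<Rightarrow> nat \<Rightarrow> nat \<Rightarrow> 'k::field mpol mat" where
  "partial_block m p d i = (if i = 1 then Phi m p d else copies (d - 1) (phi m p (i - 1)))"

definition alpha0 :: "nat \<Rightarrow> nat \<Rightarrow> 'k::field mpol mat" where
  "alpha0 m p = mat1 (m + p) (m + p - 1) (\<lambda>i j.
     if i \<le> m \<and> i = j then var (m + 1)
     else if i = m \<and> j \<ge> m + 1 then var (j + 1)
     else if i = m + 1 \<and> j \<le> m then - var j
     else if i \<ge> m + 2 \<and> j = i - 1 then - var m
     else 0)"

definition alpha :: "nat \<Rightarrow> nat \<Rightarrow> nat \<Rightarrow> 'k::field mpol mat" where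
  "alpha m p i = (if i = 0 then alpha0 m p else
     (let l = (m + p - 2) * (m + p - 3) ^ (i - 1) in
      diag_block_mat [var (m + 1) \<cdot>\<^sub>m 1\<^sub>m ((m - 1) * l), - var m \<cdot>\<^sub>m 1\<^sub>m ((p - 1) * l)]))"

definition differential_lift :: "nat \<Rightarrow> nat \<Rightarrow> nat \<Rightarrow> 'k::field mpol mat" where
  "differential_lift m p i =
    (if i = 1 then mat1 1 (m + p) (\<lambda>_ j. var j)
     else if i = 2 then
       diag_block_mat [partial_block m p m 1, partial_block m p p 1] @\<^sub>c alpha m p 0
     else (let
         A = diag_block_mat [partial_block m p m (i - 1), partial_block m p p (i - 1)];
         C = - partial_block m p (m + p - 1) (i - 2)
       in four_block_mat A (alpha m p (i - 2)) (0\<^sub>m (dim_row C) (dim_col A)) C))"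

definition differential :: "nat \<Rightarrow> nat \<Rightarrow> nat \<Rightarrow> 'k::field mpol set mat" where
  "differential m p i = map_mat (residue_class m p) (differential_lift m p i)"

definition scroll_rank :: "nat \<Rightarrow> nat \<Rightarrow> nat" where
  "scroll_rank n i = (if i = 0 then 1 else if i = 1 then n else if i = 2 then n ^ 2 - 3 * n + 3
     else (n - 2) ^ 3 * (n - 3) ^ (i - 3))"

end

theory Submission
  imports Defs "HOL-Library.Product_Plus"
begin

text \<open>
  Write w = n - 2 for the number of columns of the scroll matrix M. The assignment
  x_i \<mapsto> a t^(i-1) for i \<le> m and x_(m+j) \<mapsto> b t^(j-1) for 1 \<le> j \<le> p
  identifies R with the span of the monomials a^i b^j t^e such that e \<le> i (m-1) + j (p-1) in the
  polynomial ring k[a,b,t] (lemmas \<open>parametrization_kernel\<close> and \<open>parametrization_image\<close>). That the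
  2-minors generate the whole kernel is a straightening argument: modulo the minors, one
  factor of a monomial can be shifted step by step at the expense of another one, so that monomials
  with the same image are congruent.
  
  Let L d be the span of the monomials a^i b^j t^e with e \<le> i (m-1) + j (p-1) + d. For
  d \<ge> 1, the R-module L (d-1) is generated by 1, t, ..., t^(d-1), and the relations between these
  generators are the columns of Phi d (lemma \<open>power_form_kernel\<close>): in a relation, the coefficient of 1 is
  divisible by t, hence it is a combination of the second row of M, and it can be removed by means of
  columns of Phi d.
  
  If d - e = m - p, the submodules a L (d-1) and b L (e-1) of k[a,b,t] intersect in
  a b L (q-1) with q = d + p - 1. So the relations between the generators of a L (d-1) + b L (e-1) are
  given by Phi d, Phi e and by blocks N1, N2 that express a b t^j in both submodules
  (lemma \<open>glue_kernel\<close>), and the relations between these relations are obtained from those of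
  Phi d, Phi e and L (q-1) (lemma \<open>glue_syzygies\<close>). This is used twice. With (d, e) = (m-1, p-1) it
  shows that phi1 gives the syzygies of the first row of M, and phi2 those of phi1. With
  (d, e) = (m, p) it gives the exactness of the complex at R^n and at the next module, since
  a L (m-1) + b L (p-1) is the maximal ideal.
  
  An element of the kernel of Phi d is a sequence of relations on the first row of M, because the
  second row is t times the first one. Hence copies of phi1 resolve Phi d, and the
  remaining steps are formal: the kernel of phi2 splits into blocks, as U and V vanish on
  the kernel of Phi w, and the higher differentials are mapping cones (lemma \<open>exact_cone\<close>).
  All entries of the matrices are 0 or plus or minus a variable. This gives both the minimality and the
  grading, where the basis elements in homological degree i have degree i.
\<close>

section \<open>Polynomials and maps of exponents\<close>

text \<open>
  The linear map that sends the monomial with exponent k to the monomial with exponent g k. It is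
  multiplicative if g is additive.
\<close>

definition push :: "('a \<Rightarrow> 'b) \<Rightarrow> ('a \<Rightarrow>\<^sub>0 'k::comm_monoid_add) \<Rightarrow> ('b \<Rightarrow>\<^sub>0 'k)" where
  "push g f = (\<Sum>k\<in>Poly_Mapping.keys f. Poly_Mapping.single (g k) (Poly_Mapping.lookup f k))"

lemma push_superset:
  assumes "finite K" "Poly_Mapping.keys f \<subseteq> K"
  shows "push g f = (\<Sum>k\<in>K. Poly_Mapping.single (g k) (Poly_Mapping.lookup f k))"
  unfolding push_def using assms
  by (intro sum.mono_neutral_left) (auto simp: in_keys_iff)

lemma push_zero [simp]: "push g 0 = 0"
  by (simp add: push_def)

lemma push_add: "push g (f + h) = push g f + push g h"
proof -
  let ?K = "Poly_Mapping.keys f \<union> Poly_Mapping.keys h"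
  have "Poly_Mapping.keys (f + h) \<subseteq> ?K" by (rule Poly_Mapping.keys_add)
  then show ?thesis
    by (simp add: push_superset[of ?K] lookup_add single_add sum.distrib)
qed

lemma push_single [simp]: "push g (Poly_Mapping.single k c) = Poly_Mapping.single (g k) c"
  by (subst push_superset[of "{k}"]) auto

lemma push_sum: "push g (\<Sum>i\<in>I. f i) = (\<Sum>i\<in>I. push g (f i))"
  by (induction I rule: infinite_finite_induct) (auto simp: push_add)

lemma sum_monomials:
  "(\<Sum>k\<in>Poly_Mapping.keys f. Poly_Mapping.single k (Poly_Mapping.lookup f k)) = f"
  by (rule poly_mapping_eqI)
    (auto simp: lookup_sum lookup_single when_def sum.delta in_keys_iff)

lemma push_id: "push (\<lambda>k. k) f = f"
  by (simp add: push_def sum_monomials)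

lemma push_push: "push g (push h f) = push (\<lambda>k. g (h k)) f"
  by (simp add: push_def[of h] push_sum) (simp add: push_def)

lemma push_uminus: "push g (- f) = - push g (f :: 'a \<Rightarrow>\<^sub>0 'k::ab_group_add)"
proof -
  have "push g (- f) + push g f = 0"
    by (simp flip: push_add)
  then show ?thesis by (simp add: eq_neg_iff_add_eq_0)
qed

lemma push_diff: "push g (f - h) = push g f - push g (h :: 'a \<Rightarrow>\<^sub>0 'k::ab_group_add)"
  using push_add[of g f "-h"] by (simp add: push_uminus)

lemma push_mult:
  fixes g :: "'a::comm_monoid_add \<Rightarrow> 'b::comm_monoid_add"
    and f h :: "'a \<Rightarrow>\<^sub>0 'k::comm_semiring_1"
  assumes "\<And>k l. g (k + l) = g k + g l"
  shows "push g (f * h) = push g f * push g h"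
proof -
  have "f * h = (\<Sum>k\<in>Poly_Mapping.keys f. Poly_Mapping.single k (Poly_Mapping.lookup f k)) *
     (\<Sum>k\<in>Poly_Mapping.keys h. Poly_Mapping.single k (Poly_Mapping.lookup h k))"
    by (simp add: sum_monomials)
  also have "\<dots> = (\<Sum>k\<in>Poly_Mapping.keys f. \<Sum>l\<in>Poly_Mapping.keys h.
      Poly_Mapping.single (k + l) (Poly_Mapping.lookup f k * Poly_Mapping.lookup h l))"
    by (simp add: sum_product mult_single)
  finally have "push g (f * h) = (\<Sum>k\<in>Poly_Mapping.keys f. \<Sum>l\<in>Poly_Mapping.keys h.
      Poly_Mapping.single (g k + g l) (Poly_Mapping.lookup f k * Poly_Mapping.lookup h l))"
    by (simp add: push_sum assms)
  also have "\<dots> = push g f * push g h"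
    by (simp add: push_def sum_product mult_single)
  finally show ?thesis .
qed

lemma keys_push: "Poly_Mapping.keys (push g f) \<subseteq> g ` Poly_Mapping.keys f"
proof
  fix x assume x: "x \<in> Poly_Mapping.keys (push g f)"
  show "x \<in> g ` Poly_Mapping.keys f"
  proof (rule ccontr)
    assume "x \<notin> g ` Poly_Mapping.keys f"
    then have "Poly_Mapping.lookup (push g f) x = 0"
      by (auto simp: push_def lookup_sum lookup_single when_def intro!: sum.neutral)
    with x show False by (simp add: in_keys_iff)
  qed
qed

lemma keys_sum_subset:
  assumes "\<And>i. i \<in> I \<Longrightarrow> Poly_Mapping.keys (f i) \<subseteq> K"
  shows "Poly_Mapping.keys (\<Sum>i\<in>I. f i) \<subseteq> K"
  using assms
proof (induction I rule: infinite_finite_induct)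
  case (insert x F)
  then show ?case
    using Poly_Mapping.keys_add[of "f x" "sum f F"] by auto
qed auto

text \<open>
  If every monomial of f is the product of one of finitely many given monomials and of a monomial
  with exponent in K, then f is a combination of the given monomials whose coefficients only involve
  exponents in K. All divisibility arguments below are instances of this.
\<close>

lemma split_by_monomials:
  fixes f :: "'a::comm_monoid_add \<Rightarrow>\<^sub>0 'k::comm_semiring_1"
  assumes C: "finite C"
    and f: "\<And>k. k \<in> Poly_Mapping.keys f \<Longrightarrow> \<exists>c\<in>C. \<exists>l\<in>K. k = g c + l"
  shows "\<exists>y. (\<forall>c. Poly_Mapping.keys (y c) \<subseteq> K) \<and>
    f = (\<Sum>c\<in>C. Poly_Mapping.single (g c) 1 * y c)"
proof -
  from f obtain c l where cl: "\<And>k. k \<in> Poly_Mapping.keys f \<Longrightarrow> c k \<in> C \<and> l k \<in> K \<and> k = g (c k) + l k"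
    by metis
  define y where "y d = (\<Sum>k\<in>{k\<in>Poly_Mapping.keys f. c k = d}.
    Poly_Mapping.single (l k) (Poly_Mapping.lookup f k))" for d
  have "f = (\<Sum>k\<in>Poly_Mapping.keys f. Poly_Mapping.single k (Poly_Mapping.lookup f k))"
    by (simp add: sum_monomials)
  also have "\<dots> = (\<Sum>k\<in>Poly_Mapping.keys f.
      Poly_Mapping.single (g (c k)) 1 * Poly_Mapping.single (l k) (Poly_Mapping.lookup f k))"
    using cl by (intro sum.cong refl) (metis mult_1 mult_single)
  also have "\<dots> = (\<Sum>d\<in>C. \<Sum>k\<in>{k\<in>Poly_Mapping.keys f. c k = d}.
      Poly_Mapping.single (g (c k)) 1 * Poly_Mapping.single (l k) (Poly_Mapping.lookup f k))"
    using cl C by (intro sum.group[symmetric]) auto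
  also have "\<dots> = (\<Sum>d\<in>C. Poly_Mapping.single (g d) 1 * y d)"
    by (simp add: y_def sum_distrib_left)
  finally have "f = \<dots>" .
  moreover have "Poly_Mapping.keys (y d) \<subseteq> K" for d
    unfolding y_def using cl by (intro keys_sum_subset) auto
  ultimately show ?thesis by blast
qed

lemma lookup_single_mult:
  fixes f :: "'a::cancel_comm_monoid_add \<Rightarrow>\<^sub>0 'k::comm_semiring_1"
  shows "Poly_Mapping.lookup (Poly_Mapping.single k 1 * f) (k + l) = Poly_Mapping.lookup f l"
  by (simp add: lookup_mult lookup_single when_mult flip: mult_when)

lemma keys_single_mult:
  fixes f :: "'a::cancel_comm_monoid_add \<Rightarrow>\<^sub>0 'k::comm_semiring_1"
  shows "Poly_Mapping.keys (Poly_Mapping.single k 1 * f) = (+) k ` Poly_Mapping.keys f"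
proof
  show "Poly_Mapping.keys (Poly_Mapping.single k 1 * f) \<subseteq> (+) k ` Poly_Mapping.keys f"
    using keys_mult[of "Poly_Mapping.single k 1" f] by auto
qed (auto simp: in_keys_iff lookup_single_mult)

lemma single_mult_cancel:
  fixes f h :: "'a::cancel_comm_monoid_add \<Rightarrow>\<^sub>0 'k::comm_semiring_1"
  assumes "Poly_Mapping.single k 1 * f = Poly_Mapping.single k 1 * h"
  shows "f = h"
  using assms by (intro poly_mapping_eqI) (metis lookup_single_mult)

section \<open>The polynomial ring\<close>

text \<open>
  The exponents of the monomials in the variables 1, ..., n.
\<close>

definition monomials :: "nat \<Rightarrow> (nat \<Rightarrow>\<^sub>0 nat) set" where
  "monomials n = {k. Poly_Mapping.keys k \<subseteq> {1..n}}"

lemma monomials_zero [simp]: "0 \<in> monomials n"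
  by (simp add: monomials_def)

lemma monomials_add: "k \<in> monomials n \<Longrightarrow> l \<in> monomials n \<Longrightarrow> k + l \<in> monomials n"
  unfolding monomials_def using Poly_Mapping.keys_add[of k l] by auto

lemma keys_add_nat:
  "Poly_Mapping.keys (k + l) = Poly_Mapping.keys k \<union> Poly_Mapping.keys (l :: 'a \<Rightarrow>\<^sub>0 nat)"
  by (auto simp: in_keys_iff lookup_add)

lemma monomials_add_iff: "k + l \<in> monomials n \<longleftrightarrow> k \<in> monomials n \<and> l \<in> monomials n"
  by (auto simp: monomials_def keys_add_nat)

lemma monomials_single [simp]: "Poly_Mapping.single i 1 \<in> monomials n \<longleftrightarrow> i \<in> {1..n}"
  by (simp add: monomials_def)

lemma monomials_single_Suc [simp]: "Poly_Mapping.single i (Suc 0) \<in> monomials n \<longleftrightarrow> i \<in> {1..n}"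
  by (simp add: monomials_def)

lemma carrier_S_ring: "carrier (S_ring n) = {f. Poly_Mapping.keys f \<subseteq> monomials n}"
  by (auto simp: S_ring_def monomials_def)

lemma S_ring_simps [simp]:
  "mult (S_ring n) = (*)" "one (S_ring n) = 1" "zero (S_ring n) = 0" "add (S_ring n) = (+)"
  by (simp_all add: S_ring_def)

lemma S_carrier_add: "f \<in> carrier (S_ring n) \<Longrightarrow> g \<in> carrier (S_ring n) \<Longrightarrow> f + g \<in> carrier (S_ring n)"
  unfolding carrier_S_ring using Poly_Mapping.keys_add[of f g] by blast

lemma S_carrier_mult: "f \<in> carrier (S_ring n) \<Longrightarrow> g \<in> carrier (S_ring n) \<Longrightarrow> f * g \<in> carrier (S_ring n)"
  unfolding carrier_S_ring using keys_mult[of f g] monomials_add by blast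

lemma keys_uminus [simp]: "Poly_Mapping.keys (- f) = Poly_Mapping.keys (f :: 'a \<Rightarrow>\<^sub>0 'k::ab_group_add)"
  by (auto simp: in_keys_iff)

lemma S_carrier_uminus: "f \<in> carrier (S_ring n) \<Longrightarrow> - f \<in> carrier (S_ring n)"
  unfolding carrier_S_ring by simp

lemma S_carrier_single: "k \<in> monomials n \<Longrightarrow> Poly_Mapping.single k c \<in> carrier (S_ring n)"
  unfolding carrier_S_ring by simp

lemma S_carrier_0 [simp]: "0 \<in> carrier (S_ring n)"
  and S_carrier_1 [simp]: "1 \<in> carrier (S_ring n)"
  by (simp_all add: carrier_S_ring)

lemma S_carrier_sum: "(\<And>i. i \<in> X \<Longrightarrow> f i \<in> carrier (S_ring n)) \<Longrightarrow> sum f X \<in> carrier (S_ring n)"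
  by (induction X rule: infinite_finite_induct) (auto intro: S_carrier_add)

lemma S_carrier_var: "i \<in> {1..n} \<Longrightarrow> var i \<in> carrier (S_ring n)"
  unfolding var_def by (intro S_carrier_single) simp

lemma cring_S_ring: "cring (S_ring n :: 'k::field mpol ring)"
proof (rule cringI)
  show "abelian_group (S_ring n :: 'k mpol ring)"
  proof (rule abelian_groupI)
    fix x :: "'k mpol" assume "x \<in> carrier (S_ring n)"
    then show "\<exists>y\<in>carrier (S_ring n). y \<oplus>\<^bsub>S_ring n\<^esub> x = \<zero>\<^bsub>S_ring n\<^esub>"
      by (intro bexI[of _ "- x"]) (auto intro: S_carrier_uminus)
  qed (auto intro: S_carrier_add simp: algebra_simps)
  show "comm_monoid (S_ring n :: 'k mpol ring)"
    by (rule comm_monoidI) (auto intro: S_carrier_mult simp: algebra_simps)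
qed (auto simp: algebra_simps)

lemma S_a_inv: "f \<in> carrier (S_ring n) \<Longrightarrow> \<ominus>\<^bsub>S_ring n\<^esub> f = - (f :: 'k::field mpol)"
proof -
  assume f: "f \<in> carrier (S_ring n)"
  interpret cring "S_ring n :: 'k mpol ring" by (rule cring_S_ring)
  show ?thesis using f by (intro minus_equality) (auto intro: S_carrier_uminus)
qed

section \<open>Straightening of monomials modulo the minors\<close>

text \<open>
  In the parametrization, the variable number i becomes a monomial in a, b and t, of exponents
  \<open>a_degree i\<close>, \<open>b_degree i\<close> and \<open>t_degree i\<close>. The largest t-degree of a variable with the same
  a- and b-degree as the variable i is \<open>t_bound i\<close>.
\<close>

locale scroll =
  fixes m p :: nat
  assumes m2: "m \<ge> 2" and p2: "p \<ge> 2"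
begin

definition a_degree :: "nat \<Rightarrow> nat" where "a_degree i = (if i \<le> m then 1 else 0)"
definition b_degree :: "nat \<Rightarrow> nat" where "b_degree i = (if i \<le> m then 0 else 1)"
definition t_degree :: "nat \<Rightarrow> nat" where "t_degree i = (if i \<le> m then i - 1 else i - m - 1)"
definition t_bound :: "nat \<Rightarrow> nat" where "t_bound i = (if i \<le> m then m - 1 else p - 1)"

end

text \<open>
  The degree of a monomial for given weights of the variables.
\<close>

definition wsum :: "(nat \<Rightarrow> nat) \<Rightarrow> (nat \<Rightarrow>\<^sub>0 nat) \<Rightarrow> nat" where
  "wsum c k = (\<Sum>i\<in>Poly_Mapping.keys k. Poly_Mapping.lookup k i * c i)"

lemma wsum_superset:
  assumes "finite K" "Poly_Mapping.keys k \<subseteq> K"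
  shows "wsum c k = (\<Sum>i\<in>K. Poly_Mapping.lookup k i * c i)"
  unfolding wsum_def using assms by (intro sum.mono_neutral_left) (auto simp: in_keys_iff)

lemma wsum_add: "wsum c (k + l) = wsum c k + wsum c l"
proof -
  let ?K = "Poly_Mapping.keys k \<union> Poly_Mapping.keys l"
  have "wsum c (k + l) = (\<Sum>i\<in>?K. Poly_Mapping.lookup (k + l) i * c i)"
    by (rule wsum_superset) (simp_all add: keys_add_nat)
  also have "\<dots> = (\<Sum>i\<in>?K. Poly_Mapping.lookup k i * c i) + (\<Sum>i\<in>?K. Poly_Mapping.lookup l i * c i)"
    by (simp only: lookup_add add_mult_distrib sum.distrib)
  also have "\<dots> = wsum c k + wsum c l"
    by (subst (1 2) wsum_superset[of ?K]) simp_all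
  finally show ?thesis .
qed

lemma wsum_zero [simp]: "wsum c 0 = 0"
  by (simp add: wsum_def)

lemma wsum_single [simp]: "wsum c (Poly_Mapping.single i n) = n * c i"
  by (subst wsum_superset[of "{i}"]) auto

lemma wsum_mono: "(\<And>i. i \<in> Poly_Mapping.keys k \<Longrightarrow> c i \<le> d i) \<Longrightarrow> wsum c k \<le> wsum d k"
  unfolding wsum_def by (intro sum_mono mult_left_mono) auto

lemma wsum_positive:
  assumes "wsum c k > 0" obtains i where "i \<in> Poly_Mapping.keys k" "c i > 0"
proof -
  have "\<exists>i\<in>Poly_Mapping.keys k. c i > 0"
  proof (rule ccontr)
    assume "\<not> ?thesis"
    then have "wsum c k = 0" unfolding wsum_def by (intro sum.neutral) auto
    with assms show False by simp
  qed
  then show ?thesis using that by blast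
qed

lemma wsum_less:
  assumes "wsum c k < wsum d k" obtains i where "i \<in> Poly_Mapping.keys k" "c i < d i"
  using assms wsum_mono[of k d c] by (meson not_less)

lemma in_keys_split:
  fixes k :: "nat \<Rightarrow>\<^sub>0 nat"
  assumes "i \<in> Poly_Mapping.keys k"
  obtains l where "k = Poly_Mapping.single i 1 + l"
proof -
  have "k = Poly_Mapping.single i 1 + (k - Poly_Mapping.single i 1)"
    using assms
    by (intro poly_mapping_eqI) (auto simp: lookup_add lookup_minus lookup_single when_def in_keys_iff)
  then show ?thesis using that by blast
qed

lemma det_two:
  assumes A: "A \<in> carrier_mat 2 2"
  shows "det A = A $$ (0,0) * A $$ (1,1) - A $$ (0,1) * (A $$ (1,0) :: 'a::comm_ring_1)"
proof -
  have "det (mat_delete A i 0) = mat_delete A i 0 $$ (0,0)" if "i < 2" for i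
    using A that by (intro det_single) (auto simp: mat_delete_def)
  then show ?thesis
    using A laplace_expansion_column[OF A, of 0]
    by (simp add: numeral_2_eq_2 cofactor_def mat_delete_def mult.commute)
qed

context scroll begin

text \<open>
  The exponents of a, b and t in the image of a monomial in the variables of S.
\<close>

definition expo :: "(nat \<Rightarrow>\<^sub>0 nat) \<Rightarrow> nat \<times> nat \<times> nat" where
  "expo k = (wsum a_degree k, wsum b_degree k, wsum t_degree k)"

lemma expo_add: "expo (k + l) = expo k + expo l"
  by (simp add: expo_def wsum_add)

lemma expo_zero [simp]: "expo 0 = 0"
  by (simp add: expo_def zero_prod_def)

text \<open>
  The exponents (i, j, e) of the monomials a^i b^j t^e that span L d. For d = 0 these are
  the exponents of the images of the monomials of S.
\<close>

definition cone :: "nat \<Rightarrow> (nat \<times> nat \<times> nat) set" where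
  "cone d = {(i, j, e). e \<le> i * (m - 1) + j * (p - 1) + d}"

lemma wsum_t_bound: "wsum t_bound k = wsum a_degree k * (m - 1) + wsum b_degree k * (p - 1)"
  unfolding wsum_def sum_distrib_right sum.distrib[symmetric]
  by (intro sum.cong refl) (auto simp: t_bound_def a_degree_def b_degree_def)

lemma expo_in_cone:
  assumes "k \<in> monomials (m + p)" shows "expo k \<in> cone 0"
proof -
  have "wsum t_degree k \<le> wsum t_bound k"
    using assms m2 p2 by (intro wsum_mono) (auto simp: t_degree_def t_bound_def monomials_def)
  then show ?thesis by (simp add: expo_def cone_def wsum_t_bound)
qed

text \<open>
  The indices u such that the entries of some column of the scroll matrix are the variables number
  u and u + 1.
\<close>

definition column_index :: "nat \<Rightarrow> bool" where
  "column_index i \<longleftrightarrow> 1 \<le> i \<and> i < m + p \<and> i \<noteq> m"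

lemma scroll_matrix_carrier:
  "scroll_matrix m p \<in> carrier_mat 2 (m + p - 2)"
  by (simp add: scroll_matrix_def mat1_def)

lemma scroll_minor:
  assumes "c < m + p - 2" "d < m + p - 2"
  shows "det (mat_of_cols 2 [col (scroll_matrix m p) c, col (scroll_matrix m p) d]) =
     scroll_matrix m p $$ (0, c) * scroll_matrix m p $$ (1, d)
     - scroll_matrix m p $$ (0, d) * (scroll_matrix m p $$ (1, c) :: 'k::field mpol)"
proof -
  let ?M = "mat_of_cols 2 [col (scroll_matrix m p) c, col (scroll_matrix m p) d] :: 'k mpol mat"
  have "?M \<in> carrier_mat 2 2" by (auto simp: mat_of_cols_def numeral_2_eq_2)
  then have "det ?M = ?M $$ (0,0) * ?M $$ (1,1) - ?M $$ (0,1) * ?M $$ (1,0)"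
    by (rule det_two)
  then show ?thesis
    using assms scroll_matrix_carrier by (auto simp: mat_of_cols_index scroll_matrix_def mat1_def)
qed

lemma scroll_entry:
  assumes "column_index u"
  obtains c where "c < m + p - 2" "scroll_matrix m p $$ (0, c) = (var u :: 'k::field mpol)"
    "scroll_matrix m p $$ (1, c) = (var (u + 1) :: 'k::field mpol)"
proof (cases "u < m")
  \<comment> \<open>Columns are numbered from 0, and no column starts with the variable m.\<close>
  case True
  then show ?thesis using assms m2 p2
    by (intro that[of "u - 1"]) (auto simp: column_index_def scroll_matrix_def mat1_def)
next
  case False
  then show ?thesis using assms m2 p2
    by (intro that[of "u - 2"]) (auto simp: column_index_def scroll_matrix_def mat1_def Suc_diff_Suc numeral_2_eq_2)
qed

lemma minors_carrier: "minors2 (scroll_matrix m p) \<subseteq> carrier (S_ring (m + p) :: 'k::field mpol ring)"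
proof
  fix x :: "'k mpol" assume "x \<in> minors2 (scroll_matrix m p)"
  then obtain c d where cd: "c < d" "d < m + p - 2"
    and x: "x = det (mat_of_cols 2 [col (scroll_matrix m p) c, col (scroll_matrix m p) d])"
    using scroll_matrix_carrier[where 'a='k] unfolding minors2_def by auto
  have "scroll_matrix m p $$ (i, e) \<in> carrier (S_ring (m + p) :: 'k mpol ring)"
    if "i < 2" "e < m + p - 2" for i e
    using that by (auto simp: scroll_matrix_def mat1_def intro!: S_carrier_var)
  then show "x \<in> carrier (S_ring (m + p))"
    using cd unfolding x
    by (subst scroll_minor)
      (auto simp only: diff_conv_add_uminus intro!: S_carrier_add S_carrier_uminus S_carrier_mult)
qed

lemma ideal_scroll: "ideal (scroll_ideal m p) (S_ring (m + p) :: 'k::field mpol ring)"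
proof -
  interpret cring "S_ring (m + p) :: 'k mpol ring" by (rule cring_S_ring)
  show ?thesis unfolding scroll_ideal_def by (rule genideal_ideal[OF minors_carrier])
qed

lemma scroll_ideal_zero: "0 \<in> (scroll_ideal m p :: 'k::field mpol set)"
  using additive_subgroup.zero_closed[OF ideal.axioms(1)[OF ideal_scroll]] by simp

lemma scroll_ideal_add:
  "f \<in> scroll_ideal m p \<Longrightarrow> g \<in> scroll_ideal m p \<Longrightarrow> f + g \<in> (scroll_ideal m p :: 'k::field mpol set)"
  using additive_subgroup.a_closed[OF ideal.axioms(1)[OF ideal_scroll]] by fastforce

lemma scroll_ideal_mult:
  "f \<in> scroll_ideal m p \<Longrightarrow> g \<in> carrier (S_ring (m + p)) \<Longrightarrow> g * f \<in> (scroll_ideal m p :: 'k::field mpol set)"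
  using ideal.I_l_closed[OF ideal_scroll] by fastforce

lemma scroll_ideal_uminus:
  "f \<in> scroll_ideal m p \<Longrightarrow> - f \<in> (scroll_ideal m p :: 'k::field mpol set)"
  using scroll_ideal_mult[of f "-1"] by (simp add: S_carrier_uminus)

lemma scroll_ideal_sum:
  "(\<And>i. i \<in> X \<Longrightarrow> f i \<in> scroll_ideal m p) \<Longrightarrow> sum f X \<in> (scroll_ideal m p :: 'k::field mpol set)"
  by (induction X rule: infinite_finite_induct) (auto intro: scroll_ideal_zero scroll_ideal_add)

lemma minor_in_scroll_ideal:
  assumes "column_index u" "column_index v"
  shows "var u * var (v + 1) - var (u + 1) * var v \<in> (scroll_ideal m p :: 'k::field mpol set)"
proof -
  interpret cring "S_ring (m + p) :: 'k mpol ring" by (rule cring_S_ring)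
  let ?M = "scroll_matrix m p :: 'k mpol mat"
  have I: "minors2 ?M \<subseteq> scroll_ideal m p"
    unfolding scroll_ideal_def by (rule genideal_self[OF minors_carrier])
  obtain c where c: "c < m + p - 2" "?M $$ (0, c) = var u" "?M $$ (1, c) = var (u + 1)"
    using scroll_entry[OF assms(1)] by metis
  obtain d where d: "d < m + p - 2" "?M $$ (0, d) = var v" "?M $$ (1, d) = var (v + 1)"
    using scroll_entry[OF assms(2)] by metis
  have minor: "?M $$ (0, i) * ?M $$ (1, j) - ?M $$ (0, j) * ?M $$ (1, i) \<in> scroll_ideal m p"
    if "i < j" "j < m + p - 2" for i j
    using I that scroll_minor[of i j] scroll_matrix_carrier[where 'a='k] unfolding minors2_def
    by (smt (verit) carrier_matD(2) mem_Collect_eq order.strict_trans subsetD)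
  consider "c < d" | "c = d" | "d < c" by linarith
  then show ?thesis
  proof cases
    case 1 then show ?thesis using minor[OF 1] c d by (simp add: mult.commute)
  next
    case 2
    then have "var u * var (v + 1) - var (u + 1) * var v = (0 :: 'k mpol)"
      using c d by (metis diff_self mult.commute)
    then show ?thesis by (simp add: scroll_ideal_zero)
  next
    case 3 then show ?thesis
      using scroll_ideal_uminus[OF minor[OF 3]] c d by (simp add: mult.commute)
  qed
qed

text \<open>
  Congruence of monomials modulo the scroll ideal. The type argument fixes the ground field.
\<close>

definition monomial_cong :: "'k::field itself \<Rightarrow> (nat \<Rightarrow>\<^sub>0 nat) \<Rightarrow> (nat \<Rightarrow>\<^sub>0 nat) \<Rightarrow> bool" where
  "monomial_cong _ k l \<longleftrightarrow>
    Poly_Mapping.single k 1 - Poly_Mapping.single l 1 \<in> (scroll_ideal m p :: 'k mpol set)"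

lemma monomial_cong_refl: "monomial_cong TYPE('k::field) k k"
  by (simp add: monomial_cong_def scroll_ideal_zero)

lemma monomial_cong_trans:
  "monomial_cong TYPE('k::field) k l \<Longrightarrow> monomial_cong TYPE('k::field) l q \<Longrightarrow> monomial_cong TYPE('k::field) k q"
  unfolding monomial_cong_def by (drule (1) scroll_ideal_add) simp

lemma monomial_cong_add:
  assumes "monomial_cong TYPE('k::field) k l" "q \<in> monomials (m + p)"
  shows "monomial_cong TYPE('k::field) (k + q) (l + q)"
proof -
  have "Poly_Mapping.single q 1 * (Poly_Mapping.single k 1 - Poly_Mapping.single l 1)
      \<in> (scroll_ideal m p :: 'k mpol set)"
    using assms by (intro scroll_ideal_mult) (auto simp: monomial_cong_def S_carrier_single)
  then show ?thesis by (simp add: monomial_cong_def algebra_simps mult_single)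
qed

lemma monomial_cong_swap:
  assumes "column_index u" "column_index v"
  shows "monomial_cong TYPE('k::field) (Poly_Mapping.single u 1 + Poly_Mapping.single (v + 1) 1)
      (Poly_Mapping.single (u + 1) 1 + Poly_Mapping.single v 1)"
  using minor_in_scroll_ideal[OF assms, where 'k='k]
  by (simp add: monomial_cong_def var_def mult_single)

text \<open>
  If the image of a monomial k is divisible, in the image of S, by the image of the variable l, then
  k is congruent to a multiple of the variable l. To see this, take a factor u of k of the same
  kind as l. If u < l, then some other factor has positive t-degree, and a minor
  moves one power of t from it to u. If l < u, then some other factor is not of maximal t-degree, and a
  minor moves one power of t from u to it.
\<close>

lemma straighten_step:
  assumes "k \<in> monomials (m + p)" "u \<in> Poly_Mapping.keys k" "l \<in> {1..m + p}"
    and "u \<le> m \<longleftrightarrow> l \<le> m"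
    and "expo k = expo (Poly_Mapping.single l 1) + r" "r \<in> cone 0"
  shows "\<exists>q. q \<in> monomials (m + p) \<and> expo q = r \<and>
     monomial_cong TYPE('k::field) k (Poly_Mapping.single l 1 + q)"
  using assms
proof (induction "if u \<le> l then l - u else u - l" arbitrary: k u rule: less_induct)
  case less
  obtain k1 where k1: "k = Poly_Mapping.single u 1 + k1"
    using in_keys_split less.prems(2) by blast
  have k1': "k1 \<in> monomials (m + p)" and u: "u \<in> {1..m + p}"
    using less.prems(1) unfolding k1 monomials_add_iff by auto
  obtain i j e where r: "r = (i, j, e)" by (cases r)
  have e: "e \<le> i * (m - 1) + j * (p - 1)"
    using less.prems(6) by (simp add: r cone_def)
  from less.prems(4,5) have exp: "wsum a_degree k1 = i" "wsum b_degree k1 = j"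
    "t_degree u + wsum t_degree k1 = t_degree l + e"
    by (auto simp: r k1 expo_def wsum_add a_degree_def b_degree_def split: if_splits)
  consider "u = l" | "u < l" | "l < u" by linarith
  then show ?case
  proof cases
    case 1
    then have "expo k1 = r"
      using exp by (simp add: expo_def r)
    with 1 k1 k1' show ?thesis using monomial_cong_refl by blast
  next
    case 2
    then have t: "t_degree u < t_degree l" using less.prems(4) u by (auto simp: t_degree_def)
    then have "wsum t_degree k1 > 0" using exp by linarith
    then obtain v where v: "v \<in> Poly_Mapping.keys k1" "t_degree v > 0" by (rule wsum_positive)
    obtain k2 where k2: "k1 = Poly_Mapping.single v 1 + k2"
      using in_keys_split v(1) by blast
    have k2': "k2 \<in> monomials (m + p)" and v': "v \<in> {1..m + p}"
      using k1' unfolding k2 monomials_add_iff by auto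
    have cu: "column_index u" using u 2 less.prems(3,4) by (auto simp: column_index_def)
    have cv: "column_index (v - 1)" using v v' by (auto simp: column_index_def t_degree_def split: if_splits)
    let ?k = "(Poly_Mapping.single (u + 1) 1 + Poly_Mapping.single (v - 1) 1) + k2"
    have cong: "monomial_cong TYPE('k) k ?k"
      using monomial_cong_add[OF monomial_cong_swap[OF cu cv] k2'] v' by (simp add: k1 k2 add.assoc)
    have mon: "?k \<in> monomials (m + p)"
      using cu cv k2' unfolding monomials_add_iff by (auto simp: column_index_def)
    have same: "expo ?k = expo k"
      unfolding k1 k2 using v v' u cu less.prems(3,4) 2
      by (auto simp: expo_def wsum_add a_degree_def b_degree_def t_degree_def column_index_def
          split: if_splits)
    have "\<exists>q. q \<in> monomials (m + p) \<and> expo q = r \<and>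
        monomial_cong TYPE('k) ?k (Poly_Mapping.single l 1 + q)"
      using 2 less.prems(3-6) mon same
      by (intro less.hyps[of "u + 1"]) (auto simp: keys_add_nat)
    with cong show ?thesis using monomial_cong_trans by blast
  next
    case 3
    then have t: "t_degree u > t_degree l" using less.prems(3,4) by (auto simp: t_degree_def)
    then have "wsum t_degree k1 < e" using exp by linarith
    also have "e \<le> wsum t_bound k1" using e exp by (simp add: wsum_t_bound)
    finally obtain v where v: "v \<in> Poly_Mapping.keys k1" "t_degree v < t_bound v" by (rule wsum_less)
    obtain k2 where k2: "k1 = Poly_Mapping.single v 1 + k2"
      using in_keys_split v(1) by blast
    have k2': "k2 \<in> monomials (m + p)" and v': "v \<in> {1..m + p}"
      using k1' unfolding k2 monomials_add_iff by auto
    have cu: "column_index (u - 1)" using u 3 less.prems(3,4) by (auto simp: column_index_def)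
    have cv: "column_index v" using v v' by (auto simp: column_index_def t_degree_def t_bound_def split: if_splits)
    let ?k = "(Poly_Mapping.single (u - 1) 1 + Poly_Mapping.single (v + 1) 1) + k2"
    have cong: "monomial_cong TYPE('k) k ?k"
      using monomial_cong_add[OF monomial_cong_swap[OF cv cu] k2'] u by (simp add: k1 k2 add_ac)
    have mon: "?k \<in> monomials (m + p)"
      using cu cv k2' unfolding monomials_add_iff by (auto simp: column_index_def)
    have same: "expo ?k = expo k"
      unfolding k1 k2 using v v' u cu cv less.prems(3,4) 3
      by (auto simp: expo_def wsum_add a_degree_def b_degree_def t_degree_def column_index_def
          split: if_splits)
    have "\<exists>q. q \<in> monomials (m + p) \<and> expo q = r \<and>
        monomial_cong TYPE('k) ?k (Poly_Mapping.single l 1 + q)"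
      using 3 less.prems(3-6) mon same
      by (intro less.hyps[of "u - 1"]) (auto simp: keys_add_nat)
    with cong show ?thesis using monomial_cong_trans by blast
  qed
qed

lemma straighten:
  assumes "k \<in> monomials (m + p)" "l \<in> monomials (m + p)" "expo k = expo l"
  shows "monomial_cong TYPE('k::field) k l"
  using assms
proof (induction "wsum (\<lambda>_. 1) l" arbitrary: k l rule: less_induct)
  case less
  show ?case
  proof (cases "l = 0")
    case True
    have "k = 0"
    proof (rule ccontr)
      assume "k \<noteq> 0"
      then obtain u where "u \<in> Poly_Mapping.keys k" by (metis all_not_in_conv keys_eq_empty)
      then obtain k1 where "k = Poly_Mapping.single u 1 + k1" by (rule in_keys_split)
      with less.prems(3) True show False
        by (auto simp: expo_def wsum_add a_degree_def b_degree_def split: if_splits)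
    qed
    with True show ?thesis by (simp add: monomial_cong_refl)
  next
    case False
    then obtain i where "i \<in> Poly_Mapping.keys l" by (metis all_not_in_conv keys_eq_empty)
    then obtain l1 where l1: "l = Poly_Mapping.single i 1 + l1" by (rule in_keys_split)
    have l1': "l1 \<in> monomials (m + p)" and i: "i \<in> {1..m + p}"
      using less.prems(2) unfolding l1 monomials_add_iff by auto
    have "\<exists>u\<in>Poly_Mapping.keys k. u \<le> m \<longleftrightarrow> i \<le> m"
    proof (cases "i \<le> m")
      case True
      then have "wsum a_degree k > 0"
        using less.prems(3) by (simp add: l1 expo_def wsum_add a_degree_def)
      then show ?thesis using True
        by (elim wsum_positive) (auto simp: a_degree_def split: if_splits)
    next
      case False
      then have "wsum b_degree k > 0"
        using less.prems(3) by (simp add: l1 expo_def wsum_add b_degree_def)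
      then show ?thesis using False
        by (elim wsum_positive) (auto simp: b_degree_def split: if_splits)
    qed
    then obtain u where u: "u \<in> Poly_Mapping.keys k" "u \<le> m \<longleftrightarrow> i \<le> m" by blast
    obtain q where q: "q \<in> monomials (m + p)" "expo q = expo l1"
      "monomial_cong TYPE('k) k (Poly_Mapping.single i 1 + q)"
      using straighten_step[OF less.prems(1) u(1) i u(2), of "expo l1"] less.prems(3)
        expo_in_cone[OF l1'] by (auto simp: l1 expo_add)
    have "monomial_cong TYPE('k) q l1"
      using q l1' by (intro less.hyps) (auto simp: l1 wsum_add)
    then have "monomial_cong TYPE('k) (Poly_Mapping.single i 1 + q) l"
      using monomial_cong_add[of q l1 "Poly_Mapping.single i 1"] i by (simp add: l1 add.commute)
    with q(3) show ?thesis using monomial_cong_trans by blast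
  qed
qed

section \<open>The parametrization of the scroll\<close>

definition parametrization :: "'k::field mpol \<Rightarrow> (nat \<times> nat \<times> nat) \<Rightarrow>\<^sub>0 'k" where
  "parametrization = push expo"

text \<open>
  The R-module L d. In particular, L 0 is the image of S under the parametrization.
\<close>

definition L :: "nat \<Rightarrow> ((nat \<times> nat \<times> nat) \<Rightarrow>\<^sub>0 'k::field) set" where
  "L d = {f. Poly_Mapping.keys f \<subseteq> cone d}"

lemma parametrization_add: "parametrization (f + g) = parametrization f + parametrization g"
  and parametrization_diff: "parametrization (f - g) = parametrization f - parametrization g"
  and parametrization_uminus: "parametrization (- f) = - parametrization f"
  and parametrization_mult: "parametrization (f * g) = parametrization f * parametrization g"
  and parametrization_zero [simp]: "parametrization 0 = 0"
  by (simp_all add: parametrization_def push_add push_diff push_uminus push_mult expo_add)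

lemma parametrization_one [simp]: "parametrization 1 = 1"
  unfolding parametrization_def by (metis push_single expo_zero single_one)

lemma parametrization_var:
  "parametrization (var i) = Poly_Mapping.single (a_degree i, b_degree i, t_degree i) 1"
  by (simp add: parametrization_def var_def expo_def)

lemma cone_has_monomial:
  assumes "r \<in> cone 0" shows "\<exists>k\<in>monomials (m + p). expo k = r"
proof -
  obtain i j e where r: "r = (i, j, e)" by (cases r)
  have "e \<le> i * (m - 1) + j * (p - 1) \<Longrightarrow> \<exists>k\<in>monomials (m + p). expo k = (i, j, e)"
  proof (induction "i + j" arbitrary: i j e)
    case 0
    then show ?case by (intro bexI[of _ 0]) (auto simp: zero_prod_def)
  next
    case (Suc s)
    show ?case
    proof (cases i)
      case 0
      then obtain j' where j: "j = Suc j'" using Suc.hyps(2) by (cases j) auto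
      let ?c = "min e (p - 1)"
      have "e \<le> (p - 1) + j' * (p - 1)" using Suc.prems 0 j by simp
      then have e: "e - ?c \<le> j' * (p - 1)" by linarith
      obtain k where k: "k \<in> monomials (m + p)" "expo k = (i, j', e - ?c)"
        using Suc.hyps(1)[of 0 j' "e - ?c"] Suc.hyps(2) Suc.prems 0 j e by auto
      show ?thesis using k m2 p2 0 j
        by (intro bexI[of _ "Poly_Mapping.single (m + 1 + ?c) 1 + k"])
          (auto simp: monomials_add_iff expo_def wsum_add a_degree_def b_degree_def t_degree_def)
    next
      case (Suc i')
      let ?c = "min e (m - 1)"
      have "e \<le> (m - 1) + (i' * (m - 1) + j * (p - 1))" using Suc.prems Suc by simp
      then have e: "e - ?c \<le> i' * (m - 1) + j * (p - 1)" by linarith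
      obtain k where k: "k \<in> monomials (m + p)" "expo k = (i', j, e - ?c)"
        using Suc.hyps(1)[of i' j "e - ?c"] Suc.hyps(2) Suc.prems Suc e by auto
      show ?thesis using k m2 p2 Suc
        by (intro bexI[of _ "Poly_Mapping.single (1 + ?c) 1 + k"])
          (auto simp: monomials_add_iff expo_def wsum_add a_degree_def b_degree_def t_degree_def)
    qed
  qed
  with assms r show ?thesis by (auto simp: cone_def)
qed

text \<open>
  A choice of a monomial of S for each exponent in cone 0.
\<close>

definition lift_exponent :: "nat \<times> nat \<times> nat \<Rightarrow> nat \<Rightarrow>\<^sub>0 nat" where
  "lift_exponent r = (SOME k. k \<in> monomials (m + p) \<and> expo k = r)"

lemma lift_exponent:
  assumes "r \<in> cone 0"
  shows "lift_exponent r \<in> monomials (m + p)" "expo (lift_exponent r) = r"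
  using cone_has_monomial[OF assms] unfolding lift_exponent_def by (metis (mono_tags, lifting) someI_ex)+

lemma parametrization_image: "parametrization ` carrier (S_ring (m + p)) = (L 0 :: (_ \<Rightarrow>\<^sub>0 'k::field) set)"
proof
  show "parametrization ` carrier (S_ring (m + p)) \<subseteq> (L 0 :: (_ \<Rightarrow>\<^sub>0 'k::field) set)"
    unfolding parametrization_def L_def carrier_S_ring
    using keys_push[of expo] expo_in_cone by blast
  show "(L 0 :: (_ \<Rightarrow>\<^sub>0 'k::field) set) \<subseteq> parametrization ` carrier (S_ring (m + p))"
  proof
    fix f :: "_ \<Rightarrow>\<^sub>0 'k" assume f: "f \<in> L 0"
    have "push expo (push lift_exponent f) = push (\<lambda>k. k) f"
      unfolding push_push using f lift_exponent(2) unfolding L_def push_def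
      by (intro sum.cong) auto
    moreover have "push lift_exponent f \<in> carrier (S_ring (m + p))"
      using f keys_push[of lift_exponent f] lift_exponent(1) unfolding L_def carrier_S_ring by blast
    ultimately show "f \<in> parametrization ` carrier (S_ring (m + p))"
      unfolding parametrization_def push_id by force
  qed
qed

lemma parametrization_minor:
  assumes "f \<in> minors2 (scroll_matrix m p)" shows "parametrization (f :: 'k::field mpol) = 0"
proof -
  obtain c d where cd: "c < d" "d < m + p - 2"
    and f: "f = det (mat_of_cols 2 [col (scroll_matrix m p) c, col (scroll_matrix m p) d])"
    using assms scroll_matrix_carrier[where 'a='k] unfolding minors2_def by auto
  have t: "parametrization (scroll_matrix m p $$ (1, e) :: 'k mpol) =
      Poly_Mapping.single (0, 0, 1) 1 * parametrization (scroll_matrix m p $$ (0, e))"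
    if "e < m + p - 2" for e
    using that m2 p2 Suc_diff_le[of m "Suc e"]
    by (cases "Suc e \<le> m - 1"; cases "Suc e = m")
      (auto simp: scroll_matrix_def mat1_def parametrization_var mult_single a_degree_def b_degree_def t_degree_def)
  show ?thesis using cd unfolding f
    by (subst scroll_minor) (auto simp: parametrization_diff parametrization_mult t[unfolded One_nat_def] algebra_simps)
qed

text \<open>
  For the nontrivial inclusion, each monomial of f is replaced by the chosen monomial
  with the same image. This changes f by an element of the scroll ideal, by straightening, and the result
  depends only on the image of f.
\<close>

lemma parametrization_kernel:
  "f \<in> scroll_ideal m p \<longleftrightarrow> f \<in> carrier (S_ring (m + p)) \<and> parametrization (f :: 'k::field mpol) = 0"
proof
  interpret S: cring "S_ring (m + p) :: 'k mpol ring" by (rule cring_S_ring)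
  let ?K = "{f \<in> carrier (S_ring (m + p)). parametrization (f :: 'k mpol) = 0}"
  assume "f \<in> scroll_ideal m p"
  moreover have "ideal ?K (S_ring (m + p))"
  proof (rule idealI)
    show "subgroup ?K (add_monoid (S_ring (m + p)))"
      by (rule S.add.subgroupI)
        (auto simp: parametrization_add parametrization_uminus S_a_inv S_a_inv[unfolded a_inv_def]
          intro: S_carrier_add S_carrier_uminus)
  qed (auto simp: parametrization_mult intro: S_carrier_mult S.ring_axioms)
  moreover have "minors2 (scroll_matrix m p) \<subseteq> ?K"
    using parametrization_minor minors_carrier by blast
  ultimately show "f \<in> carrier (S_ring (m + p)) \<and> parametrization (f :: 'k::field mpol) = 0"
    using S.genideal_minimal[of ?K "minors2 (scroll_matrix m p)"] by (auto simp: scroll_ideal_def)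
next
  assume f: "f \<in> carrier (S_ring (m + p)) \<and> parametrization (f :: 'k::field mpol) = 0"
  let ?n = "\<lambda>k. lift_exponent (expo k)"
  have k: "k \<in> monomials (m + p)" if "k \<in> Poly_Mapping.keys f" for k
    using that f by (auto simp: carrier_S_ring)
  have "push ?n f = push lift_exponent (push expo f)" by (simp add: push_push)
  then have "push ?n f = 0" using f by (simp add: parametrization_def)
  then have "f = (\<Sum>k\<in>Poly_Mapping.keys f. Poly_Mapping.single k (Poly_Mapping.lookup f k)) -
     (\<Sum>k\<in>Poly_Mapping.keys f. Poly_Mapping.single (?n k) (Poly_Mapping.lookup f k))"
    by (simp add: push_def sum_monomials)
  also have "\<dots> = (\<Sum>k\<in>Poly_Mapping.keys f. Poly_Mapping.single 0 (Poly_Mapping.lookup f k) *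
     (Poly_Mapping.single k 1 - Poly_Mapping.single (?n k) 1))"
    by (simp add: algebra_simps mult_single sum_subtractf)
  also have "\<dots> \<in> scroll_ideal m p"
  proof (intro scroll_ideal_sum scroll_ideal_mult)
    fix i assume "i \<in> Poly_Mapping.keys f"
    then show "Poly_Mapping.single i 1 - Poly_Mapping.single (?n i) 1 \<in> (scroll_ideal m p :: 'k mpol set)"
      using straighten[of i "?n i", where 'k='k] k lift_exponent expo_in_cone
      by (simp add: monomial_cong_def)
  qed (simp add: S_carrier_single)
  finally show "f \<in> scroll_ideal m p" .
qed

end

section \<open>Block vectors and block matrices\<close>

lemma sum_lessThan_add:
  "(\<Sum>i<a + b. f i) = (\<Sum>i<a. f i) + (\<Sum>c<b. f (a + c) :: 'a::comm_monoid_add)" for a b :: nat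
  by (induction b) (simp_all add: add.assoc)

lemma sum_blocks:
  "(\<Sum>i<d * w. f i) = (\<Sum>k<d. \<Sum>c<w. f (k * w + c) :: 'a::comm_monoid_add)" for d w :: nat
  by (induction d) (simp_all add: sum_lessThan_add add.commute[of w])

lemma mult_mat_vec_index:
  assumes "M \<in> carrier_mat r c" "v \<in> carrier_vec c" "i < r"
  shows "(M *\<^sub>v v) $ i = (\<Sum>j<c. M $$ (i, j) * v $ j)"
  using assms by (auto simp: scalar_prod_def atLeast0LessThan intro!: sum.cong)

lemma append_vec_zero: "0\<^sub>v (a + b) = 0\<^sub>v a @\<^sub>v 0\<^sub>v b"
  by (intro eq_vecI) auto

lemma append_vec_split:
  assumes "v \<in> carrier_vec (a + b)"
  obtains x y where "x \<in> carrier_vec a" "y \<in> carrier_vec b" "v = x @\<^sub>v y"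
  using assms that[of "vec_first v a" "vec_last v b"] by simp

lemma append_vec_eq_zero:
  assumes "x \<in> carrier_vec a" "y \<in> carrier_vec b"
  shows "x @\<^sub>v y = 0\<^sub>v (a + b) \<longleftrightarrow> x = 0\<^sub>v a \<and> y = 0\<^sub>v b"
  unfolding append_vec_zero using assms by (intro append_vec_eq) auto

lemma append_cols_carrier:
  "A \<in> carrier_mat r a \<Longrightarrow> B \<in> carrier_mat r b \<Longrightarrow> A @\<^sub>c B \<in> carrier_mat r (a + b)"
  unfolding append_cols_def by auto

lemma append_cols_mult_vec:
  assumes "A \<in> carrier_mat r a" "B \<in> carrier_mat r b" "x \<in> carrier_vec a" "y \<in> carrier_vec b"
  shows "(A @\<^sub>c B) *\<^sub>v (x @\<^sub>v y) = A *\<^sub>v x + B *\<^sub>v (y :: 'a::comm_ring_1 vec)"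
proof -
  have "(A @\<^sub>c B) *\<^sub>v (x @\<^sub>v y) =
      (A *\<^sub>v x + B *\<^sub>v y) @\<^sub>v (0\<^sub>m 0 a *\<^sub>v x + 0\<^sub>m 0 b *\<^sub>v y)"
    using assms unfolding append_cols_def by (subst four_block_mat_mult_vec) auto
  also have "\<dots> = A *\<^sub>v x + B *\<^sub>v y"
    using assms by (intro eq_vecI) auto
  finally show ?thesis .
qed

lemma copies_carrier:
  "A \<in> carrier_mat r c \<Longrightarrow> copies d A \<in> carrier_mat (d * r) (d * c)"
  unfolding copies_def by (intro carrier_matI) (auto simp: dim_diag_block_mat sum_list_replicate)

lemma copies_Suc:
  assumes "A \<in> carrier_mat r c"
  shows "copies (Suc d) A = four_block_mat A (0\<^sub>m r (d * c)) (0\<^sub>m (d * r) c) (copies d A)"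
  using assms copies_carrier[OF assms, of d] by (simp add: copies_def Let_def)

lemma copies_0: "copies 0 A = 0\<^sub>m 0 0"
  by (simp add: copies_def)

lemma copies_row_index:
  assumes "A \<in> carrier_mat 1 c" "i < d" "j < d * c"
  shows "copies d A $$ (i, j) = (if i = j div c then A $$ (0, j mod c) else 0)"
  using assms(2,3)
proof (induction d arbitrary: i j)
  case (Suc d)
  have c: "c > 0" using Suc.prems by (cases c) auto
  have car: "copies d A \<in> carrier_mat d (d * c)" using copies_carrier[OF assms(1)] by simp
  show ?case
  proof (cases "j < c")
    case True
    then show ?thesis unfolding copies_Suc[OF assms(1)]
      using assms(1) car Suc.prems by auto
  next
    case False
    then have "j div c = Suc ((j - c) div c)" "j mod c = (j - c) mod c"
      using c by (simp_all add: le_div_geq le_mod_geq)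
    then show ?thesis unfolding copies_Suc[OF assms(1)]
      using assms(1) car Suc.prems False by (auto simp: Suc.IH)
  qed
qed simp

lemma diag_block_mat_two:
  assumes "A \<in> carrier_mat r c" "B \<in> carrier_mat r' c'"
  shows "diag_block_mat [A, B] = four_block_mat A (0\<^sub>m r c') (0\<^sub>m r' c) B"
  using assms diag_block_mat.simps(2)[of A "[B]"]
  unfolding diag_block_mat_singleton by (simp only: Let_def carrier_matD)

lemma copies_add:
  assumes "A \<in> carrier_mat r c"
  shows "diag_block_mat [copies d A, copies e A] = copies (d + e) A"
proof -
  note c = copies_carrier[OF assms]
  note dims = carrier_matD[OF c, unfolded copies_def]
  show ?thesis
    unfolding diag_block_mat_two[OF c c]
    by (simp only: copies_def replicate_add diag_block_mat_append Let_def dims)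
qed

lemma block_diag_mult_vec:
  assumes "A \<in> carrier_mat r c" "B \<in> carrier_mat r' c'" "x \<in> carrier_vec c" "y \<in> carrier_vec c'"
  shows "four_block_mat A (0\<^sub>m r c') (0\<^sub>m r' c) B *\<^sub>v (x @\<^sub>v y) = A *\<^sub>v x @\<^sub>v B *\<^sub>v (y :: 'a::comm_ring_1 vec)"
  using assms by (subst four_block_mat_mult_vec[where ?nr1.0=r and ?nr2.0=r']) auto

context scroll begin

section \<open>Relations between the powers of t\<close>

type_synonym 'a tpoly = "(nat \<times> nat \<times> nat) \<Rightarrow>\<^sub>0 'a"

text \<open>
  The monomial a^i b^j t^e.
\<close>

definition abt :: "nat \<Rightarrow> nat \<Rightarrow> nat \<Rightarrow> 'k::field tpoly" where
  "abt i j e = Poly_Mapping.single (i, j, e) 1"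

text \<open>
  The number n - 2 of columns of the scroll matrix.
\<close>

definition w :: nat where "w = m + p - 2"

text \<open>
  The images of the entries of the two rows of the scroll matrix, with columns numbered from 0. The
  entries tau of the second row are t times the entries beta of the first row.
\<close>

definition beta :: "nat \<Rightarrow> 'k::field tpoly" where
  "beta c = (if c < m - 1 then abt 1 0 c else abt 0 1 (c - (m - 1)))"

definition tau :: "nat \<Rightarrow> 'k::field tpoly" where
  "tau c = abt 0 0 1 * beta c"

lemma abt_mult: "abt i j e * abt i' j' e' = (abt (i + i') (j + j') (e + e') :: 'k::field tpoly)"
  by (simp add: abt_def mult_single)

lemma abt_0 [simp]: "abt 0 0 0 = 1"
  unfolding abt_def by (metis single_one zero_prod_def)

lemma w_pos: "w \<ge> 2" using m2 p2 by (simp add: w_def)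

lemma w_eq: "w = (m - 1) + (p - 1)" using m2 p2 by (simp add: w_def)

lemma L_zero [simp]: "0 \<in> L d" by (simp add: L_def)

lemma L_add: "f \<in> L d \<Longrightarrow> g \<in> L d \<Longrightarrow> f + g \<in> (L d :: 'k::field tpoly set)"
  unfolding L_def using Poly_Mapping.keys_add[of f g] by blast

lemma L_uminus: "f \<in> L d \<Longrightarrow> - f \<in> (L d :: 'k::field tpoly set)"
  unfolding L_def by simp

lemma L_diff: "f \<in> L d \<Longrightarrow> g \<in> L d \<Longrightarrow> f - g \<in> (L d :: 'k::field tpoly set)"
  using L_add[of f d "- g"] L_uminus[of g d] by simp

lemma L_sum: "(\<And>i. i \<in> X \<Longrightarrow> f i \<in> L d) \<Longrightarrow> sum f X \<in> (L d :: 'k::field tpoly set)"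
  by (induction X rule: infinite_finite_induct) (auto intro: L_add)

lemma cone_add: "r \<in> cone d \<Longrightarrow> s \<in> cone d' \<Longrightarrow> r + s \<in> cone (d + d')"
  by (auto simp: cone_def add_mult_distrib simp del: diff_mult_distrib)

lemma L_mult: "f \<in> L d \<Longrightarrow> g \<in> L d' \<Longrightarrow> f * g \<in> (L (d + d') :: 'k::field tpoly set)"
  unfolding L_def using keys_mult[of f g] cone_add by blast

lemma L0_mult: "f \<in> L 0 \<Longrightarrow> g \<in> L 0 \<Longrightarrow> f * g \<in> (L 0 :: 'k::field tpoly set)"
  using L_mult[of f 0 g 0] by simp

lemma abt_in_L: "e \<le> i * (m - 1) + j * (p - 1) + d \<Longrightarrow> abt i j e \<in> L d"
  by (simp add: L_def abt_def cone_def)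

lemma L_one: "1 \<in> L 0" using abt_in_L[of 0 0 0 0] by simp

lemma abt_cancel: "abt i j e * f = abt i j e * g \<Longrightarrow> f = (g :: 'k::field tpoly)"
  unfolding abt_def by (rule single_mult_cancel)

lemma abt_mult_eq_0: "abt i j e * f = 0 \<longleftrightarrow> f = (0 :: 'k::field tpoly)"
  using abt_cancel[of i j e f 0] by auto

lemma tau_eq: "tau c = (if c < m - 1 then abt 1 0 (Suc c) else abt 0 1 (Suc (c - (m - 1))))"
  by (simp add: tau_def beta_def abt_mult)

text \<open>
  An element of L 0 that is divisible by t lies in the ideal generated by the second row.
\<close>

lemma divisible_by_t:
  assumes f: "f \<in> (L 0 :: 'k::field tpoly set)" and eq: "f = abt 0 0 1 * g"
  obtains y where "\<And>c. y c \<in> L 0" "f = (\<Sum>c<w. tau c * y c)"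
proof -
  let ?g = "\<lambda>c. if c < m - 1 then (1, 0, Suc c) else (0, 1, Suc (c - (m - 1))) :: nat \<times> nat \<times> nat"
  have "\<exists>c\<in>{..<w}. \<exists>l\<in>cone 0. r = ?g c + l" if r: "r \<in> Poly_Mapping.keys f" for r
  proof -
    obtain i j e where rr: "r = (i, j, e)" by (cases r)
    have "r \<in> cone 0" using r f by (auto simp: L_def)
    then have e: "e \<le> i * (m - 1) + j * (p - 1)" by (simp add: cone_def rr)
    have "r \<in> (+) (0, 0, 1) ` Poly_Mapping.keys g"
      using r unfolding eq abt_def keys_single_mult .
    then have e1: "e \<ge> 1" by (auto simp: rr)
    show ?thesis
    proof (cases i)
      case (Suc i')
      \<comment> \<open>A factor a t^c with c as large as possible is split off, so that the rest stays in L 0.\<close>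
      let ?c = "min e (m - 1)"
      have "e \<le> (m - 1) + (i' * (m - 1) + j * (p - 1))" using e Suc by simp
      then have "e - ?c \<le> i' * (m - 1) + j * (p - 1)" by linarith
      moreover have "?c - 1 < m - 1" "?c - 1 < w" using m2 p2 w_eq by auto
      ultimately show ?thesis using e1 m2 Suc
        by (intro bexI[of _ "?c - 1"] bexI[of _ "(i', j, e - ?c)"]) (auto simp: rr cone_def)
    next
      case 0
      then obtain j' where j: "j = Suc j'" using e e1 by (cases j) auto
      let ?c = "min e (p - 1)"
      have "e \<le> (p - 1) + j' * (p - 1)" using e 0 j by simp
      then have "e - ?c \<le> j' * (p - 1)" by linarith
      then show ?thesis using e1 p2 0 j w_eq m2
        by (intro bexI[of _ "m - 1 + (?c - 1)"] bexI[of _ "(0, j', e - ?c)"]) (auto simp: rr cone_def)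
    qed
  qed
  then obtain y where y: "\<And>c. Poly_Mapping.keys (y c) \<subseteq> cone 0"
    "f = (\<Sum>c<w. Poly_Mapping.single (?g c) 1 * y c)"
    using split_by_monomials[of "{..<w}" f "cone 0" ?g, OF finite_lessThan] by auto
  have "f = (\<Sum>c<w. tau c * y c)"
    unfolding y(2) by (intro sum.cong) (auto simp: tau_eq abt_def)
  with y(1) show ?thesis by (intro that[of y]) (auto simp: L_def)
qed

text \<open>
  The relations with coefficients in L 0 between 1, t, ..., t^(d-1) are the combinations of the columns
  of Phi d, given here by the coefficients y k c of the column c of the block k.
\<close>

lemma power_relation:
  assumes "d \<ge> 1" "\<And>j. j < d \<Longrightarrow> r j \<in> L 0" "(\<Sum>j<d. abt 0 0 j * r j) = (0 :: 'k::field tpoly)"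
  shows "\<exists>y. (\<forall>k c. y k c \<in> L 0) \<and> (\<forall>j<d. r j =
    (if Suc j < d then (\<Sum>c<w. tau c * y j c) else 0) -
    (if 1 \<le> j then (\<Sum>c<w. beta c * y (j - 1) c) else 0))"
  using assms
proof (induction d arbitrary: r)
  case (Suc d)
  show ?case
  proof (cases "d = 0")
    case True
    then have "r 0 = 0" using Suc.prems by simp
    then show ?thesis using True by (intro exI[of _ "\<lambda>_ _. 0"]) auto
  next
    case False
    have t: "abt 0 0 (Suc j) = abt 0 0 1 * (abt 0 0 j :: 'k tpoly)" for j
      by (simp add: abt_mult)
    have sum0: "r 0 + abt 0 0 1 * (\<Sum>j<d. abt 0 0 j * r (Suc j)) = 0"
      using Suc.prems(3) unfolding sum.lessThan_Suc_shift t by (simp add: sum_distrib_left mult.assoc)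
    then have "r 0 = abt 0 0 1 * - (\<Sum>j<d. abt 0 0 j * r (Suc j))"
      by (simp add: eq_neg_iff_add_eq_0)
    then obtain y0 where y0: "\<And>c. y0 c \<in> L 0" "r 0 = (\<Sum>c<w. tau c * y0 c)"
      using divisible_by_t[of "r 0"] Suc.prems(2)[of 0] by blast
    \<comment> \<open>Removing r 0 by means of the columns of the first block changes r 1; the rest is divided by t.\<close>
    define r' where "r' j = r (Suc j) + (if j = 0 then \<Sum>c<w. beta c * y0 c else 0)" for j
    have L: "(\<Sum>c<w. beta c * y0 c) \<in> (L 0 :: 'k tpoly set)"
      using y0(1) w_eq by (intro L_sum L0_mult) (auto simp: beta_def intro!: abt_in_L)
    have "(\<Sum>j<d. abt 0 0 j * r' j) =
       (\<Sum>j<d. abt 0 0 j * r (Suc j)) + (\<Sum>j<d. if j = 0 then \<Sum>c<w. beta c * y0 c else 0)"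
      unfolding sum.distrib[symmetric] r'_def by (intro sum.cong) (auto simp: algebra_simps)
    also have "(\<Sum>j<d. if j = 0 then \<Sum>c<w. beta c * y0 c else 0) = (\<Sum>c<w. beta c * y0 c)"
      using False by (subst sum.delta) auto
    finally have "abt 0 0 1 * (\<Sum>j<d. abt 0 0 j * r' j) =
       abt 0 0 1 * (\<Sum>j<d. abt 0 0 j * r (Suc j)) + r 0"
      unfolding y0(2) by (simp add: distrib_left sum_distrib_left tau_def mult.assoc)
    also have "\<dots> = 0" using sum0 by (simp add: add.commute)
    finally have "(\<Sum>j<d. abt 0 0 j * r' j) = 0" by (simp add: abt_mult_eq_0)
    then have "\<exists>y. (\<forall>k c. y k c \<in> L 0) \<and> (\<forall>j<d. r' j =
        (if Suc j < d then (\<Sum>c<w. tau c * y j c) else 0) -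
        (if 1 \<le> j then (\<Sum>c<w. beta c * y (j - 1) c) else 0))"
      using False Suc.prems(2) L by (intro Suc.IH) (auto simp: r'_def intro!: L_add)
    then obtain y where y: "\<And>k c. y k c \<in> L 0" "\<And>j. j < d \<Longrightarrow> r' j =
        (if Suc j < d then (\<Sum>c<w. tau c * y j c) else 0) -
        (if 1 \<le> j then (\<Sum>c<w. beta c * y (j - 1) c) else 0)" by blast
    define z where "z k = (case k of 0 \<Rightarrow> y0 | Suc k \<Rightarrow> y k)" for k
    have "r j = (if Suc j < Suc d then (\<Sum>c<w. tau c * z j c) else 0) -
      (if 1 \<le> j then (\<Sum>c<w. beta c * z (j - 1) c) else 0)" if "j < Suc d" for j
    proof (cases j)
      case 0
      then show ?thesis using False y0(2) by (simp add: z_def)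
    next
      case (Suc i)
      have "r j = r' i - (if i = 0 then \<Sum>c<w. beta c * y0 c else 0)" by (simp add: r'_def Suc)
      then show ?thesis using y(2)[of i] that Suc by (cases i) (auto simp: z_def)
    qed
    moreover have "z k c \<in> L 0" for k c using y0(1) y(1) by (cases k) (auto simp: z_def)
    ultimately show ?thesis by blast
  qed
qed simp

section \<open>Exactness over the subring L 0\<close>

text \<open>
  Vectors and matrices with entries in the subring L 0 of k[a,b,t].
\<close>

definition Avec :: "nat \<Rightarrow> 'k::field tpoly vec set" where
  "Avec r = {v \<in> carrier_vec r. \<forall>i<r. v $ i \<in> L 0}"

definition Amat :: "nat \<Rightarrow> nat \<Rightarrow> 'k::field tpoly mat set" where
  "Amat r c = {M \<in> carrier_mat r c. \<forall>i<r. \<forall>j<c. M $$ (i, j) \<in> L 0}"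

lemma Avec_carrier: "v \<in> Avec r \<Longrightarrow> v \<in> carrier_vec r" by (simp add: Avec_def)
lemma Amat_carrier: "M \<in> Amat r c \<Longrightarrow> M \<in> carrier_mat r c" by (simp add: Amat_def)

lemma Avec_mult: "M \<in> Amat r c \<Longrightarrow> v \<in> Avec c \<Longrightarrow> M *\<^sub>v v \<in> (Avec r :: 'k::field tpoly vec set)"
  unfolding Avec_def Amat_def
  by (auto simp: mult_mat_vec_index simp del: index_mult_mat_vec intro!: L_sum L0_mult)

lemma Avec_add: "x \<in> Avec r \<Longrightarrow> y \<in> Avec r \<Longrightarrow> x + y \<in> (Avec r :: 'k::field tpoly vec set)"
  by (auto simp: Avec_def intro!: L_add)

lemma Avec_minus: "x \<in> Avec r \<Longrightarrow> y \<in> Avec r \<Longrightarrow> x - y \<in> (Avec r :: 'k::field tpoly vec set)"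
  by (auto simp: Avec_def intro!: L_diff)

lemma Avec_uminus: "x \<in> Avec r \<Longrightarrow> - x \<in> (Avec r :: 'k::field tpoly vec set)"
  by (auto simp: Avec_def intro!: L_uminus)

lemma Avec_append_iff:
  assumes "x \<in> carrier_vec a" "y \<in> carrier_vec b"
  shows "x @\<^sub>v y \<in> (Avec (a + b) :: 'k::field tpoly vec set) \<longleftrightarrow> x \<in> Avec a \<and> y \<in> Avec b"
proof
  assume xy: "x @\<^sub>v y \<in> Avec (a + b)"
  have "x $ i \<in> L 0" if "i < a" for i
    using xy that assms by (auto simp: Avec_def index_append_vec dest: spec[of _ i])
  moreover have "y $ i \<in> L 0" if "i < b" for i
    using xy that assms by (auto simp: Avec_def index_append_vec dest: spec[of _ "a + i"])
  ultimately show "x \<in> Avec a \<and> y \<in> Avec b" using assms by (simp add: Avec_def)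
next
  assume "x \<in> Avec a \<and> y \<in> Avec b"
  then show "x @\<^sub>v y \<in> Avec (a + b)" by (auto simp: Avec_def index_append_vec)
qed

lemma Avec_split:
  assumes "v \<in> Avec (a + b)"
  obtains x y where "x \<in> Avec a" "y \<in> Avec b" "v = x @\<^sub>v (y :: 'k::field tpoly vec)"
  using assms append_vec_split[OF Avec_carrier[OF assms]] Avec_append_iff by metis

lemma Avec_append: "x \<in> Avec a \<Longrightarrow> y \<in> Avec b \<Longrightarrow> x @\<^sub>v y \<in> (Avec (a + b) :: 'k::field tpoly vec set)"
  by (simp add: Avec_append_iff Avec_carrier)

text \<open>
  Exactness at the middle of the sequence of free L 0-modules given by E and D. Both matrices are over k[a,b,t],
  but only vectors with entries in L 0 are considered. The definition implies that the
  number of rows of E is the number of columns of D.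
\<close>

definition exact :: "'k::field tpoly mat \<Rightarrow> 'k tpoly mat \<Rightarrow> bool" where
  "exact D E \<longleftrightarrow>
    {v \<in> Avec (dim_col D). D *\<^sub>v v = 0\<^sub>v (dim_row D)} = (\<lambda>w. E *\<^sub>v w) ` Avec (dim_col E)"

lemma exactI:
  assumes "D \<in> carrier_mat r c" "E \<in> Amat c e"
    and "\<And>v. v \<in> Avec c \<Longrightarrow> D *\<^sub>v v = 0\<^sub>v r \<longleftrightarrow> (\<exists>x\<in>Avec e. v = E *\<^sub>v x)"
  shows "exact D E"
  unfolding exact_def using assms Avec_mult[OF assms(2)] Amat_carrier[OF assms(2)] by auto

lemma exactD:
  assumes "exact D E" "D \<in> carrier_mat r c" "E \<in> carrier_mat c e"
    and "v \<in> Avec c"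
  shows "D *\<^sub>v v = 0\<^sub>v r \<longleftrightarrow> (\<exists>x\<in>Avec e. v = E *\<^sub>v x)"
  using assms unfolding exact_def by auto

lemma exact_block:
  assumes D: "D \<in> carrier_mat r c" and E: "E \<in> Amat c e" and DE: "exact D E"
    and D': "D' \<in> carrier_mat r' c'" and E': "E' \<in> Amat c' e'" and DE': "exact D' E'"
  shows "exact (four_block_mat D (0\<^sub>m r c') (0\<^sub>m r' c) D') (four_block_mat E (0\<^sub>m c e') (0\<^sub>m c' e) E')"
proof (rule exactI)
  show "four_block_mat D (0\<^sub>m r c') (0\<^sub>m r' c) D' \<in> carrier_mat (r + r') (c + c')" using D D' by auto
  show "four_block_mat E (0\<^sub>m c e') (0\<^sub>m c' e) E' \<in> Amat (c + c') (e + e')"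
    using E E' by (auto simp: Amat_def)
  fix v :: "'a tpoly vec" assume "v \<in> Avec (c + c')"
  then obtain x y where v: "x \<in> Avec c" "y \<in> Avec c'" "v = x @\<^sub>v y" by (rule Avec_split)
  note [simp] = Avec_carrier Amat_carrier
  have "four_block_mat D (0\<^sub>m r c') (0\<^sub>m r' c) D' *\<^sub>v v = 0\<^sub>v (r + r') \<longleftrightarrow>
      D *\<^sub>v x = 0\<^sub>v r \<and> D' *\<^sub>v y = 0\<^sub>v r'"
    using D D' v append_vec_eq_zero[of "D *\<^sub>v x" r "D' *\<^sub>v y" r'] by (simp add: block_diag_mult_vec)
  also have "\<dots> \<longleftrightarrow> (\<exists>x'\<in>Avec e. x = E *\<^sub>v x') \<and> (\<exists>y'\<in>Avec e'. y = E' *\<^sub>v y')"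
    using exactD[OF DE D Amat_carrier[OF E] v(1)] exactD[OF DE' D' Amat_carrier[OF E'] v(2)] by simp
  also have "\<dots> \<longleftrightarrow> (\<exists>z\<in>Avec (e + e'). v = four_block_mat E (0\<^sub>m c e') (0\<^sub>m c' e) E' *\<^sub>v z)"
    (is "?l \<longleftrightarrow> ?r")
  proof
    assume ?l
    then obtain x' y' where "x' \<in> Avec e" "y' \<in> Avec e'" "x = E *\<^sub>v x'" "y = E' *\<^sub>v y'" by blast
    then show ?r using E E' v
      by (intro bexI[of _ "x' @\<^sub>v y'"]) (auto simp: block_diag_mult_vec intro: Avec_append)
  next
    assume ?r
    then obtain z where z: "z \<in> Avec (e + e')" "v = four_block_mat E (0\<^sub>m c e') (0\<^sub>m c' e) E' *\<^sub>v z" by blast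
    from z(1) obtain x' y' where z': "x' \<in> Avec e" "y' \<in> Avec e'" "z = x' @\<^sub>v y'" by (rule Avec_split)
    then have "x @\<^sub>v y = E *\<^sub>v x' @\<^sub>v E' *\<^sub>v y'"
      using z E E' v by (simp add: block_diag_mult_vec)
    then have "x = E *\<^sub>v x'" "y = E' *\<^sub>v y'"
      using append_vec_eq[of x c "E *\<^sub>v x'"] mult_mat_vec_carrier[OF Amat_carrier[OF E] Avec_carrier[OF z'(1)]] v(1)
      by auto
    with z' show ?l by blast
  qed
  finally show "four_block_mat D (0\<^sub>m r c') (0\<^sub>m r' c) D' *\<^sub>v v = 0\<^sub>v (r + r') \<longleftrightarrow> 
    (\<exists>z\<in>Avec (e + e'). v = four_block_mat E (0\<^sub>m c e') (0\<^sub>m c' e) E' *\<^sub>v z)" .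
qed

lemma Amat_four_block:
  "A \<in> Amat r c \<Longrightarrow> B \<in> Amat r c' \<Longrightarrow> C \<in> Amat r' c \<Longrightarrow> D \<in> Amat r' c' \<Longrightarrow>
    four_block_mat A B C D \<in> (Amat (r + r') (c + c') :: 'k::field tpoly mat set)"
  by (auto simp: Amat_def)

lemma Amat_zero: "0\<^sub>m r c \<in> Amat r c" by (simp add: Amat_def)

lemma Amat_copies: "A \<in> Amat r c \<Longrightarrow> copies d A \<in> (Amat (d * r) (d * c) :: 'k::field tpoly mat set)"
proof (induction d)
  case 0 then show ?case by (simp add: copies_0 Amat_zero)
next
  case (Suc d)
  then show ?case using copies_Suc[OF Amat_carrier[OF Suc.prems]]
    by (auto intro!: Amat_four_block Amat_zero)
qed

lemma exact_empty: "exact (0\<^sub>m 0 0) (0\<^sub>m 0 0 :: 'k::field tpoly mat)"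
  by (rule exactI[of _ 0 0 _ 0]) (auto simp: Amat_zero Avec_def intro!: eq_vecI exI[of _ "0\<^sub>v 0"])

lemma exact_copies:
  assumes "D \<in> carrier_mat r c" "E \<in> Amat c e" "exact D E"
  shows "exact (copies d D) (copies d E)"
proof (induction d)
  case 0 then show ?case by (simp add: copies_0 exact_empty)
next
  case (Suc d)
  then show ?case
    unfolding copies_Suc[OF assms(1)] copies_Suc[OF Amat_carrier[OF assms(2)]]
    by (intro exact_block assms copies_carrier Amat_copies)
qed

section \<open>The presentation of L d by Phi\<close>

text \<open>
  The element of k[a,b,t] that has the coordinates v with respect to 1, t, ..., t^(d-1).
\<close>

definition power_form :: "nat \<Rightarrow> 'k::field tpoly vec \<Rightarrow> 'k tpoly" where
  "power_form d v = (\<Sum>j<d. abt 0 0 j * v $ j)"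

text \<open>
  The image of Phi d, see \<open>pmat_Phi\<close>.
\<close>

definition PhiT :: "nat \<Rightarrow> 'k::field tpoly mat" where
  "PhiT d = mat d ((d - 1) * w) (\<lambda>(r, c).
     if r = c div w then tau (c mod w) else if r = c div w + 1 then - beta (c mod w) else 0)"

lemma PhiT_carrier: "PhiT d \<in> carrier_mat d ((d - 1) * w)"
  by (simp add: PhiT_def)

lemma dim_PhiT [simp]: "dim_row (PhiT d) = d" "dim_col (PhiT d) = (d - 1) * w"
  by (simp_all add: PhiT_def)

lemma block_less: "k < d \<Longrightarrow> c < v \<Longrightarrow> k * v + c < d * (v::nat)"
proof -
  assume "k < d" "c < v"
  then have "k * v + c < Suc k * v" by simp
  also have "\<dots> \<le> d * v" using \<open>k < d\<close> by (intro mult_le_mono1) simp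
  finally show ?thesis .
qed

lemma PhiT_index:
  assumes "r < d" "k < d - 1" "c < w"
  shows "PhiT d $$ (r, k * w + c) = (if r = k then tau c else if r = Suc k then - beta c else 0)"
  using assms block_less[of k "d - 1" c w] by (simp add: PhiT_def)

lemma mod_div_block: "i < d * v \<Longrightarrow> i = (i div v) * v + i mod v \<and> i div v < d \<and> i mod v < (v::nat)"
  by (metis div_mult_mod_eq gr_zeroI less_mult_imp_div_less mod_less_divisor mult_0_right not_less_zero)

lemma beta_L: "c < w \<Longrightarrow> beta c \<in> L 0"
  using w_eq by (auto simp: beta_def intro!: abt_in_L)

lemma tau_L: "c < w \<Longrightarrow> tau c \<in> L 0"
  using w_eq by (auto simp: tau_eq intro!: abt_in_L)

lemma PhiT_Amat: "PhiT d \<in> Amat d ((d - 1) * w)"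
  using w_pos by (auto simp: Amat_def PhiT_def intro!: tau_L L_uminus beta_L)

lemma PhiT_mult:
  assumes v: "v \<in> carrier_vec ((d - 1) * w)" and r: "r < d"
  shows "(PhiT d *\<^sub>v v) $ r = (if Suc r < d then (\<Sum>c<w. tau c * v $ (r * w + c)) else 0) -
     (if 1 \<le> r then (\<Sum>c<w. beta c * v $ ((r - 1) * w + c)) else (0 :: 'k::field tpoly))"
proof -
  have "(PhiT d *\<^sub>v v) $ r = (\<Sum>k<d - 1. \<Sum>c<w. PhiT d $$ (r, k * w + c) * v $ (k * w + c))"
    by (simp only: mult_mat_vec_index[OF PhiT_carrier v r] sum_blocks)
  also have "\<dots> = (\<Sum>k<d - 1. (if k = r then (\<Sum>c<w. tau c * v $ (r * w + c)) else 0) -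
      (if k = r - 1 then (if 1 \<le> r then (\<Sum>c<w. beta c * v $ ((r - 1) * w + c)) else 0) else 0))"
    using r by (intro sum.cong refl; cases r) (auto simp: PhiT_index sum_negf)
  also have "\<dots> = (if Suc r < d then (\<Sum>c<w. tau c * v $ (r * w + c)) else 0) -
     (if 1 \<le> r then (\<Sum>c<w. beta c * v $ ((r - 1) * w + c)) else 0)"
    using r by (auto simp: sum_subtractf)
  finally show ?thesis .
qed

lemma power_form_PhiT:
  assumes "v \<in> carrier_vec ((d - 1) * w)"
  shows "power_form d (PhiT d *\<^sub>v v) = (0 :: 'k::field tpoly)"
proof (cases d)
  case 0 then show ?thesis by (simp add: power_form_def)
next
  case (Suc e)
  let ?s = "\<lambda>k. abt 0 0 (Suc k) * (\<Sum>c<w. beta c * v $ (k * w + c))"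
  have "power_form d (PhiT d *\<^sub>v v) = (\<Sum>r<d. (if r < e then ?s r else 0) - (if 1 \<le> r then ?s (r - 1) else 0))"
    unfolding power_form_def
  proof (intro sum.cong refl)
    fix r assume "r \<in> {..<d}"
    then have r: "r < d" by simp
    have t: "abt 0 0 r * (tau c * x) = abt 0 0 (Suc r) * (beta c * x)" for c and x :: "'k tpoly"
      by (simp add: tau_def abt_mult flip: mult.assoc)
    show "abt 0 0 r * (PhiT d *\<^sub>v v) $ r = (if r < e then ?s r else 0) - (if 1 \<le> r then ?s (r - 1) else 0)"
      unfolding PhiT_mult[OF assms r] using Suc
      by (auto simp: right_diff_distrib sum_distrib_left t)
  qed
  also have "\<dots> = (\<Sum>r<e. ?s r) - (\<Sum>r<e. ?s r)"
    unfolding sum_subtractf Suc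
    by (subst (2) sum.lessThan_Suc_shift) simp
  finally show ?thesis by simp
qed

text \<open>
  Phi d is a presentation matrix of the module L (d-1).
\<close>

lemma power_form_kernel:
  assumes d: "d \<ge> 1" and v: "v \<in> Avec d"
  shows "power_form d v = (0 :: 'k::field tpoly) \<longleftrightarrow> (\<exists>x\<in>Avec ((d - 1) * w). v = PhiT d *\<^sub>v x)"
proof
  assume "power_form d v = 0"
  then have "\<exists>y. (\<forall>k c. y k c \<in> L 0) \<and> (\<forall>j<d. v $ j =
    (if Suc j < d then (\<Sum>c<w. tau c * y j c) else 0) -
    (if 1 \<le> j then (\<Sum>c<w. beta c * y (j - 1) c) else 0))"
    using d v by (intro power_relation) (auto simp: Avec_def power_form_def)
  then obtain y where y: "\<And>k c. y k c \<in> L 0" "\<And>j. j < d \<Longrightarrow> v $ j =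
    (if Suc j < d then (\<Sum>c<w. tau c * y j c) else 0) -
    (if 1 \<le> j then (\<Sum>c<w. beta c * y (j - 1) c) else 0)" by blast
  define x where "x = vec ((d - 1) * w) (\<lambda>i. y (i div w) (i mod w))"
  have x: "x \<in> Avec ((d - 1) * w)" using y(1) by (simp add: x_def Avec_def)
  have xi: "x $ (k * w + c) = y k c" if "k < d - 1" "c < w" for k c
    using that block_less[of k "d - 1" c w] by (simp add: x_def)
  have "v = PhiT d *\<^sub>v x"
  proof (rule eq_vecI)
    show "dim_vec v = dim_vec (PhiT d *\<^sub>v x)" using v PhiT_carrier[of d] by (auto simp: Avec_def)
    fix r assume "r < dim_vec (PhiT d *\<^sub>v x)"
    then have r: "r < d" by (simp add: PhiT_def)
    show "v $ r = (PhiT d *\<^sub>v x) $ r"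
      unfolding y(2)[OF r] PhiT_mult[OF Avec_carrier[OF x] r] using r
      by (auto simp: xi)
  qed
  with x show "\<exists>x\<in>Avec ((d - 1) * w). v = PhiT d *\<^sub>v x" by blast
qed (auto simp: power_form_PhiT Avec_carrier)

text \<open>
  The image of the first row of the scroll matrix, as a matrix with one row.
\<close>

definition beta_row :: "'k::field tpoly mat" where
  "beta_row = mat 1 w (\<lambda>(i, c). beta c)"

lemma beta_row_carrier: "beta_row \<in> carrier_mat 1 w"
  by (simp add: beta_row_def)

lemma beta_row_index: "c < w \<Longrightarrow> beta_row $$ (0, c) = beta c"
  by (simp add: beta_row_def)

text \<open>
  The row 0 says that the sum over the block 0 with coefficients tau vanishes. As tau is t times beta,
  the sum with coefficients beta vanishes too, so that the row 1 is a condition of the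
  same form on the block 1, and so on.
\<close>

lemma PhiT_zero_iff:
  assumes v: "v \<in> carrier_vec ((d - 1) * w)"
  shows "PhiT d *\<^sub>v v = 0\<^sub>v d \<longleftrightarrow> (\<forall>k<d - 1. (\<Sum>c<w. beta c * v $ (k * w + c)) = (0 :: 'k::field tpoly))"
proof
  assume 0: "PhiT d *\<^sub>v v = 0\<^sub>v d"
  show "\<forall>k<d - 1. (\<Sum>c<w. beta c * v $ (k * w + c)) = 0"
  proof (intro allI impI)
    fix k assume "k < d - 1"
    then show "(\<Sum>c<w. beta c * v $ (k * w + c)) = 0"
    proof (induction k)
      case 0
      then have "(PhiT d *\<^sub>v v) $ 0 = (\<Sum>c<w. tau c * v $ c)"
        by (subst PhiT_mult[OF v]) auto
      with \<open>PhiT d *\<^sub>v v = 0\<^sub>v d\<close> 0 have "abt 0 0 1 * (\<Sum>c<w. beta c * v $ c) = 0"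
        by (simp add: sum_distrib_left tau_def mult.assoc)
      then show ?case by (simp add: abt_mult_eq_0)
    next
      case (Suc k)
      then have "(PhiT d *\<^sub>v v) $ Suc k = (\<Sum>c<w. tau c * v $ (Suc k * w + c))"
        by (subst PhiT_mult[OF v]) auto
      with 0 Suc.prems have "abt 0 0 1 * (\<Sum>c<w. beta c * v $ (Suc k * w + c)) = 0"
        by (simp add: sum_distrib_left tau_def mult.assoc)
      then show ?case by (simp add: abt_mult_eq_0)
    qed
  qed
next
  assume 0: "\<forall>k<d - 1. (\<Sum>c<w. beta c * v $ (k * w + c)) = 0"
  show "PhiT d *\<^sub>v v = 0\<^sub>v d"
  proof (rule eq_vecI)
    fix r assume "r < dim_vec (0\<^sub>v d :: 'k tpoly vec)"
    then have r: "r < d" by simp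
    have "(\<Sum>c<w. tau c * v $ (k * w + c)) = abt 0 0 1 * (\<Sum>c<w. beta c * v $ (k * w + c))" for k
      by (simp add: sum_distrib_left tau_def mult.assoc)
    then show "(PhiT d *\<^sub>v v) $ r = 0\<^sub>v d $ r"
      unfolding PhiT_mult[OF v r] using 0 r by auto
  qed (simp add: PhiT_def)
qed

lemma copies_beta_row_mult:
  assumes v: "v \<in> carrier_vec (d * w)" and k: "k < d"
  shows "(copies d beta_row *\<^sub>v v) $ k = (\<Sum>c<w. beta c * v $ (k * w + c) :: 'k::field tpoly)"
proof -
  have c: "copies d beta_row \<in> carrier_mat d (d * w)" using copies_carrier[OF beta_row_carrier] by simp
  have "(copies d beta_row *\<^sub>v v) $ k =
      (\<Sum>i<d. \<Sum>c<w. copies d beta_row $$ (k, i * w + c) * v $ (i * w + c))"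
    by (simp only: mult_mat_vec_index[OF c v k] sum_blocks)
  also have "\<dots> = (\<Sum>i<d. if i = k then (\<Sum>c<w. beta c * v $ (k * w + c)) else 0)"
    using k by (intro sum.cong)
      (auto simp: copies_row_index[OF beta_row_carrier] block_less beta_row_index intro!: sum.cong sum.neutral)
  finally show ?thesis using k by simp
qed

text \<open>
  Copies of the syzygies of the first row of the scroll matrix are the syzygies of Phi d.
\<close>

lemma exact_PhiT:
  assumes "exact beta_row E" "E \<in> Amat w e"
  shows "exact (PhiT d :: 'k::field tpoly mat) (copies (d - 1) E)"
proof (rule exactI[OF PhiT_carrier Amat_copies[OF assms(2)]])
  fix v :: "'k tpoly vec" assume v: "v \<in> Avec ((d - 1) * w)"
  note v' = Avec_carrier[OF v]
  have cb: "copies (d - 1) beta_row \<in> carrier_mat (d - 1) ((d - 1) * w)"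
    using copies_carrier[OF beta_row_carrier] by simp
  have "copies (d - 1) beta_row *\<^sub>v v = 0\<^sub>v (d - 1) \<longleftrightarrow>
      (\<forall>k<d - 1. (copies (d - 1) beta_row *\<^sub>v v) $ k = 0)"
    using cb by (auto intro!: eq_vecI simp del: index_mult_mat_vec)
  then have "PhiT d *\<^sub>v v = 0\<^sub>v d \<longleftrightarrow> copies (d - 1) beta_row *\<^sub>v v = 0\<^sub>v (d - 1)"
    unfolding PhiT_zero_iff[OF v'] by (simp add: copies_beta_row_mult[OF v', unfolded One_nat_def] del: index_mult_mat_vec)
  also have "\<dots> \<longleftrightarrow> (\<exists>x\<in>Avec ((d - 1) * e). v = copies (d - 1) E *\<^sub>v x)"
    using exact_copies[OF beta_row_carrier assms(2,1)]
    by (rule exactD[OF _ cb copies_carrier[OF Amat_carrier[OF assms(2)]] v])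
  finally show "PhiT d *\<^sub>v v = 0\<^sub>v d \<longleftrightarrow> (\<exists>x\<in>Avec ((d - 1) * e). v = copies (d - 1) E *\<^sub>v x)" .
qed

section \<open>Gluing a L (d-1) and b L (e-1)\<close>

text \<open>
  The columns of these matrices express a b t^j in a L (d-1) and in b L (e-1), up to sign: by
  \<open>power_form_N1T\<close> and \<open>power_form_N2T\<close>, the column j has the power form b t^j and - a t^j, respectively. The images of
  N1 and N2 are the cases (d, q) = (m-1, n-2) and (p-1, n-2), and the image of alpha0
  consists of the cases (m, n-1) and (p, n-1).
\<close>

definition N1T :: "nat \<Rightarrow> nat \<Rightarrow> 'k::field tpoly mat" where
  "N1T d q = mat d q (\<lambda>(i, j). if i = min j (d - 1) then abt 0 1 (j - i) else 0)"

definition N2T :: "nat \<Rightarrow> nat \<Rightarrow> 'k::field tpoly mat" where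
  "N2T d q = mat d q (\<lambda>(i, j). if i = j - (m - 1) then - abt 1 0 (j - i) else 0)"

lemma N1T_carrier: "N1T d q \<in> carrier_mat d q" and N2T_carrier: "N2T d q \<in> carrier_mat d q"
  and dim_N1T [simp]: "dim_row (N1T d q) = d" "dim_col (N1T d q) = q"
  and dim_N2T [simp]: "dim_row (N2T d q) = d" "dim_col (N2T d q) = q"
  by (simp_all add: N1T_def N2T_def)

lemma N1T_Amat: "q \<le> d + p - 1 \<Longrightarrow> d \<ge> 1 \<Longrightarrow> N1T d q \<in> Amat d q"
  using p2 by (auto simp: Amat_def N1T_def intro!: abt_in_L)

lemma N2T_Amat: "N2T d q \<in> Amat d q"
  using m2 by (auto simp: Amat_def N2T_def intro!: abt_in_L L_uminus)

lemma power_form_mult: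
  assumes M: "M \<in> carrier_mat d q" and u: "u \<in> carrier_vec q"
    and col: "\<And>j. j < q \<Longrightarrow> (\<Sum>i<d. abt 0 0 i * M $$ (i, j)) = c * abt 0 0 j"
  shows "power_form d (M *\<^sub>v u) = (c * power_form q u :: 'k::field tpoly)"
proof -
  have "power_form d (M *\<^sub>v u) = (\<Sum>i<d. \<Sum>j<q. abt 0 0 i * M $$ (i, j) * u $ j)"
    unfolding power_form_def
    by (intro sum.cong refl, subst mult_mat_vec_index[OF M u]) (auto simp: sum_distrib_left mult.assoc)
  also have "\<dots> = (\<Sum>j<q. (\<Sum>i<d. abt 0 0 i * M $$ (i, j)) * u $ j)"
    unfolding sum_distrib_right by (rule sum.swap)
  also have "\<dots> = c * power_form q u"
    by (simp add: col power_form_def sum_distrib_left mult.assoc)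
  finally show ?thesis .
qed

lemma power_form_N1T:
  assumes "d \<ge> 1" "u \<in> carrier_vec q"
  shows "power_form d (N1T d q *\<^sub>v u) = (abt 0 1 0 * power_form q u :: 'k::field tpoly)"
proof (rule power_form_mult[OF _ assms(2)])
  fix j assume j: "j < q"
  have "(\<Sum>i<d. abt 0 0 i * N1T d q $$ (i, j)) =
      (\<Sum>i<d. if i = min j (d - 1) then abt 0 1 j else (0 :: 'k tpoly))"
    using j by (intro sum.cong) (auto simp: N1T_def abt_mult)
  also have "\<dots> = abt 0 1 j" using assms(1) by simp
  finally show "(\<Sum>i<d. abt 0 0 i * N1T d q $$ (i, j)) = abt 0 1 0 * (abt 0 0 j :: 'k tpoly)"
    by (simp add: abt_mult)
qed (simp add: N1T_def)

lemma power_form_N2T: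
  assumes "d \<ge> 1" "q \<le> d + m - 1" "u \<in> carrier_vec q"
  shows "power_form d (N2T d q *\<^sub>v u) = (- abt 1 0 0 * power_form q u :: 'k::field tpoly)"
proof (rule power_form_mult[OF _ assms(3)])
  fix j assume j: "j < q"
  have "(\<Sum>i<d. abt 0 0 i * N2T d q $$ (i, j)) =
      (\<Sum>i<d. if i = j - (m - 1) then - abt 1 0 j else (0 :: 'k tpoly))"
    using j by (intro sum.cong) (auto simp: N2T_def abt_mult)
  also have "\<dots> = - abt 1 0 j" using assms(1,2) j by simp
  finally show "(\<Sum>i<d. abt 0 0 i * N2T d q $$ (i, j)) = - abt 1 0 0 * (abt 0 0 j :: 'k tpoly)"
    by (simp add: abt_mult)
qed (simp add: N2T_def)

lemma power_form_add:
  "x \<in> carrier_vec d \<Longrightarrow> y \<in> carrier_vec d \<Longrightarrow>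
    power_form d (x + y) = power_form d x + (power_form d y :: 'k::field tpoly)"
  by (simp add: power_form_def sum.distrib algebra_simps)

lemma power_form_minus:
  "x \<in> carrier_vec d \<Longrightarrow> y \<in> carrier_vec d \<Longrightarrow>
    power_form d (x - y) = power_form d x - (power_form d y :: 'k::field tpoly)"
  by (simp add: power_form_def sum_subtractf algebra_simps)

lemma power_form_zero [simp]: "power_form d (0\<^sub>v d) = 0"
  by (simp add: power_form_def)

lemma power_form_L: "v \<in> Avec d \<Longrightarrow> d \<ge> 1 \<Longrightarrow> power_form d v \<in> (L (d - 1) :: 'k::field tpoly set)"
  unfolding power_form_def
proof (rule L_sum)
  fix i assume "v \<in> Avec d" "d \<ge> 1" "i \<in> {..<d}"
  moreover from this have "i \<le> d - 1" by auto
  ultimately show "abt 0 0 i * v $ i \<in> L (d - 1)"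
    using L_mult[of "abt 0 0 i" "d - 1" "v $ i" 0] abt_in_L[of i 0 0 "d - 1"]
    by (auto simp: Avec_def)
qed

text \<open>
  An element f of L (d-1) such that b divides a f lies in b L (d+p-2), whose generators are the b t^k
  with k < d + p - 1.
\<close>

lemma divisible_by_b:
  assumes f: "f \<in> (L (d - 1) :: 'k::field tpoly set)" and eq: "abt 1 0 0 * f = abt 0 1 0 * g"
    and d: "d \<ge> 1"
  obtains u where "u \<in> Avec (d + p - 1)" "f = abt 0 1 0 * power_form (d + p - 1) u"
proof -
  have "\<exists>k\<in>{..<d + p - 1}. \<exists>l\<in>cone 0. r = (0, 1, k) + l" if r: "r \<in> Poly_Mapping.keys f" for r
  proof -
    obtain i j e where rr: "r = (i, j, e)" by (cases r)
    have "r \<in> cone (d - 1)" using r f by (auto simp: L_def)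
    then have e: "e \<le> i * (m - 1) + j * (p - 1) + (d - 1)" by (simp add: cone_def rr)
    have "(1, 0, 0) + r \<in> (+) (0, 1, 0) ` Poly_Mapping.keys g"
      using r arg_cong[OF eq, of Poly_Mapping.keys] unfolding abt_def keys_single_mult by blast
    then obtain j' where j: "j = Suc j'" by (auto simp: rr)
    let ?c = "min e (d + p - 2)"
    have "e \<le> i * (m - 1) + j' * (p - 1) + (d + p - 2)" using e d p2 by (simp add: j)
    then have "e - ?c \<le> i * (m - 1) + j' * (p - 1)" by linarith
    moreover have "?c < d + p - 1" using d p2 by linarith
    ultimately show ?thesis
      by (intro bexI[of _ ?c] bexI[of _ "(i, j', e - ?c)"]) (auto simp: rr cone_def j)
  qed
  then obtain y where y: "\<And>k. Poly_Mapping.keys (y k) \<subseteq> cone 0"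
    "f = (\<Sum>k<d + p - 1. Poly_Mapping.single (0, 1, k) 1 * y k)"
    using split_by_monomials[of "{..<d + p - 1}" f "cone 0" "\<lambda>k. (0, 1, k)", OF finite_lessThan] by auto
  have "f = abt 0 1 0 * power_form (d + p - 1) (vec (d + p - 1) y)"
    unfolding y(2) power_form_def sum_distrib_left
    by (intro sum.cong) (auto simp: abt_def mult_single simp flip: mult.assoc)
  then show ?thesis using y(1) by (intro that[of "vec (d + p - 1) y"]) (auto simp: Avec_def L_def)
qed

text \<open>
  The condition on d and e says that the intersection of a L (d-1) and b L (e-1) is a b L (q-1) for the
  same q in terms of d and of e.
\<close>

lemma glue_kernel:
  assumes d: "d \<ge> 1" "e \<ge> 1" "d + p = e + m" and q: "q = d + p - 1"
    and y: "y \<in> Avec d" and z: "z \<in> Avec e"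
  shows "abt 1 0 0 * power_form d y + abt 0 1 0 * power_form e z = (0 :: 'k::field tpoly) \<longleftrightarrow>
    (\<exists>x\<in>Avec ((d - 1) * w). \<exists>u\<in>Avec q. \<exists>x'\<in>Avec ((e - 1) * w).
      y = PhiT d *\<^sub>v x + N1T d q *\<^sub>v u \<and> z = N2T e q *\<^sub>v u + PhiT e *\<^sub>v x')"
proof
  note [simp] = Avec_carrier
  assume 0: "abt 1 0 0 * power_form d y + abt 0 1 0 * power_form e z = 0"
  then have "abt 1 0 0 * power_form d y = abt 0 1 0 * - power_form e z"
    by (simp add: eq_neg_iff_add_eq_0)
  with power_form_L[OF y d(1)] obtain u where u: "u \<in> Avec q" "power_form d y = abt 0 1 0 * power_form q u"
    unfolding q using d(1) by (rule divisible_by_b)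
  \<comment> \<open>Subtracting the image of u from (y, z) leaves relations between the powers of t in both parts.\<close>
  have N1: "N1T d q *\<^sub>v u \<in> Avec d" using u(1) d q by (intro Avec_mult[OF N1T_Amat]) auto
  have N2: "N2T e q *\<^sub>v u \<in> Avec e" using u(1) by (intro Avec_mult[OF N2T_Amat])
  have "power_form d (y - N1T d q *\<^sub>v u) = 0"
    using N1 y u by (simp add: power_form_minus power_form_N1T[OF d(1)])
  then obtain x where x: "x \<in> Avec ((d - 1) * w)" "y - N1T d q *\<^sub>v u = PhiT d *\<^sub>v x"
    using power_form_kernel[OF d(1) Avec_minus[OF y N1]] by blast
  have "abt 0 1 0 * (power_form e z + abt 1 0 0 * power_form q u) = 0"
    using 0 u(2) by (simp add: algebra_simps)
  then have "power_form e z + abt 1 0 0 * power_form q u = 0"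
    by (simp add: abt_mult_eq_0)
  then have "power_form e (z - N2T e q *\<^sub>v u) = 0"
    using N2 z u d q by (simp add: power_form_minus power_form_N2T[OF d(2)])
  then obtain x' where x': "x' \<in> Avec ((e - 1) * w)" "z - N2T e q *\<^sub>v u = PhiT e *\<^sub>v x'"
    using power_form_kernel[OF d(2) Avec_minus[OF z N2]] by blast
  have "y = PhiT d *\<^sub>v x + N1T d q *\<^sub>v u"
    unfolding x(2)[symmetric] using Avec_carrier[OF y] Avec_carrier[OF N1] by (intro eq_vecI) auto
  moreover have "z = N2T e q *\<^sub>v u + PhiT e *\<^sub>v x'"
    unfolding x'(2)[symmetric] using Avec_carrier[OF z] Avec_carrier[OF N2] by (intro eq_vecI) auto
  ultimately show "\<exists>x\<in>Avec ((d - 1) * w). \<exists>u\<in>Avec q. \<exists>x'\<in>Avec ((e - 1) * w).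
      y = PhiT d *\<^sub>v x + N1T d q *\<^sub>v u \<and> z = N2T e q *\<^sub>v u + PhiT e *\<^sub>v x'"
    using x(1) x'(1) u(1) by blast
next
  assume "\<exists>x\<in>Avec ((d - 1) * w). \<exists>u\<in>Avec q. \<exists>x'\<in>Avec ((e - 1) * w).
      y = PhiT d *\<^sub>v x + N1T d q *\<^sub>v u \<and> z = N2T e q *\<^sub>v u + PhiT e *\<^sub>v x'"
  then obtain x u x' where x: "x \<in> Avec ((d - 1) * w)" "u \<in> Avec q" "x' \<in> Avec ((e - 1) * w)"
    "y = PhiT d *\<^sub>v x + N1T d q *\<^sub>v u" "z = N2T e q *\<^sub>v u + PhiT e *\<^sub>v x'" by blast
  note c = x(1-3)[THEN Avec_carrier]
  have "power_form d y = abt 0 1 0 * power_form q u"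
    unfolding x(4) power_form_add[OF mult_mat_vec_carrier[OF PhiT_carrier c(1)] mult_mat_vec_carrier[OF N1T_carrier c(2)]]
    by (simp add: power_form_PhiT[OF c(1)] power_form_N1T[OF d(1) c(2)])
  moreover have "power_form e z = - abt 1 0 0 * power_form q u"
    unfolding x(5) power_form_add[OF mult_mat_vec_carrier[OF N2T_carrier c(2)] mult_mat_vec_carrier[OF PhiT_carrier c(3)]]
    using d q power_form_N2T[OF d(2) _ c(2)] by (simp add: power_form_PhiT[OF c(3)])
  ultimately show "abt 1 0 0 * power_form d y + abt 0 1 0 * power_form e z = 0"
    by (simp add: algebra_simps)
qed

lemma mult_mat_vec_uminus:
  assumes "M \<in> carrier_mat r c" "v \<in> carrier_vec c"
  shows "M *\<^sub>v (- v) = - (M *\<^sub>v v :: 'a::comm_ring_1 vec)"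
  using assms by (intro eq_vecI) (auto simp: scalar_prod_uminus_right)

lemma uminus_mult_mat_vec':
  assumes "M \<in> carrier_mat r c" "v \<in> carrier_vec c"
  shows "(- M) *\<^sub>v v = - (M *\<^sub>v v :: 'a::comm_ring_1 vec)"
  using assms by (intro eq_vecI) auto

lemma add_uminus_eq_zero_vec: "v \<in> carrier_vec r \<Longrightarrow> v + - v = (0\<^sub>v r :: 'a::comm_ring_1 vec)"
  by (intro eq_vecI) auto

text \<open>
  The syzygies of the matrix of \<open>glue_kernel\<close>. The component u of a syzygy is a relation between
  1, t, ..., t^(q-1), as the part with PhiT d does not contribute to the power form. So u comes from Phi q,
  and after subtracting the lift given by U and V only syzygies of Phi d and Phi e remain.
\<close>

lemma glue_syzygies:
  assumes d: "d \<ge> 1" "e \<ge> 1" "d + p = e + m" and q: "q = d + p - 1"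
    and X1: "X1 \<in> Amat ((d - 1) * w) a" "exact (PhiT d) X1"
    and X2: "X2 \<in> Amat ((e - 1) * w) b" "exact (PhiT e) X2"
    and U: "U \<in> Amat ((d - 1) * w) ((q - 1) * w)" "PhiT d * U = N1T d q * PhiT q"
    and V: "V \<in> Amat ((e - 1) * w) ((q - 1) * w)" "PhiT e * V = N2T e q * PhiT q"
    and x: "x \<in> Avec ((d - 1) * w)" and u: "u \<in> Avec q" and z: "z \<in> Avec ((e - 1) * w)"
  shows "PhiT d *\<^sub>v x + N1T d q *\<^sub>v u = 0\<^sub>v d \<and> N2T e q *\<^sub>v u + PhiT e *\<^sub>v z = (0\<^sub>v e :: 'k::field tpoly vec) \<longleftrightarrow>
    (\<exists>x'\<in>Avec a. \<exists>y\<in>Avec ((q - 1) * w). \<exists>z'\<in>Avec b.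
       x = X1 *\<^sub>v x' + U *\<^sub>v y \<and> u = (- PhiT q) *\<^sub>v y \<and> z = V *\<^sub>v y + X2 *\<^sub>v z')"
proof -
  have N1: "N1T d q \<in> carrier_mat d q" and N2: "N2T e q \<in> carrier_mat e q"
    by (simp_all add: N1T_def N2T_def)
  note P = PhiT_carrier
  note car = Amat_carrier[OF U(1)] Amat_carrier[OF V(1)] Amat_carrier[OF X1(1)] Amat_carrier[OF X2(1)]
  have q1: "q \<ge> 1" using d q p2 by simp
  have act1: "PhiT d *\<^sub>v (U *\<^sub>v y) = N1T d q *\<^sub>v (PhiT q *\<^sub>v y)" 
    and act2: "PhiT e *\<^sub>v (V *\<^sub>v y) = N2T e q *\<^sub>v (PhiT q *\<^sub>v y)"
    if "y \<in> carrier_vec ((q - 1) * w)" for y :: "'k tpoly vec"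
    by (simp_all only: assoc_mult_mat_vec[OF P car(1) that, symmetric] assoc_mult_mat_vec[OF P car(2) that, symmetric]
      assoc_mult_mat_vec[OF N1 P that, symmetric] assoc_mult_mat_vec[OF N2 P that, symmetric] U(2) V(2))
  show ?thesis
  proof
    assume 0: "PhiT d *\<^sub>v x + N1T d q *\<^sub>v u = 0\<^sub>v d \<and> N2T e q *\<^sub>v u + PhiT e *\<^sub>v z = 0\<^sub>v e"
    have "power_form d (PhiT d *\<^sub>v x + N1T d q *\<^sub>v u) = abt 0 1 0 * power_form q u"
      using Avec_carrier[OF x] Avec_carrier[OF u] N1 P[of d]
      by (subst power_form_add) (auto simp: power_form_PhiT power_form_N1T[OF d(1)] intro!: mult_mat_vec_carrier)
    with 0 have "abt 0 1 0 * power_form q u = 0" by simp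
    then have "power_form q u = 0" by (simp add: abt_mult_eq_0)
    then obtain y0 where y0: "y0 \<in> Avec ((q - 1) * w)" "u = PhiT q *\<^sub>v y0"
      using power_form_kernel[OF q1 u] by blast
    note y0' = Avec_carrier[OF y0(1)]
    have Uy: "U *\<^sub>v y0 \<in> Avec ((d - 1) * w)" and Vy: "V *\<^sub>v y0 \<in> Avec ((e - 1) * w)"
      using y0(1) U(1) V(1) by (auto intro: Avec_mult)
    note c = Avec_carrier[OF x] Avec_carrier[OF z] Avec_carrier[OF Uy] Avec_carrier[OF Vy] Avec_carrier[OF u]
    have "PhiT d *\<^sub>v (x + U *\<^sub>v y0) = PhiT d *\<^sub>v x + N1T d q *\<^sub>v u"
      using c by (simp only: mult_add_distrib_mat_vec[OF P] act1[OF y0'] y0(2))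
    with 0 have "PhiT d *\<^sub>v (x + U *\<^sub>v y0) = 0\<^sub>v d" by simp
    then obtain x' where x': "x' \<in> Avec a" "x + U *\<^sub>v y0 = X1 *\<^sub>v x'"
      using exactD[OF X1(2) P car(3) Avec_add[OF x Uy]] by blast
    have "PhiT e *\<^sub>v (V *\<^sub>v y0 + z) = N2T e q *\<^sub>v u + PhiT e *\<^sub>v z"
      using c by (simp only: mult_add_distrib_mat_vec[OF P] act2[OF y0'] y0(2))
    with 0 have "PhiT e *\<^sub>v (V *\<^sub>v y0 + z) = 0\<^sub>v e" by simp
    then obtain z' where z': "z' \<in> Avec b" "V *\<^sub>v y0 + z = X2 *\<^sub>v z'"
      using exactD[OF X2(2) P car(4) Avec_add[OF Vy z]] by blast
    have "x = X1 *\<^sub>v x' + U *\<^sub>v (- y0)"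
      unfolding mult_mat_vec_uminus[OF car(1) y0'] x'(2)[symmetric]
      using c car by (intro eq_vecI) auto
    moreover have "z = V *\<^sub>v (- y0) + X2 *\<^sub>v z'"
      unfolding mult_mat_vec_uminus[OF car(2) y0'] z'(2)[symmetric]
      using c car by (intro eq_vecI) auto
    moreover have "u = (- PhiT q) *\<^sub>v (- y0)"
      using y0(2) y0' P[of q] mult_mat_vec_uminus[OF P y0'] uminus_mult_mat_vec'[OF P, of "- y0" q]
      by simp
    ultimately show "\<exists>x'\<in>Avec a. \<exists>y\<in>Avec ((q - 1) * w). \<exists>z'\<in>Avec b.
       x = X1 *\<^sub>v x' + U *\<^sub>v y \<and> u = (- PhiT q) *\<^sub>v y \<and> z = V *\<^sub>v y + X2 *\<^sub>v z'"
      using x'(1) z'(1) Avec_uminus[OF y0(1)] by blast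
  next
    assume "\<exists>x'\<in>Avec a. \<exists>y\<in>Avec ((q - 1) * w). \<exists>z'\<in>Avec b.
       x = X1 *\<^sub>v x' + U *\<^sub>v y \<and> u = (- PhiT q) *\<^sub>v y \<and> z = V *\<^sub>v y + X2 *\<^sub>v z'"
    then obtain x' y z' where xyz: "x' \<in> Avec a" "y \<in> Avec ((q - 1) * w)" "z' \<in> Avec b"
      "x = X1 *\<^sub>v x' + U *\<^sub>v y" "u = (- PhiT q) *\<^sub>v y" "z = V *\<^sub>v y + X2 *\<^sub>v z'" by blast
    have X1x: "X1 *\<^sub>v x' \<in> Avec ((d - 1) * w)" and X2z: "X2 *\<^sub>v z' \<in> Avec ((e - 1) * w)"
      and Uy: "U *\<^sub>v y \<in> Avec ((d - 1) * w)" and Vy: "V *\<^sub>v y \<in> Avec ((e - 1) * w)"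
      and Py: "PhiT q *\<^sub>v y \<in> Avec q"
      using xyz(1-3) X1(1) X2(1) U(1) V(1) by (auto intro: Avec_mult PhiT_Amat)
    note c = Avec_carrier[OF X1x] Avec_carrier[OF X2z] Avec_carrier[OF Uy] Avec_carrier[OF Vy]
    have "PhiT d *\<^sub>v (X1 *\<^sub>v x') = 0\<^sub>v d" "PhiT e *\<^sub>v (X2 *\<^sub>v z') = 0\<^sub>v e"
      using exactD[OF X1(2) P car(3) X1x] exactD[OF X2(2) P car(4) X2z] xyz by blast+
    moreover have "u = - (PhiT q *\<^sub>v y)"
      using xyz(5) uminus_mult_mat_vec'[OF P Avec_carrier[OF xyz(2)]] by simp
    then have "N1T d q *\<^sub>v u = - (N1T d q *\<^sub>v (PhiT q *\<^sub>v y))" "N2T e q *\<^sub>v u = - (N2T e q *\<^sub>v (PhiT q *\<^sub>v y))"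
      using mult_mat_vec_uminus[OF N1 Avec_carrier[OF Py]] mult_mat_vec_uminus[OF N2 Avec_carrier[OF Py]] by simp_all
    ultimately show "PhiT d *\<^sub>v x + N1T d q *\<^sub>v u = 0\<^sub>v d \<and> N2T e q *\<^sub>v u + PhiT e *\<^sub>v z = 0\<^sub>v e"
      unfolding xyz(4,6) mult_add_distrib_mat_vec[OF P c(1,3)] mult_add_distrib_mat_vec[OF P c(4,2)]
        act1[OF Avec_carrier[OF xyz(2)]] act2[OF Avec_carrier[OF xyz(2)]]
      using N1 N2 by (auto intro!: eq_vecI simp del: index_mult_mat_vec)
  qed
qed

end

section \<open>Concatenation of blocks\<close>

lemma append_cols_index:
  assumes "A \<in> carrier_mat r a" "B \<in> carrier_mat r b" "i < r" "j < a + b"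
  shows "(A @\<^sub>c B) $$ (i, j) = (if j < a then A $$ (i, j) else B $$ (i, j - a))"
  using assms unfolding append_cols_def by auto

lemma append_rows_index:
  assumes "A \<in> carrier_mat r a" "B \<in> carrier_mat s a" "i < r + s" "j < a"
  shows "(A @\<^sub>r B) $$ (i, j) = (if i < r then A $$ (i, j) else B $$ (i - r, j))"
  using assms unfolding append_rows_def by auto

lemma foldr_append_cols:
  assumes "\<And>x. x \<in> set xs \<Longrightarrow> f x \<in> carrier_mat r v" "Z \<in> carrier_mat r c"
  shows "foldr (@\<^sub>c) (map f xs) Z \<in> carrier_mat r (length xs * v + c)"
    and "i < r \<Longrightarrow> j < length xs * v + c \<Longrightarrow> foldr (@\<^sub>c) (map f xs) Z $$ (i, j) =
      (if j < length xs * v then f (xs ! (j div v)) $$ (i, j mod v) else Z $$ (i, j - length xs * v))"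
  using assms
proof (induction xs arbitrary: j)
  case (Cons x xs)
  {
    case 1
    then show ?case using append_cols_carrier[of "f x" r v, OF _ Cons.IH(1)] by (simp add: add.assoc)
  next
    case 2
    have car: "foldr (@\<^sub>c) (map f xs) Z \<in> carrier_mat r (length xs * v + c)" "f x \<in> carrier_mat r v"
      using 2 Cons.IH(1) by auto
    show ?case
    proof (cases "j < v")
      case True
      then show ?thesis using 2 append_cols_index[OF car(2,1) 2(1), of j] by simp
    next
      case False
      then have jv: "j div v = Suc ((j - v) div v)" "j mod v = (j - v) mod v" if "v > 0"
        using that by (simp_all add: le_div_geq le_mod_geq)
      have "(foldr (@\<^sub>c) (map f (x # xs)) Z) $$ (i, j) = foldr (@\<^sub>c) (map f xs) Z $$ (i, j - v)"
        using 2 append_cols_index[OF car(2,1) 2(1), of j] False by simp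
      also have "\<dots> = (if j - v < length xs * v then f (xs ! ((j - v) div v)) $$ (i, (j - v) mod v)
          else Z $$ (i, j - v - length xs * v))"
        using 2 False by (intro Cons.IH(2)) auto
      finally show ?thesis using False jv by (cases "v = 0") (auto simp: less_diff_conv2)
    qed
  }
qed auto

lemma mult_mat_index:
  assumes "M \<in> carrier_mat r c" "N \<in> carrier_mat c e" "i < r" "j < e"
  shows "(M * N) $$ (i, j) = (\<Sum>l<c. M $$ (i, l) * N $$ (l, j))"
  using assms by (auto simp: scalar_prod_def atLeast0LessThan intro!: sum.cong)

lemma add_zero_right_vec: "x \<in> carrier_vec n \<Longrightarrow> x + 0\<^sub>v n = (x :: 'a::comm_ring_1 vec)"
  and add_zero_left_vec: "x \<in> carrier_vec n \<Longrightarrow> 0\<^sub>v n + x = (x :: 'a::comm_ring_1 vec)"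
  by (intro eq_vecI; auto)+

lemma zero_mult_mat_vec: "x \<in> carrier_vec c \<Longrightarrow> 0\<^sub>m r c *\<^sub>v x = (0\<^sub>v r :: 'a::comm_ring_1 vec)"
  by (intro eq_vecI) auto

lemma two_block_mult:
  assumes "A \<in> carrier_mat r a" "U \<in> carrier_mat r b" "V \<in> carrier_mat s b" "B \<in> carrier_mat s c"
    "x \<in> carrier_vec a" "y \<in> carrier_vec b" "z \<in> carrier_vec c"
  shows "((A @\<^sub>c U @\<^sub>c 0\<^sub>m r c) @\<^sub>r (0\<^sub>m s a @\<^sub>c V @\<^sub>c B)) *\<^sub>v (x @\<^sub>v y @\<^sub>v z) =
    (A *\<^sub>v x + U *\<^sub>v y) @\<^sub>v (V *\<^sub>v y + B *\<^sub>v (z :: 'a::comm_ring_1 vec))"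
proof -
  have yz: "y @\<^sub>v z \<in> carrier_vec (b + c)" and xyz: "x @\<^sub>v y @\<^sub>v z \<in> carrier_vec (a + (b + c))"
    using assms by auto
  have 1: "(A @\<^sub>c U @\<^sub>c 0\<^sub>m r c) \<in> carrier_mat r (a + (b + c))"
    and 2: "(0\<^sub>m s a @\<^sub>c V @\<^sub>c B) \<in> carrier_mat s (a + (b + c))"
    using assms by (auto intro!: append_cols_carrier)
  have "(A @\<^sub>c U @\<^sub>c 0\<^sub>m r c) *\<^sub>v (x @\<^sub>v y @\<^sub>v z) = A *\<^sub>v x + U *\<^sub>v y"
    using assms yz
    by (simp add: append_cols_mult_vec[where r=r and a=a and b="b + c"] append_cols_carrier
      append_cols_mult_vec[where r=r and a=b and b=c] zero_mult_mat_vec add_zero_right_vec[where n=r])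
  moreover have "(0\<^sub>m s a @\<^sub>c V @\<^sub>c B) *\<^sub>v (x @\<^sub>v y @\<^sub>v z) = V *\<^sub>v y + B *\<^sub>v z"
    using assms yz
    by (simp add: append_cols_mult_vec[where r=s and a=a and b="b + c"] append_cols_carrier
      append_cols_mult_vec[where r=s and a=b and b=c] zero_mult_mat_vec add_zero_left_vec[where n=s])
  ultimately show ?thesis by (simp add: mat_mult_append[OF 1 2 xyz])
qed

lemma three_block_mult:
  assumes "A \<in> carrier_mat r a" "U \<in> carrier_mat r b" "C \<in> carrier_mat q b" "V \<in> carrier_mat s b" "B \<in> carrier_mat s c"
    "x \<in> carrier_vec a" "y \<in> carrier_vec b" "z \<in> carrier_vec c"
  shows "((A @\<^sub>c U @\<^sub>c 0\<^sub>m r c) @\<^sub>r (0\<^sub>m q a @\<^sub>c C @\<^sub>c 0\<^sub>m q c) @\<^sub>r (0\<^sub>m s a @\<^sub>c V @\<^sub>c B)) *\<^sub>v (x @\<^sub>v y @\<^sub>v z) =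
    (A *\<^sub>v x + U *\<^sub>v y) @\<^sub>v (C *\<^sub>v y) @\<^sub>v (V *\<^sub>v y + B *\<^sub>v (z :: 'a::comm_ring_1 vec))"
proof -
  have yz: "y @\<^sub>v z \<in> carrier_vec (b + c)" and xyz: "x @\<^sub>v y @\<^sub>v z \<in> carrier_vec (a + (b + c))"
    using assms by auto
  have 1: "(A @\<^sub>c U @\<^sub>c 0\<^sub>m r c) \<in> carrier_mat r (a + (b + c))"
    and 2: "(0\<^sub>m s a @\<^sub>c V @\<^sub>c B) \<in> carrier_mat s (a + (b + c))"
    and 3: "(0\<^sub>m q a @\<^sub>c C @\<^sub>c 0\<^sub>m q c) \<in> carrier_mat q (a + (b + c))"
    using assms by (auto intro!: append_cols_carrier)
  have "(A @\<^sub>c U @\<^sub>c 0\<^sub>m r c) *\<^sub>v (x @\<^sub>v y @\<^sub>v z) = A *\<^sub>v x + U *\<^sub>v y"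
    using assms yz
    by (simp add: append_cols_mult_vec[where r=r and a=a and b="b + c"] append_cols_carrier
      append_cols_mult_vec[where r=r and a=b and b=c] zero_mult_mat_vec add_zero_right_vec[where n=r])
  moreover have "(0\<^sub>m s a @\<^sub>c V @\<^sub>c B) *\<^sub>v (x @\<^sub>v y @\<^sub>v z) = V *\<^sub>v y + B *\<^sub>v z"
    using assms yz
    by (simp add: append_cols_mult_vec[where r=s and a=a and b="b + c"] append_cols_carrier
      append_cols_mult_vec[where r=s and a=b and b=c] zero_mult_mat_vec add_zero_left_vec[where n=s])
  moreover have "(0\<^sub>m q a @\<^sub>c C @\<^sub>c 0\<^sub>m q c) *\<^sub>v (x @\<^sub>v y @\<^sub>v z) = C *\<^sub>v y"
    using assms yz
    by (simp add: append_cols_mult_vec[where r=q and a=a and b="b + c"] append_cols_carrier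
      append_cols_mult_vec[where r=q and a=b and b=c] zero_mult_mat_vec add_zero_left_vec[where n=q]
      add_zero_right_vec[where n=q])
  ultimately show ?thesis
    by (simp add: mat_mult_append[OF 1 carrier_append_rows[OF 3 2] xyz] mat_mult_append[OF 3 2 xyz])
qed

lemma append_vec_eq3:
  assumes "x \<in> carrier_vec a" "x' \<in> carrier_vec a" "y \<in> carrier_vec b" "y' \<in> carrier_vec b"
  shows "x @\<^sub>v y @\<^sub>v z = x' @\<^sub>v y' @\<^sub>v z' \<longleftrightarrow> x = x' \<and> y = y' \<and> z = z'"
  using append_vec_eq[OF assms(1,2), of "y @\<^sub>v z" "y' @\<^sub>v z'"] append_vec_eq[OF assms(3,4), of z z'] by simp

context scroll begin

section \<open>Mapping cones\<close>

lemma exact_transfer: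
  assumes "exact D E" "D \<in> carrier_mat r c" "E \<in> Amat c e" "D' \<in> carrier_mat r' c"
    and "\<And>v. v \<in> Avec c \<Longrightarrow> D' *\<^sub>v v = 0\<^sub>v r' \<longleftrightarrow> D *\<^sub>v v = 0\<^sub>v r"
  shows "exact D' (E :: 'k::field tpoly mat)"
  using exactD[OF assms(1,2) Amat_carrier[OF assms(3)]] assms(5)
  by (intro exactI[OF assms(4,3)]) auto

text \<open>
  The mapping cone of a chain map. If y = C' z, then x + al' z is in the kernel of A for every
  (x, y) in the kernel of the first block matrix, because A al' = al C'.
\<close>

lemma exact_cone:
  assumes A: "A \<in> carrier_mat r c" "A' \<in> Amat c e" "exact A A'"
    and C: "C \<in> carrier_mat s d" "C' \<in> Amat d f" "exact C C'"
    and al: "al \<in> Amat r d" and al': "al' \<in> Amat c f" and comm: "A * al' = al * (C' :: 'k::field tpoly mat)"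
  shows "exact (four_block_mat A al (0\<^sub>m s c) (- C)) (four_block_mat A' al' (0\<^sub>m d e) (- C'))"
proof (rule exactI)
  note A' = Amat_carrier[OF A(2)] and C' = Amat_carrier[OF C(2)]
  note alc = Amat_carrier[OF al] and alc' = Amat_carrier[OF al']
  show "four_block_mat A al (0\<^sub>m s c) (- C) \<in> carrier_mat (r + s) (c + d)"
    using A C by auto
  have "- C' \<in> Amat d f" using C(2) by (auto simp: Amat_def intro!: L_uminus)
  then show "four_block_mat A' al' (0\<^sub>m d e) (- C') \<in> Amat (c + d) (e + f)"
    using A al' by (intro Amat_four_block Amat_zero)
  fix v :: "'k tpoly vec" assume "v \<in> Avec (c + d)"
  then obtain x y where v: "x \<in> Avec c" "y \<in> Avec d" "v = x @\<^sub>v y" by (rule Avec_split)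
  note vc = v(1,2)[THEN Avec_carrier]
  have act: "four_block_mat A al (0\<^sub>m s c) (- C) *\<^sub>v v = (A *\<^sub>v x + al *\<^sub>v y) @\<^sub>v - (C *\<^sub>v y)"
    unfolding v(3) using vc A(1) C(1) alc
    by (subst four_block_mat_mult_vec[where ?nr1.0=r and ?nr2.0=s and ?nc1.0=c and ?nc2.0=d])
      (auto simp: zero_mult_mat_vec add_zero_left_vec uminus_mult_mat_vec')
  have act': "four_block_mat A' al' (0\<^sub>m d e) (- C') *\<^sub>v (x' @\<^sub>v y') = (A' *\<^sub>v x' + al' *\<^sub>v y') @\<^sub>v - (C' *\<^sub>v y')"
    if "x' \<in> carrier_vec e" "y' \<in> carrier_vec f" for x' y' :: "'k tpoly vec"
    using that A' C' alc'
    by (subst four_block_mat_mult_vec[where ?nr1.0=c and ?nr2.0=d and ?nc1.0=e and ?nc2.0=f])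
      (auto simp: zero_mult_mat_vec add_zero_left_vec uminus_mult_mat_vec')
  have comm': "A *\<^sub>v (al' *\<^sub>v z) = al *\<^sub>v (C' *\<^sub>v z)" if "z \<in> carrier_vec f" for z
    by (simp only: assoc_mult_mat_vec[OF A(1) alc' that, symmetric] comm assoc_mult_mat_vec[OF alc C' that])
  have "four_block_mat A al (0\<^sub>m s c) (- C) *\<^sub>v v = 0\<^sub>v (r + s) \<longleftrightarrow>
      A *\<^sub>v x + al *\<^sub>v y = 0\<^sub>v r \<and> - (C *\<^sub>v y) = 0\<^sub>v s"
    unfolding act using A(1) C(1) alc vc by (intro append_vec_eq_zero) auto
  also have "- (C *\<^sub>v y) = 0\<^sub>v s \<longleftrightarrow> C *\<^sub>v y = 0\<^sub>v s"
    using C(1) vc by (subst uminus_zero_vec_eq) auto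
  finally have iff: "four_block_mat A al (0\<^sub>m s c) (- C) *\<^sub>v v = 0\<^sub>v (r + s) \<longleftrightarrow>
      A *\<^sub>v x + al *\<^sub>v y = 0\<^sub>v r \<and> C *\<^sub>v y = 0\<^sub>v s" .
  show "four_block_mat A al (0\<^sub>m s c) (- C) *\<^sub>v v = 0\<^sub>v (r + s) \<longleftrightarrow>
    (\<exists>z\<in>Avec (e + f). v = four_block_mat A' al' (0\<^sub>m d e) (- C') *\<^sub>v z)"
    unfolding iff
  proof
    assume 0: "A *\<^sub>v x + al *\<^sub>v y = 0\<^sub>v r \<and> C *\<^sub>v y = 0\<^sub>v s"
    then obtain z where z: "z \<in> Avec f" "y = C' *\<^sub>v z"
      using exactD[OF C(3,1) C' v(2)] by blast
    note zc = Avec_carrier[OF z(1)]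
    have az: "al' *\<^sub>v z \<in> Avec c" using al' z(1) by (rule Avec_mult)
    have "A *\<^sub>v (x + al' *\<^sub>v z) = A *\<^sub>v x + al *\<^sub>v y"
      by (simp only: mult_add_distrib_mat_vec[OF A(1) vc(1) Avec_carrier[OF az]] comm'[OF zc] z(2))
    with 0 obtain x' where x': "x' \<in> Avec e" "x + al' *\<^sub>v z = A' *\<^sub>v x'"
      using exactD[OF A(3,1) A' Avec_add[OF v(1) az]] by metis
    note c = vc zc Avec_carrier[OF az] Avec_carrier[OF x'(1)]
    have "x = A' *\<^sub>v x' + al' *\<^sub>v (- z)"
      unfolding mult_mat_vec_uminus[OF alc' zc] x'(2)[symmetric]
      using c alc' by (intro eq_vecI) auto
    moreover have "y = - (C' *\<^sub>v (- z))"
      unfolding mult_mat_vec_uminus[OF C' zc] using z(2) by simp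
    ultimately have "v = four_block_mat A' al' (0\<^sub>m d e) (- C') *\<^sub>v (x' @\<^sub>v - z)"
      using act'[of x' "- z"] c v(3) by simp
    then show "\<exists>z\<in>Avec (e + f). v = four_block_mat A' al' (0\<^sub>m d e) (- C') *\<^sub>v z"
      using Avec_append[OF x'(1) Avec_uminus[OF z(1)]] by blast
  next
    assume "\<exists>z\<in>Avec (e + f). v = four_block_mat A' al' (0\<^sub>m d e) (- C') *\<^sub>v z"
    then obtain z where z: "z \<in> Avec (e + f)" "v = four_block_mat A' al' (0\<^sub>m d e) (- C') *\<^sub>v z" by blast
    from z(1) obtain x' y' where xy': "x' \<in> Avec e" "y' \<in> Avec f" "z = x' @\<^sub>v y'" by (rule Avec_split)
    note c = xy'(1,2)[THEN Avec_carrier]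
    have A'x: "A' *\<^sub>v x' \<in> Avec c" and ay: "al' *\<^sub>v y' \<in> Avec c" and C'y: "C' *\<^sub>v y' \<in> Avec d"
      using A(2) al' C(2) xy' by (auto intro: Avec_mult)
    note cc = A'x[THEN Avec_carrier] ay[THEN Avec_carrier] C'y[THEN Avec_carrier]
    have "x @\<^sub>v y = (A' *\<^sub>v x' + al' *\<^sub>v y') @\<^sub>v - (C' *\<^sub>v y')"
      using z(2) act'[OF c] v(3) xy'(3) by simp
    then have "x = A' *\<^sub>v x' + al' *\<^sub>v y' \<and> y = - (C' *\<^sub>v y')"
      using append_vec_eq[OF vc(1) add_carrier_vec[OF cc(1,2)]] by metis
    then have x: "x = A' *\<^sub>v x' + al' *\<^sub>v y'" and y: "y = - (C' *\<^sub>v y')" by blast+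
    have 1: "A *\<^sub>v (A' *\<^sub>v x') = 0\<^sub>v r"
      using exactD[OF A(3,1) A' A'x] xy' by blast
    have 2: "C *\<^sub>v (C' *\<^sub>v y') = 0\<^sub>v s"
      using exactD[OF C(3,1) C' C'y] xy' by blast
    have "A *\<^sub>v x = al *\<^sub>v (C' *\<^sub>v y')"
      unfolding x mult_add_distrib_mat_vec[OF A(1) cc(1,2)] 1 comm'[OF c(2)]
      using alc by (intro eq_vecI) auto
    moreover have "al *\<^sub>v y = - (al *\<^sub>v (C' *\<^sub>v y'))"
      unfolding y by (rule mult_mat_vec_uminus[OF alc cc(3)])
    moreover have "C *\<^sub>v y = 0\<^sub>v s"
      unfolding y mult_mat_vec_uminus[OF C(1) cc(3)] 2 by simp
    ultimately show "A *\<^sub>v x + al *\<^sub>v y = 0\<^sub>v r \<and> C *\<^sub>v y = 0\<^sub>v s"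
      using add_uminus_eq_zero_vec[of "al *\<^sub>v (C' *\<^sub>v y')" r] alc cc by auto
  qed
qed

lemma Avec_split3:
  "(\<exists>s\<in>Avec (a + (b + c)). P s) \<longleftrightarrow>
    (\<exists>x\<in>Avec a. \<exists>y\<in>Avec b. \<exists>z\<in>Avec c. P (x @\<^sub>v y @\<^sub>v (z :: 'k::field tpoly vec)))"
  by (metis Avec_append Avec_split)

section \<open>The blocks U and V\<close>

lemma mult_PhiT_index:
  assumes M: "M \<in> carrier_mat d q" and i: "i < d" and k: "k < q - 1" and c: "c < w"
  shows "(M * PhiT q) $$ (i, k * w + c) = M $$ (i, k) * tau c - M $$ (i, Suc k) * (beta c :: 'k::field tpoly)"
proof -
  have "(M * PhiT q) $$ (i, k * w + c) = (\<Sum>l<q. M $$ (i, l) * PhiT q $$ (l, k * w + c))"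
    using block_less[OF k c] by (intro mult_mat_index[OF M PhiT_carrier i]) simp
  also have "\<dots> = (\<Sum>l<q. (if l = k then M $$ (i, k) * tau c else 0) -
      (if l = Suc k then M $$ (i, Suc k) * beta c else 0))"
    using k c by (intro sum.cong) (auto simp: PhiT_index)
  also have "\<dots> = M $$ (i, k) * tau c - M $$ (i, Suc k) * beta c"
    using k unfolding sum_subtractf by (simp add: less_diff_conv)
  finally show ?thesis .
qed

lemma PhiT_mult_single:
  assumes M: "M \<in> carrier_mat ((d - 1) * w) e" and i: "i < d" and j: "j < e"
    and entry: "\<And>l. l < (d - 1) * w \<Longrightarrow> M $$ (l, j) = (if l = l0 then x else 0)" and l0: "l0 < (d - 1) * w"
  shows "(PhiT d * M) $$ (i, j) = PhiT d $$ (i, l0) * (x :: 'k::field tpoly)"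
proof -
  have "(PhiT d * M) $$ (i, j) = (\<Sum>l<(d - 1) * w. PhiT d $$ (i, l) * M $$ (l, j))"
    by (rule mult_mat_index[OF PhiT_carrier M i j])
  also have "\<dots> = (\<Sum>l<(d - 1) * w. if l = l0 then PhiT d $$ (i, l0) * x else 0)"
    using entry by (intro sum.cong) auto
  finally show ?thesis using l0 by simp
qed

lemma PhiT_mult_zero:
  assumes M: "M \<in> carrier_mat ((d - 1) * w) e" and i: "i < d" and j: "j < e"
    and entry: "\<And>l. l < (d - 1) * w \<Longrightarrow> M $$ (l, j) = 0"
  shows "(PhiT d * M) $$ (i, j) = (0 :: 'k::field tpoly)"
  using mult_mat_index[OF PhiT_carrier M i j] entry by simp

text \<open>
  For k \<ge> d - 1, the entries of the last row of N1T in the columns k and k + 1 differ by the factor t,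
  and so do beta and tau. Hence the two terms of the product cancel.
\<close>

lemma N1T_PhiT:
  assumes "i < d" "k < q - 1" "c < w"
  shows "(N1T d q * PhiT q) $$ (i, k * w + c) =
    (if k < d - 1 then abt 0 1 0 * PhiT d $$ (i, k * w + c) else (0 :: 'k::field tpoly))"
proof -
  have *: "(N1T d q * PhiT q) $$ (i, k * w + c) = N1T d q $$ (i, k) * tau c - N1T d q $$ (i, Suc k) * (beta c :: 'k tpoly)"
    by (rule mult_PhiT_index[OF N1T_carrier assms])
  show ?thesis
  proof (cases "k < d - 1")
    case True
    then show ?thesis unfolding * using assms by (auto simp: N1T_def PhiT_index)
  next
    case False
    then have "min k (d - 1) = d - 1" "min (Suc k) (d - 1) = d - 1" "Suc (k - (d - 1)) = Suc k - (d - 1)" by auto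
    then show ?thesis unfolding * using assms False
      by (auto simp: N1T_def tau_def abt_mult simp flip: mult.assoc)
  qed
qed

lemma N2T_PhiT:
  assumes "i < d" "k < q - 1" "c < w" "q \<le> d + m - 1"
  shows "(N2T d q * PhiT q) $$ (i, k * w + c) =
    (if m - 1 \<le> k then - abt 1 0 (m - 1) * PhiT d $$ (i, (k - (m - 1)) * w + c) else (0 :: 'k::field tpoly))"
proof -
  have *: "(N2T d q * PhiT q) $$ (i, k * w + c) = N2T d q $$ (i, k) * tau c - N2T d q $$ (i, Suc k) * (beta c :: 'k tpoly)"
    by (rule mult_PhiT_index[OF N2T_carrier assms(1-3)])
  show ?thesis
  proof (cases "m - 1 \<le> k")
    case True
    then have "k < q" "Suc k < q" "k - (m - 1) < d - 1" "Suc k - (m - 1) = Suc (k - (m - 1))" "k - (k - (m - 1)) = m - 1"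
      using assms m2 by auto
    then show ?thesis unfolding * using assms True by (auto simp: N2T_def PhiT_index)
  next
    case False
    then have "k - (m - 1) = 0" "Suc k - (m - 1) = 0" by auto
    then show ?thesis unfolding * using assms False
      by (auto simp: N2T_def tau_def abt_mult simp flip: mult.assoc)
  qed
qed

text \<open>
  The images of U and V, see \<open>pmat_U\<close> and \<open>pmat_V\<close>, with rows and columns numbered from 0.
\<close>

definition UT :: "'k::field tpoly mat" where
  "UT = mat ((m - 2) * w) ((w - 1) * w) (\<lambda>(r, j).
     if j div w < m - 2 \<and> r = j div w * w + (m - 1) then beta (j mod w) else 0)"

definition VT :: "'k::field tpoly mat" where
  "VT = mat ((p - 2) * w) ((w - 1) * w) (\<lambda>(r, j).
     if m - 1 \<le> j div w \<and> r = (j div w - (m - 1)) * w + (m - 2) then - tau (j mod w) else 0)"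

lemma UT_index:
  "r < (m - 2) * w \<Longrightarrow> k < w - 1 \<Longrightarrow> c < w \<Longrightarrow>
    UT $$ (r, k * w + c) = (if k < m - 2 \<and> r = k * w + (m - 1) then beta c else 0)"
  using block_less[of k "w - 1" c w] by (auto simp: UT_def)

lemma VT_index:
  "r < (p - 2) * w \<Longrightarrow> k < w - 1 \<Longrightarrow> c < w \<Longrightarrow>
    VT $$ (r, k * w + c) = (if m - 1 \<le> k \<and> r = (k - (m - 1)) * w + (m - 2) then - tau c else 0)"
  using block_less[of k "w - 1" c w] by (auto simp: VT_def)

lemma UT_carrier: "UT \<in> carrier_mat ((m - 1 - 1) * w) ((w - 1) * w)"
  and VT_carrier: "VT \<in> carrier_mat ((p - 1 - 1) * w) ((w - 1) * w)"
  by (simp_all add: UT_def VT_def numeral_2_eq_2)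

lemma beta_special: "beta (m - 1) = abt 0 1 0" "beta (m - 2) = abt 1 0 (m - 2)"
  "tau (m - 1) = abt 0 1 1" "tau (m - 2) = abt 1 0 (m - 1)"
  using m2 by (auto simp: beta_def tau_def abt_mult Suc_diff_Suc numeral_2_eq_2)

lemma PhiT_UT: "PhiT (m - 1) * UT = N1T (m - 1) w * (PhiT w :: 'k::field tpoly mat)"
proof (rule eq_matI)
  fix i j assume "i < dim_row (N1T (m - 1) w * (PhiT w :: 'k tpoly mat))" "j < dim_col (N1T (m - 1) w * (PhiT w :: 'k tpoly mat))"
  then have i: "i < m - 1" and j: "j < (w - 1) * w" by simp_all
  define k c where kc: "k = j div w" "c = j mod w"
  have k: "k < w - 1" and c: "c < w" and jkc: "j = k * w + c" using mod_div_block[OF j] kc by auto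
  show "(PhiT (m - 1) * UT) $$ (i, j) = (N1T (m - 1) w * (PhiT w :: 'k tpoly mat)) $$ (i, j)"
  proof (cases "k < m - 1 - 1")
    case True
    have l: "k * w + (m - 1) < (m - 1 - 1) * w"
      using True w_eq p2 by (intro block_less) auto
    have "(PhiT (m - 1) * UT) $$ (i, j) = PhiT (m - 1) $$ (i, k * w + (m - 1)) * (beta c :: 'k tpoly)"
      using True unfolding jkc
      by (intro PhiT_mult_single[OF UT_carrier i _ _ l] block_less k c)
        (subst UT_index, use k c in \<open>auto simp: numeral_2_eq_2\<close>)
    moreover have "PhiT (m - 1) $$ (i, k * w + (m - 1)) =
       (if i = k then tau (m - 1) else if i = Suc k then - beta (m - 1) else (0 :: 'k tpoly))"
      using i True w_eq p2 by (intro PhiT_index) auto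
    ultimately show ?thesis
      unfolding jkc N1T_PhiT[OF i k c] using i True c
      by (auto simp: PhiT_index beta_special[unfolded One_nat_def] tau_def[of c] abt_mult simp flip: mult.assoc)
  next
    case False
    then have "(PhiT (m - 1) * UT) $$ (i, j) = (0 :: 'k tpoly)"
      unfolding jkc
      by (intro PhiT_mult_zero[OF UT_carrier i] block_less k c)
        (subst UT_index, use k c in \<open>auto simp: numeral_2_eq_2\<close>)
    with False show ?thesis unfolding jkc N1T_PhiT[OF i k c] by simp
  qed
qed (simp_all add: UT_def)

lemma PhiT_VT: "PhiT (p - 1) * VT = N2T (p - 1) w * (PhiT w :: 'k::field tpoly mat)"
proof (rule eq_matI)
  fix i j assume "i < dim_row (N2T (p - 1) w * (PhiT w :: 'k tpoly mat))" "j < dim_col (N2T (p - 1) w * (PhiT w :: 'k tpoly mat))"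
  then have i: "i < p - 1" and j: "j < (w - 1) * w" by simp_all
  define k c where kc: "k = j div w" "c = j mod w"
  have k: "k < w - 1" and c: "c < w" and jkc: "j = k * w + c" using mod_div_block[OF j] kc by auto
  have q: "w \<le> p - 1 + m - 1" using w_eq m2 p2 by simp
  show "(PhiT (p - 1) * VT) $$ (i, j) = (N2T (p - 1) w * (PhiT w :: 'k tpoly mat)) $$ (i, j)"
  proof (cases "m - 1 \<le> k")
    case True
    then have k': "k - (m - 1) < p - 1 - 1" using k w_eq m2 p2 by auto
    have l: "(k - (m - 1)) * w + (m - 2) < (p - 1 - 1) * w"
      using k' w_eq m2 p2 by (intro block_less) auto
    have "(PhiT (p - 1) * VT) $$ (i, j) = PhiT (p - 1) $$ (i, (k - (m - 1)) * w + (m - 2)) * - (tau c :: 'k tpoly)"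
      using True unfolding jkc
      by (intro PhiT_mult_single[OF VT_carrier i _ _ l] block_less k c)
        (subst VT_index, use k c in \<open>auto simp: numeral_2_eq_2\<close>)
    moreover have "PhiT (p - 1) $$ (i, (k - (m - 1)) * w + (m - 2)) =
       (if i = k - (m - 1) then tau (m - 2) else if i = Suc (k - (m - 1)) then - beta (m - 2) else (0 :: 'k tpoly))"
      using i k' w_eq m2 p2 by (intro PhiT_index) auto
    moreover have "PhiT (p - 1) $$ (i, (k - (m - 1)) * w + c) =
       (if i = k - (m - 1) then tau c else if i = Suc (k - (m - 1)) then - beta c else (0 :: 'k tpoly))"
      using i k' c by (intro PhiT_index) auto
    moreover have "Suc (m - 2) = m - 1" using m2 by simp
    ultimately show ?thesis
      unfolding jkc N2T_PhiT[OF i k c q] using True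
      by (auto simp: beta_special tau_def[of c] abt_mult simp flip: mult.assoc)
  next
    case False
    then have "(PhiT (p - 1) * VT) $$ (i, j) = (0 :: 'k tpoly)"
      unfolding jkc
      by (intro PhiT_mult_zero[OF VT_carrier i] block_less k c)
        (subst VT_index, use k c in \<open>auto simp: numeral_2_eq_2\<close>)
    with False show ?thesis unfolding jkc N2T_PhiT[OF i k c q] by simp
  qed
qed (simp_all add: VT_def)

text \<open>
  The nonzero rows of U and V consist of the first and of minus the second row of the scroll matrix, and
  the blocks of an element of the kernel of Phi are relations on both rows.
\<close>

lemma UT_kernel:
  assumes y: "y \<in> carrier_vec ((w - 1) * w)" and 0: "PhiT w *\<^sub>v y = 0\<^sub>v w"
  shows "UT *\<^sub>v y = (0\<^sub>v ((m - 2) * w) :: 'k::field tpoly vec)" "VT *\<^sub>v y = (0\<^sub>v ((p - 2) * w) :: 'k::field tpoly vec)"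
proof -
  have b: "(\<Sum>c<w. beta c * y $ (k * w + c)) = 0" if "k < w - 1" for k
    using PhiT_zero_iff[OF y] 0 that by blast
  have t: "(\<Sum>c<w. tau c * y $ (k * w + c)) = 0" if "k < w - 1" for k
    using b[OF that] by (simp add: tau_def mult.assoc flip: sum_distrib_left)
  have car: "UT \<in> carrier_mat ((m - 2) * w) ((w - 1) * w)" "VT \<in> carrier_mat ((p - 2) * w) ((w - 1) * w)"
    by (simp_all add: UT_def VT_def)
  have "(UT *\<^sub>v y) $ r = 0" if r: "r < (m - 2) * w" for r
  proof -
    have "(UT *\<^sub>v y) $ r = (\<Sum>k<w - 1. \<Sum>c<w. UT $$ (r, k * w + c) * y $ (k * w + c))"
      by (simp only: mult_mat_vec_index[OF car(1) y r] sum_blocks)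
    also have "\<dots> = (\<Sum>k<w - 1. if k < m - 2 \<and> r = k * w + (m - 1) then (\<Sum>c<w. beta c * y $ (k * w + c)) else 0)"
      using r by (intro sum.cong) (auto simp: UT_index intro!: sum.neutral)
    also have "\<dots> = 0" using b by (intro sum.neutral) auto
    finally show ?thesis .
  qed
  then show "UT *\<^sub>v y = 0\<^sub>v ((m - 2) * w)"
    by (intro eq_vecI) (simp_all add: UT_def del: index_mult_mat_vec)
  have "(VT *\<^sub>v y) $ r = 0" if r: "r < (p - 2) * w" for r
  proof -
    have "(VT *\<^sub>v y) $ r = (\<Sum>k<w - 1. \<Sum>c<w. VT $$ (r, k * w + c) * y $ (k * w + c))"
      by (simp only: mult_mat_vec_index[OF car(2) y r] sum_blocks)
    also have "\<dots> = (\<Sum>k<w - 1. if m - 1 \<le> k \<and> r = (k - (m - 1)) * w + (m - 2) then - (\<Sum>c<w. tau c * y $ (k * w + c)) else 0)"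
      using r by (intro sum.cong) (auto simp: VT_index sum_negf intro!: sum.neutral)
    also have "\<dots> = 0" using t by (intro sum.neutral) auto
    finally show ?thesis .
  qed
  then show "VT *\<^sub>v y = 0\<^sub>v ((p - 2) * w)"
    by (intro eq_vecI) (simp_all add: VT_def del: index_mult_mat_vec)
qed

section \<open>The matrices over S and their images\<close>

text \<open>
  The possible entries of the matrices of the resolution, and the matrices with such entries. The image of
  such a matrix under the parametrization is denoted by pmat.
\<close>

definition lin :: "'k::field mpol set" where
  "lin = {0} \<union> var ` {1..m + p} \<union> (\<lambda>i. - var i) ` {1..m + p}"

definition linmat :: "nat \<Rightarrow> nat \<Rightarrow> 'k::field mpol mat set" where
  "linmat r c = {M \<in> carrier_mat r c. \<forall>i<r. \<forall>j<c. M $$ (i, j) \<in> lin}"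

abbreviation pmat :: "'k::field mpol mat \<Rightarrow> 'k tpoly mat" where
  "pmat M \<equiv> map_mat parametrization M"

lemma lin_0 [simp]: "0 \<in> lin" by (simp add: lin_def)
lemma lin_var: "i \<in> {1..m + p} \<Longrightarrow> var i \<in> lin" by (simp add: lin_def)
lemma lin_uminus: "f \<in> lin \<Longrightarrow> - f \<in> (lin :: 'k::field mpol set)" by (auto simp: lin_def)

lemma linmat_carrier: "M \<in> linmat r c \<Longrightarrow> M \<in> carrier_mat r c" by (simp add: linmat_def)

lemma linmat_zero: "0\<^sub>m r c \<in> linmat r c" by (simp add: linmat_def)

lemma linmat_uminus: "M \<in> linmat r c \<Longrightarrow> - M \<in> (linmat r c :: 'k::field mpol mat set)"
  by (auto simp: linmat_def intro!: lin_uminus)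

lemma linmat_four_block:
  "A \<in> linmat r c \<Longrightarrow> B \<in> linmat r c' \<Longrightarrow> C \<in> linmat r' c \<Longrightarrow> D \<in> linmat r' c' \<Longrightarrow>
    four_block_mat A B C D \<in> linmat (r + r') (c + c')"
  by (auto simp: linmat_def)

lemma linmat_append_cols:
  "A \<in> linmat r c \<Longrightarrow> B \<in> linmat r c' \<Longrightarrow> A @\<^sub>c B \<in> linmat r (c + c')"
  using linmat_four_block[of A r c B c' "0\<^sub>m 0 c" 0 "0\<^sub>m 0 c'"] linmat_carrier[of A r c] linmat_carrier[of B r c']
  by (auto simp: append_cols_def linmat_zero)

lemma linmat_append_rows:
  "A \<in> linmat r c \<Longrightarrow> B \<in> linmat r' c \<Longrightarrow> A @\<^sub>r B \<in> linmat (r + r') c"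
  using linmat_four_block[of A r c "0\<^sub>m r 0" 0 B r' "0\<^sub>m r' 0"] linmat_carrier[of A r c] linmat_carrier[of B r' c]
  by (auto simp: append_rows_def linmat_zero)

lemma linmat_copies: "A \<in> linmat r c \<Longrightarrow> copies d A \<in> linmat (d * r) (d * c)"
proof (induction d)
  case 0 then show ?case by (simp add: copies_0 linmat_zero)
next
  case (Suc d)
  then show ?case using copies_Suc[OF linmat_carrier[OF Suc.prems]]
    by (auto intro!: linmat_four_block linmat_zero)
qed

lemma diag_block_mat_three:
  assumes "A \<in> carrier_mat r c" "B \<in> carrier_mat r' c'" "C \<in> carrier_mat r'' c''"
  shows "diag_block_mat [A, B, C] = four_block_mat A (0\<^sub>m r (c' + c'')) (0\<^sub>m (r' + r'') c)
    (four_block_mat B (0\<^sub>m r' c'') (0\<^sub>m r'' c') C)"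
proof -
  have "diag_block_mat [B, C] = four_block_mat B (0\<^sub>m r' c'') (0\<^sub>m r'' c') C"
    using assms by (intro diag_block_mat_two)
  moreover have "four_block_mat B (0\<^sub>m r' c'') (0\<^sub>m r'' c') C \<in> carrier_mat (r' + r'') (c' + c'')"
    using assms by auto
  ultimately show ?thesis
    using assms(1) diag_block_mat.simps(2)[of A "[B, C]"] by (simp only: Let_def carrier_matD)
qed

lemma pmat_carrier: "M \<in> carrier_mat r c \<Longrightarrow> pmat M \<in> carrier_mat r c" by simp

lemma parametrization_lin: "f \<in> lin \<Longrightarrow> parametrization f \<in> L 0"
  using m2 p2
  by (auto simp: lin_def parametrization_uminus parametrization_var a_degree_def b_degree_def t_degree_def
      simp flip: abt_def intro!: L_uminus abt_in_L)

lemma pmat_Amat: "M \<in> linmat r c \<Longrightarrow> pmat M \<in> Amat r c"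
  using parametrization_lin by (fastforce simp: linmat_def Amat_def)

lemma pmat_zero: "pmat (0\<^sub>m r c) = 0\<^sub>m r c"
  by (intro eq_matI) auto

lemma pmat_uminus: "pmat (- M) = - pmat M"
  by (intro eq_matI) (auto simp: parametrization_uminus)

lemma pmat_four_block:
  "A \<in> carrier_mat r c \<Longrightarrow> B \<in> carrier_mat r c' \<Longrightarrow> C \<in> carrier_mat r' c \<Longrightarrow> D \<in> carrier_mat r' c' \<Longrightarrow>
    pmat (four_block_mat A B C D) = four_block_mat (pmat A) (pmat B) (pmat C) (pmat D)"
  by (intro eq_matI) auto

lemma pmat_append_cols:
  "A \<in> carrier_mat r c \<Longrightarrow> B \<in> carrier_mat r c' \<Longrightarrow> pmat (A @\<^sub>c B) = pmat A @\<^sub>c pmat B"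
  unfolding append_cols_def by (subst pmat_four_block[where r'=0]) (auto simp: pmat_zero)

lemma pmat_append_rows:
  "A \<in> carrier_mat r c \<Longrightarrow> B \<in> carrier_mat r' c \<Longrightarrow> pmat (A @\<^sub>r B) = pmat A @\<^sub>r pmat B"
  unfolding append_rows_def by (subst pmat_four_block[where c'=0]) (auto simp: pmat_zero)

lemma pmat_copies: "A \<in> carrier_mat r c \<Longrightarrow> pmat (copies d A) = copies d (pmat A)"
proof (induction d)
  case 0 then show ?case by (simp add: copies_0 pmat_zero)
next
  case (Suc d)
  show ?case
    unfolding copies_Suc[OF Suc.prems] copies_Suc[OF pmat_carrier[OF Suc.prems]] Suc.IH[OF Suc.prems, symmetric]
    using Suc.prems by (subst pmat_four_block[OF _ _ _ copies_carrier]) (auto simp: pmat_zero)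
qed

lemma parametrization_var_abt:
  "parametrization (var i) = (if i \<le> m then abt 1 0 (i - 1) else abt 0 1 (i - m - 1))"
  by (simp add: parametrization_var abt_def a_degree_def b_degree_def t_degree_def)

lemma phi0_linmat: "phi0 m p \<in> linmat 2 w"
  using m2 p2 by (auto simp: phi0_def mat1_def w_def linmat_def intro!: lin_var lin_uminus)

lemma phi0_entry:
  assumes "c < w"
  shows "parametrization (phi0 m p $$ (0, c)) = tau c" "parametrization (phi0 m p $$ (1, c)) = - beta c"
  using assms m2 p2
  by (auto simp: phi0_def mat1_def w_def parametrization_var_abt tau_eq beta_def parametrization_uminus
      Suc_diff_le not_less not_le intro!: arg_cong[of _ _ "abt 0 1"])

lemma Phi_linmat: "Phi m p d \<in> (linmat d ((d - 1) * w) :: 'k::field mpol mat set)"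
proof -
  have e: "phi0 m p $$ (i, c mod w) \<in> (lin :: 'k mpol set)" if "i < 2" for i c
    using phi0_linmat w_pos that mod_less_divisor[of w c] by (auto simp: linmat_def simp del: mod_less_divisor)
  from e[of 0] e[of 1] show ?thesis by (auto simp: Phi_def linmat_def Let_def simp flip: w_def)
qed

lemma pmat_Phi: "pmat (Phi m p d) = PhiT d"
  using w_pos by (intro eq_matI) (auto simp: Phi_def PhiT_def Let_def phi0_entry[unfolded One_nat_def] simp flip: w_def)

lemma N1_linmat: "N1 m p \<in> linmat (m - 1) w"
  using m2 p2 by (auto simp: N1_def mat1_def w_def linmat_def intro!: lin_var)

lemma N2_linmat: "N2 m p \<in> linmat (p - 1) w"
  using m2 p2 by (auto simp: N2_def mat1_def w_def linmat_def intro!: lin_var lin_uminus)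

lemma pmat_N1: "pmat (N1 m p) = N1T (m - 1) w"
  using m2 p2
  by (intro eq_matI)
    (auto simp: N1_def mat1_def N1T_def w_def parametrization_var_abt min_def intro!: arg_cong[of _ _ "abt 0 1"])

lemma pmat_N2: "pmat (N2 m p) = N2T (p - 1) w"
  using m2 p2
  by (intro eq_matI)
    (auto simp: N2_def mat1_def N2T_def w_def parametrization_var_abt parametrization_uminus
      intro!: arg_cong[of _ _ "abt (Suc 0) 0"])

lemma u_block_linmat: "u_block m p i \<in> linmat ((m - 2) * w) w"
  using m2 p2 by (auto simp: u_block_def mat1_def w_def linmat_def intro!: lin_var)

lemma v_block_linmat: "v_block m p i \<in> linmat ((p - 2) * w) w"
  using m2 p2 by (auto simp: v_block_def mat1_def w_def linmat_def intro!: lin_var lin_uminus)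

lemma linmat_foldr:
  "(\<And>x. f x \<in> linmat r v) \<Longrightarrow> Z \<in> linmat r c \<Longrightarrow>
    foldr (@\<^sub>c) (map f xs) Z \<in> linmat r (length xs * v + c)"
  by (induction xs) (auto simp: add.assoc intro!: linmat_append_cols)

lemma w1_eq: "w - 1 = (m - 2) + (p - 1)" "w - 1 = (m - 1) + (p - 2)" "w - 1 = m + p - 3"
  using m2 p2 by (auto simp: w_def)

lemma U_linmat: "U_mat m p \<in> linmat ((m - 2) * w) ((w - 1) * w)"
  using linmat_foldr[OF u_block_linmat linmat_zero[of "(m - 2) * w" "(p - 1) * w"], where xs = "[0..<m - 2]"]
  unfolding w1_eq(1) by (simp add: U_mat_def Let_def add_mult_distrib flip: w_def)

lemma V_linmat: "V_mat m p \<in> linmat ((p - 2) * w) ((w - 1) * w)"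
  using linmat_append_cols[OF linmat_zero[of "(p - 2) * w" "(m - 1) * w"]
    linmat_foldr[OF v_block_linmat linmat_zero[of "(p - 2) * w" 0], where xs = "[0..<p - 2]"]]
  unfolding w1_eq(2) by (simp add: V_mat_def Let_def add_mult_distrib flip: w_def)

lemma pmat_U: "pmat (U_mat m p) = (UT :: 'k::field tpoly mat)"
proof (rule eq_matI)
  show "dim_row (pmat (U_mat m p)) = dim_row (UT :: 'k tpoly mat)" "dim_col (pmat (U_mat m p)) = dim_col (UT :: 'k tpoly mat)"
    using linmat_carrier[OF U_linmat] by (auto simp: UT_def)
  fix r j assume "r < dim_row (UT :: 'k tpoly mat)" "j < dim_col (UT :: 'k tpoly mat)"
  then have r: "r < (m - 2) * w" and j: "j < (w - 1) * w" by (simp_all add: UT_def)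
  define k c where kc: "k = j div w" "c = j mod w"
  have k: "k < w - 1" and c: "c < w" and jkc: "j = k * w + c" using mod_div_block[OF j] kc by auto
  have j': "j < (m - 2) * w + (p - 1) * w" using j unfolding w1_eq(1) add_mult_distrib .
  have "(U_mat m p :: 'k mpol mat) $$ (r, j) = (if j < (m - 2) * w then u_block m p ([0..<m - 2] ! (j div w)) $$ (r, j mod w)
      else 0\<^sub>m ((m - 2) * w) ((p - 1) * w) $$ (r, j - (m - 2) * w))"
    using foldr_append_cols(2)[of "[0..<m - 2]" "u_block m p" "(m - 2) * w" w
        "0\<^sub>m ((m - 2) * w) ((p - 1) * w)" "(p - 1) * w" r j] r j'
    by (cases "j < (m - 2) * w") (simp_all add: U_mat_def Let_def linmat_carrier[OF u_block_linmat] flip: w_def)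
  moreover have "j < (m - 2) * w \<longleftrightarrow> k < m - 2"
    using w_pos unfolding kc by (simp add: div_less_iff_less_mult)
  ultimately have U: "(U_mat m p :: 'k mpol mat) $$ (r, j) = (if k < m - 2 then u_block m p k $$ (r, c) else 0)"
    using r j' by (auto simp: kc)
  have "parametrization ((u_block m p k :: 'k mpol mat) $$ (r, c)) = (if r = k * w + (m - 1) then beta c else 0)"
    using r c m2 p2
    by (auto simp: u_block_def mat1_def w_def parametrization_var_abt beta_def intro!: arg_cong[of _ _ "abt 0 1"])
  moreover have "(UT :: 'k tpoly mat) $$ (r, j) = (if k < m - 2 \<and> r = k * w + (m - 1) then beta c else 0)"
    unfolding jkc by (rule UT_index[OF r k c])
  ultimately show "pmat (U_mat m p) $$ (r, j) = (UT :: 'k tpoly mat) $$ (r, j)"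
    using r j by (auto simp add: U carrier_matD[OF linmat_carrier[OF U_linmat]])
qed

lemma v_block_index:
  assumes "r < (p - 2) * w" "c < w"
  shows "v_block m p i $$ (r, c) = (if r = i * w + (m - 2) then (if c < m - 1 then - var (c + 2) else - var (c + 3)) else 0)"
proof -
  have "r + 1 = X + m - 1 \<longleftrightarrow> r = X + (m - 2)" for X using m2 by auto
  moreover have "c + 1 \<le> m - 1 \<longleftrightarrow> c < m - 1" by auto
  ultimately show ?thesis using assms by (simp add: v_block_def mat1_def w_def numeral_eq_Suc)
qed

lemma pmat_V: "pmat (V_mat m p) = (VT :: 'k::field tpoly mat)"
proof (rule eq_matI)
  show "dim_row (pmat (V_mat m p)) = dim_row (VT :: 'k tpoly mat)" "dim_col (pmat (V_mat m p)) = dim_col (VT :: 'k tpoly mat)"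
    using linmat_carrier[OF V_linmat] by (auto simp: VT_def)
  fix r j assume "r < dim_row (VT :: 'k tpoly mat)" "j < dim_col (VT :: 'k tpoly mat)"
  then have r: "r < (p - 2) * w" and j: "j < (w - 1) * w" by (simp_all add: VT_def)
  define k c where kc: "k = j div w" "c = j mod w"
  have k: "k < w - 1" and c: "c < w" and jkc: "j = k * w + c" using mod_div_block[OF j] kc by auto
  let ?F = "foldr (@\<^sub>c) (map (v_block m p) [0..<p - 2]) (0\<^sub>m ((p - 2) * w) 0) :: 'k mpol mat"
  have F: "?F \<in> carrier_mat ((p - 2) * w) ((p - 2) * w)"
    using linmat_carrier[OF linmat_foldr[OF v_block_linmat linmat_zero[of "(p - 2) * w" 0], where xs = "[0..<p - 2]"]] by simp
  have j': "j < (m - 1) * w + (p - 2) * w" using j unfolding w1_eq(2) add_mult_distrib .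
  have "(V_mat m p :: 'k mpol mat) $$ (r, j) = (if j < (m - 1) * w then 0 else ?F $$ (r, j - (m - 1) * w))"
    using append_cols_index[OF zero_carrier_mat F r, of j "(m - 1) * w"] r j'
    by (cases "j < (m - 1) * w") (simp_all add: V_mat_def Let_def flip: w_def)
  moreover have "j < (m - 1) * w \<longleftrightarrow> \<not> m - 1 \<le> k"
    using w_pos unfolding kc by (simp add: div_less_iff_less_mult not_le)
  moreover have "?F $$ (r, j - (m - 1) * w) = v_block m p (k - (m - 1)) $$ (r, c)" if mk: "m - 1 \<le> k"
  proof -
    have jj: "j - (m - 1) * w = (k - (m - 1)) * w + c" unfolding jkc using mk
      by (metis add_mult_distrib add.assoc add_diff_cancel_left' le_add_diff_inverse)
    have kk: "k - (m - 1) < p - 2" using k w1_eq(2) mk by simp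
    have "?F $$ (r, (k - (m - 1)) * w + c) = v_block m p ([0..<p - 2] ! (k - (m - 1))) $$ (r, c)"
      using foldr_append_cols(2)[of "[0..<p - 2]" "v_block m p" "(p - 2) * w" w
        "0\<^sub>m ((p - 2) * w) 0" 0 r "(k - (m - 1)) * w + c"] r block_less[OF kk c] c
      by (simp add: linmat_carrier[OF v_block_linmat])
    then show ?thesis using kk jj by simp
  qed
  ultimately have V: "(V_mat m p :: 'k mpol mat) $$ (r, j) = (if m - 1 \<le> k then v_block m p (k - (m - 1)) $$ (r, c) else 0)"
    by auto
  have "parametrization ((v_block m p (k - (m - 1)) :: 'k mpol mat) $$ (r, c)) =
      (if r = (k - (m - 1)) * w + (m - 2) then - tau c else 0)"
    using r c m2 Suc_diff_le[of m "Suc c"] unfolding v_block_index[OF r c]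
    by (auto simp: parametrization_var_abt tau_eq parametrization_uminus intro!: arg_cong[of _ _ "abt 0 1"])
  moreover have "(VT :: 'k tpoly mat) $$ (r, j) =
      (if m - 1 \<le> k \<and> r = (k - (m - 1)) * w + (m - 2) then - tau c else 0)"
    unfolding jkc by (rule VT_index[OF r k c])
  ultimately show "pmat (V_mat m p) $$ (r, j) = (VT :: 'k tpoly mat) $$ (r, j)"
    using r j by (auto simp add: V carrier_matD[OF linmat_carrier[OF V_linmat]])
qed

section \<open>Exactness of the sequence of the matrices phi\<close>

lemma pred_pred [simp]: "m - 1 - 1 = m - 2" "p - 1 - 1 = p - 2"
  by simp_all

lemma block_sum: "(m - 1) * l + (p - 1) * l = w * l" "(m - 2) * l + (l + (p - 2) * l) = (w - 1) * l"
proof -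
  show "(m - 1) * l + (p - 1) * l = w * l" unfolding w_eq add_mult_distrib ..
  have "w - 1 = (m - 2) + (1 + (p - 2))" using m2 p2 by (simp add: w_def)
  then show "(m - 2) * l + (l + (p - 2) * l) = (w - 1) * l" by (simp only: add_mult_distrib mult_1)
qed

text \<open>
  The row (a, a t, ..., a t^(d-1), b, b t, ..., b t^(e-1)). For (d, e) = (m-1, p-1) it is the first row
  of the scroll matrix, and for (m, p) it is the image of the row of all variables.
\<close>

definition rowT :: "nat \<Rightarrow> nat \<Rightarrow> 'k::field tpoly mat" where
  "rowT d e = mat 1 (d + e) (\<lambda>(i, j). if j < d then abt 1 0 j else abt 0 1 (j - d))"

lemma rowT_carrier: "rowT d e \<in> carrier_mat 1 (d + e)"
  by (simp add: rowT_def)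

lemma rowT_kernel:
  assumes "y \<in> carrier_vec d" "z \<in> carrier_vec e"
  shows "rowT d e *\<^sub>v (y @\<^sub>v z) = 0\<^sub>v 1 \<longleftrightarrow>
    abt 1 0 0 * power_form d y + abt 0 1 0 * power_form e z = (0 :: 'k::field tpoly)"
proof -
  have yz: "y @\<^sub>v z \<in> carrier_vec (d + e)" using assms by simp
  have "(rowT d e *\<^sub>v (y @\<^sub>v z)) $ 0 = (\<Sum>j<d + e. rowT d e $$ (0, j) * (y @\<^sub>v z) $ j)"
    by (rule mult_mat_vec_index[OF rowT_carrier yz]) simp
  also have "\<dots> = (\<Sum>j<d. abt 1 0 j * y $ j) + (\<Sum>j<e. abt 0 1 j * z $ j)"
    unfolding sum_lessThan_add using assms by (intro arg_cong2[of _ _ _ _ "(+)"] sum.cong) (auto simp: rowT_def)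
  also have "\<dots> = abt 1 0 0 * power_form d y + abt 0 1 0 * power_form e z"
    by (simp add: power_form_def sum_distrib_left abt_mult flip: mult.assoc)
  finally have "(rowT d e *\<^sub>v (y @\<^sub>v z)) $ 0 = abt 1 0 0 * power_form d y + abt 0 1 0 * power_form e z" .
  moreover have "rowT d e *\<^sub>v (y @\<^sub>v z) = 0\<^sub>v 1 \<longleftrightarrow> (rowT d e *\<^sub>v (y @\<^sub>v z)) $ 0 = 0"
    by (auto simp: rowT_def intro!: eq_vecI simp del: index_mult_mat_vec)
  ultimately show ?thesis by simp
qed

lemma beta_row_eq: "beta_row = rowT (m - 1) (p - 1)"
  by (intro eq_matI) (auto simp: beta_row_def rowT_def beta_def w_eq)

lemma Phi_linmat': "Phi m p (m - 1) \<in> linmat (m - 1) ((m - 2) * w)" "Phi m p (p - 1) \<in> linmat (p - 1) ((p - 2) * w)"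
  using Phi_linmat[of "m - 1"] Phi_linmat[of "p - 1"] by (simp_all only: pred_pred)

lemma phi1_linmat: "phi1 m p \<in> linmat w ((w - 1) * w)"
proof -
  have "phi1 m p \<in> linmat ((m - 1) + (p - 1)) ((m - 2) * w + (w + (p - 2) * w))"
    unfolding phi1_def Let_def w_def[symmetric]
    by (intro linmat_append_rows linmat_append_cols linmat_zero Phi_linmat' N1_linmat N2_linmat)
  then show ?thesis unfolding block_sum(2) w_eq[symmetric] .
qed

lemma pmat_phi1:
  "pmat (phi1 m p) = (PhiT (m - 1) @\<^sub>c N1T (m - 1) w @\<^sub>c 0\<^sub>m (m - 1) ((p - 2) * w)) @\<^sub>r
     (0\<^sub>m (p - 1) ((m - 2) * w) @\<^sub>c N2T (p - 1) w @\<^sub>c PhiT (p - 1))"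
proof -
  note c = Phi_linmat'[THEN linmat_carrier] N1_linmat[THEN linmat_carrier] N2_linmat[THEN linmat_carrier]
  show ?thesis
    unfolding phi1_def Let_def w_def[symmetric]
    by (simp only: pmat_append_rows[OF append_cols_carrier[OF c(1) append_cols_carrier[OF c(3) zero_carrier_mat]]
        append_cols_carrier[OF zero_carrier_mat append_cols_carrier[OF c(4) c(2)]]]
      pmat_append_cols[OF c(1) append_cols_carrier[OF c(3) zero_carrier_mat]]
      pmat_append_cols[OF c(3) zero_carrier_mat] pmat_append_cols[OF c(4) c(2)]
      pmat_append_cols[OF zero_carrier_mat append_cols_carrier[OF c(4) c(2)]] pmat_zero pmat_Phi pmat_N1 pmat_N2)
qed

lemma PhiT_carrier': "PhiT (m - 1) \<in> carrier_mat (m - 1) ((m - 2) * w)" "PhiT (p - 1) \<in> carrier_mat (p - 1) ((p - 2) * w)"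
  using PhiT_carrier[of "m - 1"] PhiT_carrier[of "p - 1"] by (simp_all only: pred_pred)

lemma phi1_mult:
  assumes "x \<in> carrier_vec ((m - 2) * w)" "u \<in> carrier_vec w" "z \<in> carrier_vec ((p - 2) * w)"
  shows "pmat (phi1 m p) *\<^sub>v (x @\<^sub>v u @\<^sub>v z) =
    (PhiT (m - 1) *\<^sub>v x + N1T (m - 1) w *\<^sub>v u) @\<^sub>v (N2T (p - 1) w *\<^sub>v u + PhiT (p - 1) *\<^sub>v z)"
  unfolding pmat_phi1
  by (rule two_block_mult[OF PhiT_carrier'(1) N1T_carrier N2T_carrier PhiT_carrier'(2) assms])

text \<open>
  The conditions of \<open>glue_kernel\<close> and \<open>glue_syzygies\<close> in the case of phi1 and phi2.
\<close>

lemma small_glue: "m - 1 \<ge> 1" "p - 1 \<ge> 1" "(m - 1) + p = (p - 1) + m" "w = (m - 1) + p - 1"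
  using m2 p2 by (auto simp: w_def)

lemma exact_beta_row_phi1: "exact (beta_row :: 'k::field tpoly mat) (pmat (phi1 m p))"
  unfolding beta_row_eq
proof (rule exactI[OF rowT_carrier, where e = "(w - 1) * w"])
  show "pmat (phi1 m p) \<in> (Amat (m - 1 + (p - 1)) ((w - 1) * w) :: 'k tpoly mat set)"
    unfolding w_eq[symmetric] by (rule pmat_Amat[OF phi1_linmat])
  fix v :: "'k tpoly vec" assume "v \<in> Avec (m - 1 + (p - 1))"
  then obtain y z where v: "y \<in> Avec (m - 1)" "z \<in> Avec (p - 1)" "v = y @\<^sub>v z" by (rule Avec_split)
  note vc = v(1,2)[THEN Avec_carrier]
  have "rowT (m - 1) (p - 1) *\<^sub>v v = 0\<^sub>v 1 \<longleftrightarrow> (\<exists>x\<in>Avec ((m - 2) * w). \<exists>u\<in>Avec w. \<exists>x'\<in>Avec ((p - 2) * w).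
      y = PhiT (m - 1) *\<^sub>v x + N1T (m - 1) w *\<^sub>v u \<and> z = N2T (p - 1) w *\<^sub>v u + PhiT (p - 1) *\<^sub>v x')"
    unfolding v(3) rowT_kernel[OF vc] glue_kernel[OF small_glue v(1,2)] pred_pred ..
  also have "\<dots> \<longleftrightarrow> (\<exists>x\<in>Avec ((m - 2) * w). \<exists>u\<in>Avec w. \<exists>x'\<in>Avec ((p - 2) * w).
      v = pmat (phi1 m p) *\<^sub>v (x @\<^sub>v u @\<^sub>v x'))"
  proof (intro bex_cong refl)
    fix x u x' :: "'k tpoly vec"
    assume x: "x \<in> Avec ((m - 2) * w)" "u \<in> Avec w" "x' \<in> Avec ((p - 2) * w)"
    have "PhiT (m - 1) *\<^sub>v x + N1T (m - 1) w *\<^sub>v u \<in> carrier_vec (m - 1)"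
      using Avec_carrier[OF x(1)] Avec_carrier[OF x(2)] PhiT_carrier'(1) N1T_carrier by (intro add_carrier_vec mult_mat_vec_carrier)
    then show "(y = PhiT (m - 1) *\<^sub>v x + N1T (m - 1) w *\<^sub>v u \<and> z = N2T (p - 1) w *\<^sub>v u + PhiT (p - 1) *\<^sub>v x')
        \<longleftrightarrow> v = pmat (phi1 m p) *\<^sub>v (x @\<^sub>v u @\<^sub>v x')"
      unfolding v(3) phi1_mult[OF x[THEN Avec_carrier]] using vc by (subst append_vec_eq) auto
  qed
  also have "\<dots> \<longleftrightarrow> (\<exists>s\<in>Avec ((w - 1) * w). v = pmat (phi1 m p) *\<^sub>v s)"
    unfolding block_sum(2)[symmetric] Avec_split3 ..
  finally show "rowT (m - 1) (p - 1) *\<^sub>v v = 0\<^sub>v 1 \<longleftrightarrow> (\<exists>s\<in>Avec ((w - 1) * w). v = pmat (phi1 m p) *\<^sub>v s)" .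
qed

lemma exact_PhiT_copies: "exact (PhiT d :: 'k::field tpoly mat) (copies (d - 1) (pmat (phi1 m p)))"
  by (rule exact_PhiT[OF exact_beta_row_phi1 pmat_Amat[OF phi1_linmat]])

lemma copies_phi1_Amat: "copies d (pmat (phi1 m p)) \<in> Amat (d * w) (d * ((w - 1) * w))"
  by (intro Amat_copies pmat_Amat phi1_linmat)

lemma phi2_linmat: "phi2 m p \<in> linmat ((w - 1) * w) ((w - 1) * ((w - 1) * w))"
  and pmat_phi2: "pmat (phi2 m p) =
    (copies (m - 2) (pmat (phi1 m p)) @\<^sub>c UT @\<^sub>c 0\<^sub>m ((m - 2) * w) ((p - 2) * ((w - 1) * w))) @\<^sub>r
    (0\<^sub>m w ((m - 2) * ((w - 1) * w)) @\<^sub>c - PhiT w @\<^sub>c 0\<^sub>m w ((p - 2) * ((w - 1) * w))) @\<^sub>r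
    (0\<^sub>m ((p - 2) * w) ((m - 2) * ((w - 1) * w)) @\<^sub>c VT @\<^sub>c copies (p - 2) (pmat (phi1 m p)))"
proof -
  note cp = linmat_copies[OF phi1_linmat]
  note dims = carrier_matD[OF linmat_carrier[OF cp]] carrier_matD[OF linmat_carrier[OF linmat_uminus[OF Phi_linmat]]]
  have eq: "phi2 m p = (copies (m - 2) (phi1 m p) @\<^sub>c U_mat m p @\<^sub>c 0\<^sub>m ((m - 2) * w) ((p - 2) * ((w - 1) * w))) @\<^sub>r
    (0\<^sub>m w ((m - 2) * ((w - 1) * w)) @\<^sub>c - Phi m p w @\<^sub>c 0\<^sub>m w ((p - 2) * ((w - 1) * w))) @\<^sub>r
    (0\<^sub>m ((p - 2) * w) ((m - 2) * ((w - 1) * w)) @\<^sub>c V_mat m p @\<^sub>c copies (p - 2) (phi1 m p))"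
    unfolding phi2_def Let_def w_def[symmetric] dims ..
  have 1: "(copies (m - 2) (phi1 m p) @\<^sub>c U_mat m p @\<^sub>c 0\<^sub>m ((m - 2) * w) ((p - 2) * ((w - 1) * w)))
      \<in> linmat ((m - 2) * w) ((m - 2) * ((w - 1) * w) + ((w - 1) * w + (p - 2) * ((w - 1) * w)))"
    by (intro linmat_append_cols cp U_linmat linmat_zero)
  have 2: "(0\<^sub>m w ((m - 2) * ((w - 1) * w)) @\<^sub>c - Phi m p w @\<^sub>c 0\<^sub>m w ((p - 2) * ((w - 1) * w)))
      \<in> linmat w ((m - 2) * ((w - 1) * w) + ((w - 1) * w + (p - 2) * ((w - 1) * w)))"
    by (intro linmat_append_cols linmat_uminus Phi_linmat linmat_zero)
  have 3: "(0\<^sub>m ((p - 2) * w) ((m - 2) * ((w - 1) * w)) @\<^sub>c V_mat m p @\<^sub>c copies (p - 2) (phi1 m p))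
      \<in> linmat ((p - 2) * w) ((m - 2) * ((w - 1) * w) + ((w - 1) * w + (p - 2) * ((w - 1) * w)))"
    by (intro linmat_append_cols cp V_linmat linmat_zero)
  show "phi2 m p \<in> linmat ((w - 1) * w) ((w - 1) * ((w - 1) * w))"
    using linmat_append_rows[OF 1 linmat_append_rows[OF 2 3]] unfolding eq[symmetric] block_sum(2) .
  note c = linmat_carrier[OF cp] linmat_carrier[OF U_linmat] linmat_carrier[OF V_linmat]
    linmat_carrier[OF linmat_uminus[OF Phi_linmat[of w]]]
  show "pmat (phi2 m p) =
    (copies (m - 2) (pmat (phi1 m p)) @\<^sub>c UT @\<^sub>c 0\<^sub>m ((m - 2) * w) ((p - 2) * ((w - 1) * w))) @\<^sub>r
    (0\<^sub>m w ((m - 2) * ((w - 1) * w)) @\<^sub>c - PhiT w @\<^sub>c 0\<^sub>m w ((p - 2) * ((w - 1) * w))) @\<^sub>r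
    (0\<^sub>m ((p - 2) * w) ((m - 2) * ((w - 1) * w)) @\<^sub>c VT @\<^sub>c copies (p - 2) (pmat (phi1 m p)))"
    unfolding eq
    by (simp only: pmat_append_rows[OF 1[THEN linmat_carrier] linmat_append_rows[OF 2 3, THEN linmat_carrier]]
      pmat_append_rows[OF 2[THEN linmat_carrier] 3[THEN linmat_carrier]]
      pmat_append_cols[OF c(1) append_cols_carrier[OF c(2) zero_carrier_mat]] pmat_append_cols[OF c(2) zero_carrier_mat]
      pmat_append_cols[OF zero_carrier_mat append_cols_carrier[OF c(4) zero_carrier_mat]] pmat_append_cols[OF c(4) zero_carrier_mat]
      pmat_append_cols[OF zero_carrier_mat append_cols_carrier[OF c(3) c(1)]] pmat_append_cols[OF c(3) c(1)]
      pmat_zero pmat_copies[OF linmat_carrier[OF phi1_linmat]] pmat_U pmat_V pmat_uminus pmat_Phi)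
qed

lemma UT_carrier': "UT \<in> carrier_mat ((m - 2) * w) ((w - 1) * w)" "VT \<in> carrier_mat ((p - 2) * w) ((w - 1) * w)"
  by (simp_all add: UT_def VT_def)

lemma phi2_mult:
  assumes "x \<in> carrier_vec ((m - 2) * ((w - 1) * w))" "y \<in> carrier_vec ((w - 1) * w)" "z \<in> carrier_vec ((p - 2) * ((w - 1) * w))"
  shows "pmat (phi2 m p) *\<^sub>v (x @\<^sub>v y @\<^sub>v z) =
    (copies (m - 2) (pmat (phi1 m p)) *\<^sub>v x + UT *\<^sub>v y) @\<^sub>v ((- PhiT w) *\<^sub>v y) @\<^sub>v
    (VT *\<^sub>v y + copies (p - 2) (pmat (phi1 m p)) *\<^sub>v z)"
proof -
  have "- PhiT w \<in> carrier_mat w ((w - 1) * w)" using PhiT_carrier[of w] by simp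
  then show ?thesis
    unfolding pmat_phi2
    by (intro three_block_mult[OF copies_phi1_Amat[THEN Amat_carrier] UT_carrier'(1) _ UT_carrier'(2)
        copies_phi1_Amat[THEN Amat_carrier] assms])
qed

lemma UT_Amat: "UT \<in> (Amat ((m - 2) * w) ((w - 1) * w) :: 'k::field tpoly mat set)"
  using pmat_Amat[OF U_linmat] unfolding pmat_U .

lemma VT_Amat: "VT \<in> (Amat ((p - 2) * w) ((w - 1) * w) :: 'k::field tpoly mat set)"
  using pmat_Amat[OF V_linmat] unfolding pmat_V .

lemma exact_phi1_phi2: "exact (pmat (phi1 m p) :: 'k::field tpoly mat) (pmat (phi2 m p))"
proof (rule exactI[OF pmat_carrier[OF linmat_carrier[OF phi1_linmat]] pmat_Amat[OF phi2_linmat]])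
  fix v :: "'k tpoly vec" assume "v \<in> Avec ((w - 1) * w)"
  then obtain x u z where v: "x \<in> Avec ((m - 2) * w)" "u \<in> Avec w" "z \<in> Avec ((p - 2) * w)" "v = x @\<^sub>v u @\<^sub>v z"
    unfolding block_sum(2)[symmetric] using Avec_split by metis
  note vc = v(1-3)[THEN Avec_carrier]
  let ?P = "pmat (phi1 m p) :: 'k tpoly mat"
  have "?P *\<^sub>v v = 0\<^sub>v w \<longleftrightarrow> ?P *\<^sub>v v = 0\<^sub>v ((m - 1) + (p - 1))" using w_eq by simp
  also have "\<dots> \<longleftrightarrow>
      PhiT (m - 1) *\<^sub>v x + N1T (m - 1) w *\<^sub>v u = 0\<^sub>v (m - 1) \<and> N2T (p - 1) w *\<^sub>v u + PhiT (p - 1) *\<^sub>v z = 0\<^sub>v (p - 1)"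
    unfolding v(4) phi1_mult[OF vc] using vc PhiT_carrier' N1T_carrier N2T_carrier
    by (intro append_vec_eq_zero) (auto intro!: add_carrier_vec mult_mat_vec_carrier)
  also have "\<dots> \<longleftrightarrow> (\<exists>x'\<in>Avec ((m - 2) * ((w - 1) * w)). \<exists>y\<in>Avec ((w - 1) * w). \<exists>z'\<in>Avec ((p - 2) * ((w - 1) * w)).
       x = copies (m - 2) ?P *\<^sub>v x' + UT *\<^sub>v y \<and> u = (- PhiT w) *\<^sub>v y \<and> z = VT *\<^sub>v y + copies (p - 2) ?P *\<^sub>v z')"
    using glue_syzygies[OF small_glue, of "copies (m - 2) ?P" "(m - 2) * ((w - 1) * w)"
        "copies (p - 2) ?P" "(p - 2) * ((w - 1) * w)" UT VT x u z,
      unfolded pred_pred, OF copies_phi1_Amat _ copies_phi1_Amat _ UT_Amat PhiT_UT VT_Amat PhiT_VT v(1-3)]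
      exact_PhiT_copies[of "m - 1", unfolded pred_pred] exact_PhiT_copies[of "p - 1", unfolded pred_pred] by blast
  also have "\<dots> \<longleftrightarrow> (\<exists>x'\<in>Avec ((m - 2) * ((w - 1) * w)). \<exists>y\<in>Avec ((w - 1) * w). \<exists>z'\<in>Avec ((p - 2) * ((w - 1) * w)).
       v = pmat (phi2 m p) *\<^sub>v (x' @\<^sub>v y @\<^sub>v z'))"
  proof (intro bex_cong refl)
    fix x' y z' :: "'k tpoly vec"
    assume xyz: "x' \<in> Avec ((m - 2) * ((w - 1) * w))" "y \<in> Avec ((w - 1) * w)" "z' \<in> Avec ((p - 2) * ((w - 1) * w))"
    note c = xyz[THEN Avec_carrier]
    have "copies (m - 2) ?P *\<^sub>v x' + UT *\<^sub>v y \<in> carrier_vec ((m - 2) * w)"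
      using c UT_carrier'(1) copies_phi1_Amat[THEN Amat_carrier] by (intro add_carrier_vec mult_mat_vec_carrier)
    moreover have "(- PhiT w) *\<^sub>v y \<in> carrier_vec w" using c PhiT_carrier[of w] by (intro mult_mat_vec_carrier) auto
    ultimately show "(x = copies (m - 2) ?P *\<^sub>v x' + UT *\<^sub>v y \<and> u = (- PhiT w) *\<^sub>v y \<and> z = VT *\<^sub>v y + copies (p - 2) ?P *\<^sub>v z')
        \<longleftrightarrow> v = pmat (phi2 m p) *\<^sub>v (x' @\<^sub>v y @\<^sub>v z')"
      unfolding v(4) phi2_mult[OF c] using append_vec_eq3[OF vc(1) _ vc(2)] by simp
  qed
  also have "\<dots> \<longleftrightarrow> (\<exists>s\<in>Avec ((w - 1) * ((w - 1) * w)). v = pmat (phi2 m p) *\<^sub>v s)"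
    unfolding block_sum(2)[symmetric, of "(w - 1) * w"] Avec_split3 ..
  finally show "?P *\<^sub>v v = 0\<^sub>v w \<longleftrightarrow> (\<exists>s\<in>Avec ((w - 1) * ((w - 1) * w)). v = pmat (phi2 m p) *\<^sub>v s)" .
qed

lemma exact_diag_three:
  assumes "A \<in> carrier_mat a1 a2" "A' \<in> Amat a2 a3" "exact A A'"
    "B \<in> carrier_mat b1 b2" "B' \<in> Amat b2 b3" "exact B B'"
    "C \<in> carrier_mat c1 c2" "C' \<in> Amat c2 c3" "exact C C'"
  shows "exact (diag_block_mat [A, B, C]) (diag_block_mat [A', B', C' :: 'k::field tpoly mat])"
  unfolding diag_block_mat_three[OF assms(1,4,7)]
    diag_block_mat_three[OF assms(2,5,8)[THEN Amat_carrier]]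
  using assms by (intro exact_block Amat_four_block Amat_zero) auto

lemma linmat_diag_three:
  assumes "A \<in> linmat a1 a2" "B \<in> linmat b1 b2" "C \<in> linmat c1 c2"
  shows "diag_block_mat [A, B, C] \<in> linmat (a1 + (b1 + c1)) (a2 + (b2 + c2))"
  unfolding diag_block_mat_three[OF assms[THEN linmat_carrier]]
  using assms by (intro linmat_four_block linmat_zero)

lemma pmat_diag_three:
  assumes "A \<in> carrier_mat a1 a2" "B \<in> carrier_mat b1 b2" "C \<in> carrier_mat c1 c2"
  shows "pmat (diag_block_mat [A, B, C]) = diag_block_mat [pmat A, pmat B, pmat C]"
proof -
  have "four_block_mat B (0\<^sub>m b1 c2) (0\<^sub>m c1 b2) C \<in> carrier_mat (b1 + c1) (b2 + c2)" using assms by auto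
  then show ?thesis
    unfolding diag_block_mat_three[OF assms] diag_block_mat_three[OF assms[THEN pmat_carrier]]
    by (simp only: pmat_four_block[OF assms(1) zero_carrier_mat zero_carrier_mat]
      pmat_four_block[OF assms(2) zero_carrier_mat zero_carrier_mat assms(3)] pmat_zero)
qed

lemma phi_step: "phi m p (Suc (Suc (Suc i))) = diag_block_mat
   [copies (m - 2) (phi m p (Suc (Suc i))), copies (w - 1) (phi m p (Suc i)), copies (p - 2) (phi m p (Suc (Suc i)))]"
  by (simp add: w1_eq(3)[unfolded One_nat_def])

lemma phi_linmat: "phi m p (Suc i) \<in> (linmat ((w - 1) ^ i * w) ((w - 1) ^ Suc i * w) :: 'k::field mpol mat set)"
proof (induction i rule: less_induct)
  case (less i)
  consider "i = 0" | "i = 1" | j where "i = Suc (Suc j)" by (metis One_nat_def not0_implies_Suc)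
  then show ?case
  proof cases
    case 1 then show ?thesis using phi1_linmat by simp
  next
    case 2 then show ?thesis using phi2_linmat by (simp add: mult.assoc)
  next
    case 3
    let ?a = "(w - 1) ^ Suc j * w" and ?b = "(w - 1) ^ Suc (Suc j) * w"
    have "phi m p (Suc (Suc (Suc j))) \<in> (linmat ((m - 2) * ?a + ((w - 1) * ((w - 1) ^ j * w) + (p - 2) * ?a))
        ((m - 2) * ?b + ((w - 1) * ?a + (p - 2) * ?b)) :: 'k mpol mat set)"
      unfolding phi_step using less[of j] less[of "Suc j"] 3 by (intro linmat_diag_three linmat_copies) auto
    moreover have eqs: "(w - 1) * ((w - 1) ^ j * w) = ?a" "(w - 1) * ?a = ?b"
      "(w - 1) * ?b = (w - 1) ^ Suc (Suc (Suc j)) * w" by (simp_all add: mult.assoc)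
    ultimately show ?thesis by (simp only: 3 eqs block_sum(2))
  qed
qed

lemma phi_carrier: "pmat (phi m p (Suc i)) \<in> carrier_mat ((w - 1) ^ i * w) ((w - 1) ^ Suc i * w)"
  by (rule pmat_carrier[OF linmat_carrier[OF phi_linmat]])

lemma phi_Amat: "pmat (phi m p (Suc i)) \<in> Amat ((w - 1) ^ i * w) ((w - 1) ^ Suc i * w)"
  by (rule pmat_Amat[OF phi_linmat])

lemma pmat_phi_step: "pmat (phi m p (Suc (Suc (Suc i)))) = diag_block_mat
   [copies (m - 2) (pmat (phi m p (Suc (Suc i)))), copies (w - 1) (pmat (phi m p (Suc i))),
    copies (p - 2) (pmat (phi m p (Suc (Suc i))))]"
  unfolding phi_step
  by (simp only: pmat_diag_three[OF copies_carrier copies_carrier copies_carrier, OF phi_linmat[THEN linmat_carrier]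
    phi_linmat[THEN linmat_carrier] phi_linmat[THEN linmat_carrier]] pmat_copies[OF phi_linmat[THEN linmat_carrier]])

text \<open>
  The matrix phi2 has the same kernel as its block diagonal part, and the exactness is inherited from the
  blocks.
\<close>

lemma exact_phi2_phi3: "exact (pmat (phi m p 2) :: 'k::field tpoly mat) (pmat (phi m p 3))"
proof -
  let ?P1 = "pmat (phi1 m p) :: 'k tpoly mat" and ?P2 = "pmat (phi2 m p) :: 'k tpoly mat"
  let ?D = "diag_block_mat [copies (m - 2) ?P1, PhiT w, copies (p - 2) ?P1]"
  let ?E = "diag_block_mat [copies (m - 2) ?P2, copies (w - 1) ?P1, copies (p - 2) ?P2]"
  have P2: "?P2 \<in> Amat ((w - 1) * w) ((w - 1) * ((w - 1) * w))" by (rule pmat_Amat[OF phi2_linmat])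
  note P1 = pmat_carrier[OF linmat_carrier[OF phi1_linmat]]
  have 3: "pmat (phi m p 3) = ?E" using pmat_phi_step[of 0] by (simp add: numeral_3_eq_3)
  have 2: "phi m p 2 = phi2 m p" by (simp add: numeral_2_eq_2)
  have DE: "exact ?D ?E"
    by (rule exact_diag_three[OF copies_carrier[OF P1] Amat_copies[OF P2] exact_copies[OF P1 P2 exact_phi1_phi2]
        PhiT_carrier copies_phi1_Amat exact_PhiT_copies
        copies_carrier[OF P1] Amat_copies[OF P2] exact_copies[OF P1 P2 exact_phi1_phi2]])
  have D: "?D \<in> carrier_mat ((m - 2) * w + (w + (p - 2) * w)) ((m - 2) * ((w - 1) * w) + ((w - 1) * w + (p - 2) * ((w - 1) * w)))"
    unfolding diag_block_mat_three[OF copies_carrier[OF P1] PhiT_carrier copies_carrier[OF P1]]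
    by (intro four_block_carrier_mat copies_carrier[OF P1] PhiT_carrier)
  have E: "?E \<in> Amat ((m - 2) * ((w - 1) * w) + ((w - 1) * w + (p - 2) * ((w - 1) * w)))
     ((m - 2) * ((w - 1) * ((w - 1) * w)) + ((w - 1) * ((w - 1) * w) + (p - 2) * ((w - 1) * ((w - 1) * w))))"
    unfolding diag_block_mat_three[OF copies_carrier[OF Amat_carrier[OF P2]] copies_carrier[OF P1] copies_carrier[OF Amat_carrier[OF P2]]]
    by (intro Amat_four_block Amat_zero Amat_copies P2 copies_phi1_Amat)
  have car2: "?P2 \<in> carrier_mat ((w - 1) * w) ((m - 2) * ((w - 1) * w) + ((w - 1) * w + (p - 2) * ((w - 1) * w)))"
    unfolding block_sum(2) by (rule Amat_carrier[OF P2])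
  show ?thesis
    unfolding 2 3
  proof (rule exact_transfer[OF DE D E car2])
    fix v :: "'k tpoly vec" assume "v \<in> Avec ((m - 2) * ((w - 1) * w) + ((w - 1) * w + (p - 2) * ((w - 1) * w)))"
    then obtain x y z where v: "x \<in> Avec ((m - 2) * ((w - 1) * w))" "y \<in> Avec ((w - 1) * w)"
      "z \<in> Avec ((p - 2) * ((w - 1) * w))" "v = x @\<^sub>v y @\<^sub>v z"
      using Avec_split by metis
    note vc = v(1-3)[THEN Avec_carrier]
    note X = mult_mat_vec_carrier[OF copies_carrier[OF P1, of "m - 2"] vc(1)]
      mult_mat_vec_carrier[OF PhiT_carrier vc(2)] mult_mat_vec_carrier[OF copies_carrier[OF P1, of "p - 2"] vc(3)]
      mult_mat_vec_carrier[OF UT_carrier'(1) vc(2)] mult_mat_vec_carrier[OF UT_carrier'(2) vc(2)]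
    have Dv: "?D *\<^sub>v v = 0\<^sub>v ((m - 2) * w + (w + (p - 2) * w)) \<longleftrightarrow>
      copies (m - 2) ?P1 *\<^sub>v x = 0\<^sub>v ((m - 2) * w) \<and> PhiT w *\<^sub>v y = 0\<^sub>v w \<and> copies (p - 2) ?P1 *\<^sub>v z = 0\<^sub>v ((p - 2) * w)"
    proof -
      have "?D *\<^sub>v v = copies (m - 2) ?P1 *\<^sub>v x @\<^sub>v PhiT w *\<^sub>v y @\<^sub>v copies (p - 2) ?P1 *\<^sub>v z"
        unfolding v(4) diag_block_mat_three[OF copies_carrier[OF P1] PhiT_carrier copies_carrier[OF P1]]
        by (simp only: block_diag_mult_vec[OF copies_carrier[OF P1] four_block_carrier_mat[OF PhiT_carrier copies_carrier[OF P1]]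
            vc(1) append_carrier_vec[OF vc(2,3)]] block_diag_mult_vec[OF PhiT_carrier copies_carrier[OF P1] vc(2,3)])
      then show ?thesis using X by (simp add: append_vec_eq_zero)
    qed
    have "?P2 *\<^sub>v v = 0\<^sub>v ((w - 1) * w) \<longleftrightarrow> ?P2 *\<^sub>v v = 0\<^sub>v ((m - 2) * w + (w + (p - 2) * w))"
      unfolding block_sum(2) ..
    also have "\<dots> \<longleftrightarrow> copies (m - 2) ?P1 *\<^sub>v x + UT *\<^sub>v y = 0\<^sub>v ((m - 2) * w) \<and> (- PhiT w) *\<^sub>v y = 0\<^sub>v w \<and>
        VT *\<^sub>v y + copies (p - 2) ?P1 *\<^sub>v z = 0\<^sub>v ((p - 2) * w)"
      unfolding v(4) phi2_mult[OF vc] uminus_mult_mat_vec'[OF PhiT_carrier vc(2)] using X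
      by (subst append_vec_eq_zero, simp, simp, subst append_vec_eq_zero) auto
    also have "\<dots> \<longleftrightarrow> copies (m - 2) ?P1 *\<^sub>v x = 0\<^sub>v ((m - 2) * w) \<and> PhiT w *\<^sub>v y = 0\<^sub>v w \<and>
        copies (p - 2) ?P1 *\<^sub>v z = 0\<^sub>v ((p - 2) * w)"
    proof -
      have "(- PhiT w) *\<^sub>v y = 0\<^sub>v w \<longleftrightarrow> PhiT w *\<^sub>v y = 0\<^sub>v w"
        unfolding uminus_mult_mat_vec'[OF PhiT_carrier vc(2)] by (rule uminus_zero_vec_eq[OF X(2)])
      moreover have "PhiT w *\<^sub>v y = 0\<^sub>v w \<Longrightarrow> copies (m - 2) ?P1 *\<^sub>v x + UT *\<^sub>v y = copies (m - 2) ?P1 *\<^sub>v x \<and>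
          VT *\<^sub>v y + copies (p - 2) ?P1 *\<^sub>v z = copies (p - 2) ?P1 *\<^sub>v z"
        using UT_kernel[OF vc(2)] X(1,3) by (simp add: add_zero_right_vec add_zero_left_vec)
      ultimately show ?thesis by metis
    qed
    finally show "?P2 *\<^sub>v v = 0\<^sub>v ((w - 1) * w) \<longleftrightarrow> ?D *\<^sub>v v = 0\<^sub>v ((m - 2) * w + (w + (p - 2) * w))"
      unfolding Dv .
  qed
qed

lemma exact_phi: "exact (pmat (phi m p (Suc i)) :: 'k::field tpoly mat) (pmat (phi m p (Suc (Suc i))))"
proof (induction i rule: less_induct)
  case (less i)
  consider "i = 0" | "i = 1" | j where "i = Suc (Suc j)" by (metis One_nat_def not0_implies_Suc)
  then show ?case
  proof cases
    case 1 then show ?thesis using exact_phi1_phi2 by simp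
  next
    case 2 then show ?thesis using exact_phi2_phi3 by (simp only: numeral_2_eq_2 numeral_3_eq_3 One_nat_def)
  next
    case 3
    note step = copies_carrier[OF phi_carrier] Amat_copies[OF phi_Amat] exact_copies[OF phi_carrier phi_Amat]
    have "exact (pmat (phi m p (Suc (Suc j))) :: 'k tpoly mat) (pmat (phi m p (Suc (Suc (Suc j)))))"
      "exact (pmat (phi m p (Suc j)) :: 'k tpoly mat) (pmat (phi m p (Suc (Suc j))))"
      by (intro less, simp add: 3)+
    note ex = this[THEN exact_copies[OF phi_carrier phi_Amat]]
    note diag = exact_diag_three[OF step(1,2) ex(1) step(1,2) ex(2) step(1,2) ex(1), of "m - 2" "w - 1" "p - 2"]
    show ?thesis
      using diag unfolding 3 pmat_phi_step[of j, symmetric] pmat_phi_step[of "Suc j", symmetric] .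
  qed
qed

section \<open>Exactness of the sequence of the differentials\<close>

text \<open>
  The image of the diagonal matrix alpha i for i \<ge> 1, where l is the number of rows of phi i; note that
  the variables m + 1 and m become b and a t^(m-1).
\<close>

definition alT :: "nat \<Rightarrow> 'k::field tpoly mat" where
  "alT l = mat (w * l) (w * l) (\<lambda>(r, j).
     if r = j then (if r < (m - 1) * l then abt 0 1 0 else - abt 1 0 (m - 1)) else 0)"

lemma alT_carrier: "alT l \<in> carrier_mat (w * l) (w * l)"
  by (simp add: alT_def)

lemma diag_two_scalars:
  assumes "r < a + b" "j < a + b"
  shows "four_block_mat (x \<cdot>\<^sub>m 1\<^sub>m a) (0\<^sub>m a b) (0\<^sub>m b a) (y \<cdot>\<^sub>m 1\<^sub>m b) $$ (r, j) =
    (if r = j then if r < a then x else y else (0 :: 'a::comm_ring_1))"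
  using assms by auto

lemma alpha_linmat: "alpha m p (Suc i) \<in> (linmat (w * (w * (w - 1) ^ i)) (w * (w * (w - 1) ^ i)) :: 'k::field mpol mat set)"
  and pmat_alpha: "pmat (alpha m p (Suc i)) = (alT (w * (w - 1) ^ i) :: 'k::field tpoly mat)"
proof -
  let ?l = "w * (w - 1) ^ i"
  have car: "var (m + 1) \<cdot>\<^sub>m 1\<^sub>m ((m - 1) * ?l) \<in> (carrier_mat ((m - 1) * ?l) ((m - 1) * ?l) :: 'k mpol mat set)"
    "- var m \<cdot>\<^sub>m 1\<^sub>m ((p - 1) * ?l) \<in> (carrier_mat ((p - 1) * ?l) ((p - 1) * ?l) :: 'k mpol mat set)" by auto
  have eq: "alpha m p (Suc i) = four_block_mat (var (m + 1) \<cdot>\<^sub>m 1\<^sub>m ((m - 1) * ?l))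
      (0\<^sub>m ((m - 1) * ?l) ((p - 1) * ?l)) (0\<^sub>m ((p - 1) * ?l) ((m - 1) * ?l)) (- var m \<cdot>\<^sub>m 1\<^sub>m ((p - 1) * ?l) :: 'k mpol mat)"
    unfolding diag_block_mat_two[OF car, symmetric] by (simp add: alpha_def w_def Let_def)
  have 1: "var (m + 1) \<cdot>\<^sub>m 1\<^sub>m ((m - 1) * ?l) \<in> (linmat ((m - 1) * ?l) ((m - 1) * ?l) :: 'k mpol mat set)"
    using p2 by (auto simp: linmat_def lin_var)
  have 2: "- var m \<cdot>\<^sub>m 1\<^sub>m ((p - 1) * ?l) \<in> (linmat ((p - 1) * ?l) ((p - 1) * ?l) :: 'k mpol mat set)"
    using m2 by (auto simp: linmat_def lin_var lin_uminus)
  show "alpha m p (Suc i) \<in> (linmat (w * ?l) (w * ?l) :: 'k mpol mat set)"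
    unfolding eq block_sum(1)[symmetric, of ?l] by (intro linmat_four_block 1 2 linmat_zero)
  show "pmat (alpha m p (Suc i)) = (alT ?l :: 'k tpoly mat)"
  proof (rule eq_matI)
    fix r j assume "r < dim_row (alT ?l :: 'k tpoly mat)" "j < dim_col (alT ?l :: 'k tpoly mat)"
    then have rj: "r < w * ?l" "j < w * ?l" by (simp_all add: alT_def)
    then have rj': "r < (m - 1) * ?l + (p - 1) * ?l" "j < (m - 1) * ?l + (p - 1) * ?l"
      unfolding block_sum(1) by simp_all
    have "pmat (alpha m p (Suc i)) $$ (r, j) = parametrization ((alpha m p (Suc i) :: 'k mpol mat) $$ (r, j))"
      using rj' unfolding eq by (intro index_map_mat) simp_all
    then show "pmat (alpha m p (Suc i)) $$ (r, j) = (alT ?l :: 'k tpoly mat) $$ (r, j)"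
      unfolding eq diag_two_scalars[OF rj'] using rj
      by (simp add: alT_def parametrization_var_abt parametrization_uminus)
  qed (use block_sum(1)[of ?l] in \<open>simp_all add: eq alT_def\<close>)
qed

lemma alT_Amat: "alT l \<in> Amat (w * l) (w * l)"
  using m2 by (auto simp: Amat_def alT_def intro!: abt_in_L L_uminus)

lemma copies_w_blocks:
  assumes "X \<in> carrier_mat r c"
  shows "copies w X = four_block_mat (copies (m - 1) X) (0\<^sub>m ((m - 1) * r) ((p - 1) * c))
    (0\<^sub>m ((p - 1) * r) ((m - 1) * c)) (copies (p - 1) X)"
  unfolding w_eq copies_add[OF assms, symmetric]
  by (rule diag_block_mat_two[OF copies_carrier[OF assms] copies_carrier[OF assms]])

lemma alT_commute:
  assumes X: "X \<in> carrier_mat r c"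
  shows "copies w X * alT c = alT r * (copies w X :: 'k::field tpoly mat)"
proof (rule eq_matI)
  note c = copies_carrier[OF X, of w]
  show "dim_row (copies w X * alT c) = dim_row (alT r * copies w X)"
    "dim_col (copies w X * alT c) = dim_col (alT r * copies w X)"
    using c by (simp_all add: alT_def)
  fix i j assume "i < dim_row (alT r * copies w X)" "j < dim_col (alT r * copies w X)"
  then have i: "i < w * r" and j: "j < w * c" using c by (simp_all add: alT_def)
  let ?s = "\<lambda>b. if b then abt 0 1 0 else - abt 1 0 (m - 1) :: 'k tpoly"
  have "(copies w X * alT c) $$ (i, j) = (\<Sum>l<w * c. copies w X $$ (i, l) * alT c $$ (l, j))"
    by (rule mult_mat_index[OF c alT_carrier i j])
  also have "\<dots> = (\<Sum>l<w * c. if l = j then copies w X $$ (i, j) * ?s (j < (m - 1) * c) else 0)"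
    using j by (intro sum.cong) (auto simp: alT_def)
  also have "\<dots> = copies w X $$ (i, j) * ?s (j < (m - 1) * c)" using j by simp
  finally have 1: "(copies w X * alT c) $$ (i, j) = copies w X $$ (i, j) * ?s (j < (m - 1) * c)" .
  have "(alT r * copies w X) $$ (i, j) = (\<Sum>l<w * r. alT r $$ (i, l) * copies w X $$ (l, j))"
    by (rule mult_mat_index[OF alT_carrier c i j])
  also have "\<dots> = (\<Sum>l<w * r. if l = i then ?s (i < (m - 1) * r) * copies w X $$ (i, j) else 0)"
    using i by (intro sum.cong) (auto simp: alT_def)
  also have "\<dots> = ?s (i < (m - 1) * r) * copies w X $$ (i, j)" using i by simp
  finally have 2: "(alT r * copies w X) $$ (i, j) = ?s (i < (m - 1) * r) * copies w X $$ (i, j)" .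
  have i': "i < (m - 1) * r + (p - 1) * r" and j': "j < (m - 1) * c + (p - 1) * c"
    using i j unfolding block_sum(1) by simp_all
  \<comment> \<open>The scalars of the row and of the column differ only off the two diagonal blocks.\<close>
  have "copies w X $$ (i, j) = 0" if "(i < (m - 1) * r) \<noteq> (j < (m - 1) * c)"
    unfolding copies_w_blocks[OF X]
    using that i' j' carrier_matD[OF copies_carrier[OF X]] by (subst index_mat_four_block) auto
  then show "(copies w X * alT c) $$ (i, j) = (alT r * copies w X) $$ (i, j)"
    unfolding 1 2 by (cases "(i < (m - 1) * r) = (j < (m - 1) * c)") (auto simp: mult.commute)
qed

lemma differential_lift_1: "differential_lift m p 1 \<in> linmat 1 (m + p)"
  "pmat (differential_lift m p 1) = rowT m p"
proof -
  show "differential_lift m p 1 \<in> linmat 1 (m + p)"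
    by (auto simp: differential_lift_def mat1_def linmat_def intro!: lin_var)
  show "pmat (differential_lift m p 1) = rowT m p"
    by (intro eq_matI) (auto simp: differential_lift_def mat1_def rowT_def parametrization_var_abt)
qed

lemma alpha0_linmat: "alpha m p 0 \<in> linmat (m + p) (m + p - 1)"
  by (simp add: alpha_def alpha0_def mat1_def linmat_def; intro allI impI conjI lin_uminus lin_var; use m2 p2 in simp)

lemma pmat_alpha0: "pmat (alpha m p 0) = N1T m (w + 1) @\<^sub>r N2T p (w + 1)"
proof (rule eq_matI)
  have w1: "w + 1 = m + p - 1" using m2 p2 by (simp add: w_def)
  show "dim_row (pmat (alpha m p 0)) = dim_row (N1T m (w + 1) @\<^sub>r N2T p (w + 1))"
    "dim_col (pmat (alpha m p 0)) = dim_col (N1T m (w + 1) @\<^sub>r N2T p (w + 1))"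
    using linmat_carrier[OF alpha0_linmat] w1 by (auto simp: append_rows_def)
  fix i j assume "i < dim_row (N1T m (w + 1) @\<^sub>r N2T p (w + 1) :: 'a tpoly mat)" "j < dim_col (N1T m (w + 1) @\<^sub>r N2T p (w + 1) :: 'a tpoly mat)"
  then have i: "i < m + p" and j: "j < w + 1" by (simp_all add: append_rows_def)
  show "pmat (alpha m p 0) $$ (i, j) = (N1T m (w + 1) @\<^sub>r N2T p (w + 1) :: 'a tpoly mat) $$ (i, j)"
    unfolding append_rows_index[OF N1T_carrier N2T_carrier i j]
    using i j m2 p2 w1
    by (auto simp: alpha_def alpha0_def mat1_def N1T_def N2T_def parametrization_var_abt
        parametrization_uminus min_def intro!: arg_cong[of _ _ "abt 0 1"] arg_cong[of _ _ "abt 1 0"])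
qed

lemma differential_lift_2:
  "differential_lift m p 2 = four_block_mat (Phi m p m) (0\<^sub>m m ((p - 1) * w)) (0\<^sub>m p ((m - 1) * w)) (Phi m p p) @\<^sub>c alpha m p 0"
  by (simp add: differential_lift_def partial_block_def
      diag_block_mat_two[OF linmat_carrier[OF Phi_linmat] linmat_carrier[OF Phi_linmat]] del: diag_block_mat.simps)

lemma differential_lift_2_linmat:
  "differential_lift m p 2 \<in> linmat (m + p) ((m - 1) * w + (p - 1) * w + (w + 1))"
proof -
  have w1: "w + 1 = m + p - 1" using m2 p2 by (simp add: w_def)
  show ?thesis unfolding differential_lift_2 w1
    by (intro linmat_append_cols linmat_four_block Phi_linmat linmat_zero alpha0_linmat)
qed

lemma pmat_differential_lift_2: "pmat (differential_lift m p 2) =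
  four_block_mat (PhiT m) (0\<^sub>m m ((p - 1) * w)) (0\<^sub>m p ((m - 1) * w)) (PhiT p) @\<^sub>c (N1T m (w + 1) @\<^sub>r N2T p (w + 1))"
proof -
  note c = linmat_carrier[OF Phi_linmat]
  show ?thesis
    unfolding differential_lift_2
    by (simp only: pmat_append_cols[OF four_block_carrier_mat[OF c c] linmat_carrier[OF alpha0_linmat]]
      pmat_four_block[OF c zero_carrier_mat zero_carrier_mat c] pmat_zero pmat_Phi pmat_alpha0)
qed

lemma differential_2_mult:
  assumes "x \<in> carrier_vec ((m - 1) * w)" "z \<in> carrier_vec ((p - 1) * w)" "u \<in> carrier_vec (w + 1)"
  shows "pmat (differential_lift m p 2) *\<^sub>v ((x @\<^sub>v z) @\<^sub>v u) =
    (PhiT m *\<^sub>v x + N1T m (w + 1) *\<^sub>v u) @\<^sub>v (N2T p (w + 1) *\<^sub>v u + PhiT p *\<^sub>v (z :: 'k::field tpoly vec))"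
proof -
  note P = PhiT_carrier[of m] PhiT_carrier[of p]
  have xz: "x @\<^sub>v z \<in> carrier_vec ((m - 1) * w + (p - 1) * w)" using assms by simp
  note X = mult_mat_vec_carrier[OF P(1) assms(1)] mult_mat_vec_carrier[OF P(2) assms(2)]
    mult_mat_vec_carrier[OF N1T_carrier[of m] assms(3)] mult_mat_vec_carrier[OF N2T_carrier[of p] assms(3)]
  have "pmat (differential_lift m p 2) *\<^sub>v ((x @\<^sub>v z) @\<^sub>v u) =
      (PhiT m *\<^sub>v x @\<^sub>v PhiT p *\<^sub>v z) + (N1T m (w + 1) *\<^sub>v u @\<^sub>v N2T p (w + 1) *\<^sub>v u)"
    unfolding pmat_differential_lift_2
    by (simp only: append_cols_mult_vec[OF four_block_carrier_mat[OF P] carrier_append_rows[OF N1T_carrier N2T_carrier] xz assms(3)]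
      block_diag_mult_vec[OF P assms(1,2)] mat_mult_append[OF N1T_carrier N2T_carrier assms(3)])
  also have "\<dots> = (PhiT m *\<^sub>v x + N1T m (w + 1) *\<^sub>v u) @\<^sub>v (PhiT p *\<^sub>v z + N2T p (w + 1) *\<^sub>v u)"
    by (rule append_vec_add[OF X(1,3,2,4)])
  also have "PhiT p *\<^sub>v z + N2T p (w + 1) *\<^sub>v u = N2T p (w + 1) *\<^sub>v u + PhiT p *\<^sub>v z"
    by (rule comm_add_vec[OF X(2,4)])
  finally show ?thesis .
qed

text \<open>
  The conditions of \<open>glue_kernel\<close> and \<open>glue_syzygies\<close> in the case of the first differentials.
\<close>

lemma large_glue: "m \<ge> 1" "p \<ge> 1" "m + p = p + m" "w + 1 = m + p - 1"
  using m2 p2 by (auto simp: w_def)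

lemma Avec_split3':
  "(\<exists>s\<in>Avec (a + b + c). P s) \<longleftrightarrow>
    (\<exists>x\<in>Avec a. \<exists>u\<in>Avec c. \<exists>z\<in>Avec b. P ((x @\<^sub>v z) @\<^sub>v (u :: 'k::field tpoly vec)))"
  by (metis Avec_append Avec_split)

lemma exact_differential_1_2:
  "exact (pmat (differential_lift m p 1) :: 'k::field tpoly mat) (pmat (differential_lift m p 2))"
  unfolding differential_lift_1(2)
proof (rule exactI[OF rowT_carrier pmat_Amat[OF differential_lift_2_linmat]])
  fix v :: "'k tpoly vec" assume "v \<in> Avec (m + p)"
  then obtain y z where v: "y \<in> Avec m" "z \<in> Avec p" "v = y @\<^sub>v z" by (rule Avec_split)
  note vc = v(1,2)[THEN Avec_carrier]
  have "rowT m p *\<^sub>v v = 0\<^sub>v 1 \<longleftrightarrow> (\<exists>x\<in>Avec ((m - 1) * w). \<exists>u\<in>Avec (w + 1). \<exists>x'\<in>Avec ((p - 1) * w).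
      y = PhiT m *\<^sub>v x + N1T m (w + 1) *\<^sub>v u \<and> z = N2T p (w + 1) *\<^sub>v u + PhiT p *\<^sub>v x')"
    unfolding v(3) rowT_kernel[OF vc] glue_kernel[OF large_glue v(1,2)] ..
  also have "\<dots> \<longleftrightarrow> (\<exists>x\<in>Avec ((m - 1) * w). \<exists>u\<in>Avec (w + 1). \<exists>x'\<in>Avec ((p - 1) * w).
      v = pmat (differential_lift m p 2) *\<^sub>v ((x @\<^sub>v x') @\<^sub>v u))"
  proof (intro bex_cong refl)
    fix x u x' :: "'k tpoly vec"
    assume x: "x \<in> Avec ((m - 1) * w)" "u \<in> Avec (w + 1)" "x' \<in> Avec ((p - 1) * w)"
    note xc = x[THEN Avec_carrier]
    have "PhiT m *\<^sub>v x + N1T m (w + 1) *\<^sub>v u \<in> carrier_vec m"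
      using xc PhiT_carrier[of m] N1T_carrier by (intro add_carrier_vec mult_mat_vec_carrier)
    then show "(y = PhiT m *\<^sub>v x + N1T m (w + 1) *\<^sub>v u \<and> z = N2T p (w + 1) *\<^sub>v u + PhiT p *\<^sub>v x')
        \<longleftrightarrow> v = pmat (differential_lift m p 2) *\<^sub>v ((x @\<^sub>v x') @\<^sub>v u)"
      unfolding v(3) differential_2_mult[OF xc(1,3,2)] using vc by (subst append_vec_eq) auto
  qed
  also have "\<dots> \<longleftrightarrow> (\<exists>s\<in>Avec ((m - 1) * w + (p - 1) * w + (w + 1)). v = pmat (differential_lift m p 2) *\<^sub>v s)"
    unfolding Avec_split3' ..
  finally show "rowT m p *\<^sub>v v = 0\<^sub>v 1 \<longleftrightarrow>
    (\<exists>s\<in>Avec ((m - 1) * w + (p - 1) * w + (w + 1)). v = pmat (differential_lift m p 2) *\<^sub>v s)" .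
qed

text \<open>
  The two parts of the image of alpha 1. They play the role of U and V in \<open>glue_syzygies\<close>.
\<close>

definition U3 :: "'k::field tpoly mat" where
  "U3 = mat ((m - 1) * w) (w * w) (\<lambda>(r, j). if r = j then abt 0 1 0 else 0)"

definition V3 :: "'k::field tpoly mat" where
  "V3 = mat ((p - 1) * w) (w * w) (\<lambda>(r, j). if j = (m - 1) * w + r then - abt 1 0 (m - 1) else 0)"

lemma U3_Amat: "U3 \<in> Amat ((m - 1) * w) (w * w)" and V3_Amat: "V3 \<in> Amat ((p - 1) * w) (w * w)"
  using m2 by (auto simp: Amat_def U3_def V3_def intro!: abt_in_L L_uminus)

lemma alT_w: "alT w = U3 @\<^sub>r V3"
proof (rule eq_matI)
  note c = Amat_carrier[OF U3_Amat] Amat_carrier[OF V3_Amat]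
  show "dim_row (alT w) = dim_row (U3 @\<^sub>r V3)" "dim_col (alT w) = dim_col (U3 @\<^sub>r V3)"
    using block_sum(1)[of w] by (simp_all add: alT_def U3_def V3_def append_rows_def)
  fix r j assume "r < dim_row (U3 @\<^sub>r V3 :: 'a tpoly mat)" "j < dim_col (U3 @\<^sub>r V3 :: 'a tpoly mat)"
  then have r: "r < (m - 1) * w + (p - 1) * w" and j: "j < w * w"
    by (simp_all add: U3_def V3_def append_rows_def)
  have r': "r < w * w" using r unfolding block_sum(1) .
  show "alT w $$ (r, j) = (U3 @\<^sub>r V3 :: 'a tpoly mat) $$ (r, j)"
    unfolding append_rows_index[OF c r j] using r r' j by (auto simp: alT_def U3_def V3_def)
qed

lemma PhiT_U3: "PhiT m * U3 = N1T m (w + 1) * (PhiT (w + 1) :: 'k::field tpoly mat)"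
  and PhiT_V3: "PhiT p * V3 = N2T p (w + 1) * (PhiT (w + 1) :: 'k::field tpoly mat)"
proof -
  have index: "(PhiT m * U3) $$ (i, j) = (N1T m (w + 1) * (PhiT (w + 1) :: 'k tpoly mat)) $$ (i, j)"
    if i: "i < m" and j: "j < w * w" for i j
  proof -
    define k c where kc: "k = j div w" "c = j mod w"
    have k: "k < (w + 1) - 1" and c: "c < w" and jkc: "j = k * w + c" using mod_div_block[OF j] kc by auto
    show ?thesis
    proof (cases "k < m - 1")
      case True
      have l: "j < (m - 1) * w" unfolding jkc by (rule block_less[OF True c])
      have "(PhiT m * U3) $$ (i, j) = PhiT m $$ (i, j) * (abt 0 1 0 :: 'k tpoly)"
        by (rule PhiT_mult_single[OF Amat_carrier[OF U3_Amat] i j _ l]) (use j in \<open>auto simp: U3_def\<close>)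
      then show ?thesis unfolding jkc N1T_PhiT[OF i k c] using True by (simp add: mult.commute)
    next
      case False
      then have "(m - 1) * w \<le> k * w" by (intro mult_le_mono1) simp
      then have le: "\<not> j < (m - 1) * w" unfolding jkc by linarith
      have "(PhiT m * U3) $$ (i, j) = (0 :: 'k tpoly)"
        by (intro PhiT_mult_zero[OF Amat_carrier[OF U3_Amat] i j]) (use j le in \<open>auto simp: U3_def\<close>)
      then show ?thesis unfolding jkc N1T_PhiT[OF i k c] using False by simp
    qed
  qed
  show "PhiT m * U3 = N1T m (w + 1) * (PhiT (w + 1) :: 'k tpoly mat)"
    by (rule eq_matI) (simp_all add: index U3_def[THEN arg_cong, of dim_col] del: index_mult_mat(1))
  have index: "(PhiT p * V3) $$ (i, j) = (N2T p (w + 1) * (PhiT (w + 1) :: 'k tpoly mat)) $$ (i, j)"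
    if i: "i < p" and j: "j < w * w" for i j
  proof -
    define k c where kc: "k = j div w" "c = j mod w"
    have k: "k < (w + 1) - 1" and c: "c < w" and jkc: "j = k * w + c" using mod_div_block[OF j] kc by auto
    have q: "w + 1 \<le> p + m - 1" using m2 p2 by (simp add: w_def)
    show ?thesis
    proof (cases "m - 1 \<le> k")
      case True
      have k': "k - (m - 1) < p - 1" using k True w_eq by simp
      have l: "(k - (m - 1)) * w + c < (p - 1) * w" by (rule block_less[OF k' c])
      have "k * w = (m - 1) * w + (k - (m - 1)) * w" using True by (simp flip: add_mult_distrib)
      then have "j = (m - 1) * w + ((k - (m - 1)) * w + c)" unfolding jkc by simp
      then have "(PhiT p * V3) $$ (i, j) = PhiT p $$ (i, (k - (m - 1)) * w + c) * (- abt 1 0 (m - 1) :: 'k tpoly)"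
        by (intro PhiT_mult_single[OF Amat_carrier[OF V3_Amat] i j _ l]) (use j in \<open>auto simp: V3_def\<close>)
      then show ?thesis unfolding jkc N2T_PhiT[OF i k c q] using True by (simp add: mult.commute)
    next
      case False
      then have "j < (m - 1) * w" unfolding jkc by (intro block_less c) simp
      then have "(PhiT p * V3) $$ (i, j) = (0 :: 'k tpoly)"
        by (intro PhiT_mult_zero[OF Amat_carrier[OF V3_Amat] i j]) (use j in \<open>auto simp: V3_def\<close>)
      then show ?thesis unfolding jkc N2T_PhiT[OF i k c q] using False by simp
    qed
  qed
  show "PhiT p * V3 = N2T p (w + 1) * (PhiT (w + 1) :: 'k tpoly mat)"
    by (rule eq_matI) (simp_all add: index V3_def[THEN arg_cong, of dim_col] del: index_mult_mat(1))
qed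

text \<open>
  The two diagonal blocks for I1 and I2 together are copies of phi, since (m-1) + (p-1) = w.
\<close>

lemma differential_lift_3:
  "differential_lift m p (Suc (Suc (Suc i))) = (let A = copies w (phi m p (Suc i)); C = - partial_block m p (w + 1) (Suc i)
    in four_block_mat A (alpha m p (Suc i)) (0\<^sub>m (dim_row C) (dim_col A)) (C :: 'k::field mpol mat))"
proof -
  have "diag_block_mat [copies (m - 1) (phi m p (Suc i)), copies (p - 1) (phi m p (Suc i))] = (copies w (phi m p (Suc i)) :: 'k mpol mat)"
    unfolding w_eq by (rule copies_add[OF linmat_carrier[OF phi_linmat]])
  moreover have "m + p - Suc 0 = Suc w" using m2 p2 by (simp add: w_def)
  ultimately show ?thesis
    by (simp add: differential_lift_def partial_block_def[of m p m] partial_block_def[of m p p] Let_def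
      del: diag_block_mat.simps phi.simps)
qed

lemma partial_block_w: "partial_block m p (w + 1) (Suc 0) = Phi m p (w + 1)"
  "partial_block m p (w + 1) (Suc (Suc i)) = copies w (phi m p (Suc i))"
  by (simp_all add: partial_block_def)

lemma phi_linmat': "phi m p (Suc i) \<in> linmat (w * (w - 1) ^ i) (w * (w - 1) ^ Suc i)"
  using phi_linmat[of i] by (simp only: mult.commute)

lemmas phi_Amat' = pmat_Amat[OF phi_linmat']
lemmas phi_carrier' = linmat_carrier[OF phi_linmat']

lemma differential_3_eq: "differential_lift m p 3 = four_block_mat (copies w (phi1 m p)) (alpha m p 1)
    (0\<^sub>m (w + 1) (w * ((w - 1) * w))) (- Phi m p (w + 1) :: 'k::field mpol mat)"
proof -
  have "dim_row (Phi m p (Suc w) :: 'k mpol mat) = Suc w" using carrier_matD[OF linmat_carrier[OF Phi_linmat[of "w + 1"]]] by simp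
  moreover have "dim_col (copies w (phi1 m p) :: 'k mpol mat) = w * ((w - Suc 0) * w)"
    using carrier_matD[OF copies_carrier[OF linmat_carrier[OF phi1_linmat], of w]] by simp
  ultimately show ?thesis
    using differential_lift_3[of 0, where 'k='k] by (simp add: numeral_3_eq_3 Let_def partial_block_w[unfolded Suc_eq_plus1[symmetric]])
qed

lemma differential_4_eq: "differential_lift m p (Suc (Suc (Suc (Suc i)))) =
    four_block_mat (copies w (phi m p (Suc (Suc i)))) (alpha m p (Suc (Suc i)))
    (0\<^sub>m (w * (w * (w - 1) ^ i)) (w * (w * (w - 1) ^ Suc (Suc i)))) (- copies w (phi m p (Suc i)))"
  unfolding differential_lift_3[of "Suc i"] partial_block_w Let_def
  by (simp only: carrier_matD[OF copies_carrier[OF phi_carrier']] index_uminus_mat)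

lemma differential_3_linmat: "differential_lift m p 3 \<in> linmat (w * w + (w + 1)) (w * ((w - 1) * w) + w * w)"
  unfolding differential_3_eq
  using alpha_linmat[of 0] linmat_uminus[OF Phi_linmat[of "w + 1"]]
  by (intro linmat_four_block linmat_zero linmat_copies phi1_linmat) simp_all

lemma differential_4_linmat: "differential_lift m p (Suc (Suc (Suc (Suc i)))) \<in>
   linmat (w * (w * (w - 1) ^ Suc i) + w * (w * (w - 1) ^ i)) (w * (w * (w - 1) ^ Suc (Suc i)) + w * (w * (w - 1) ^ Suc i))"
  unfolding differential_4_eq
  by (intro linmat_four_block linmat_zero linmat_copies phi_linmat' alpha_linmat linmat_uminus)

lemma pmat_differential_3: "pmat (differential_lift m p 3) = four_block_mat (copies w (pmat (phi1 m p))) (alT w)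
    (0\<^sub>m (w + 1) (w * ((w - 1) * w))) (- PhiT (w + 1) :: 'k::field tpoly mat)"
proof -
  have a: "alpha m p 1 \<in> (carrier_mat (w * w) (w * w) :: 'k mpol mat set)" using linmat_carrier[OF alpha_linmat[of 0]] by simp
  have P: "- Phi m p (w + 1) \<in> (carrier_mat (w + 1) (w * w) :: 'k mpol mat set)"
    using linmat_carrier[OF linmat_uminus[OF Phi_linmat[of "w + 1"]]] by simp
  have "pmat (alpha m p 1) = (alT w :: 'k tpoly mat)" using pmat_alpha[of 0] by simp
  then show ?thesis
    unfolding differential_3_eq
    by (simp only: pmat_four_block[OF copies_carrier[OF linmat_carrier[OF phi1_linmat]] a zero_carrier_mat P]
      pmat_copies[OF linmat_carrier[OF phi1_linmat]] pmat_zero pmat_uminus pmat_Phi)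
qed

lemma pmat_differential_4: "pmat (differential_lift m p (Suc (Suc (Suc (Suc i))))) =
    four_block_mat (copies w (pmat (phi m p (Suc (Suc i))))) (alT (w * (w - 1) ^ Suc i))
    (0\<^sub>m (w * (w * (w - 1) ^ i)) (w * (w * (w - 1) ^ Suc (Suc i)))) (- copies w (pmat (phi m p (Suc i))))"
  unfolding differential_4_eq
  by (simp only: pmat_four_block[OF copies_carrier[OF phi_carrier'] linmat_carrier[OF alpha_linmat] zero_carrier_mat
    linmat_carrier[OF linmat_uminus[OF linmat_copies[OF phi_linmat']]]]
      pmat_copies[OF phi_carrier'] pmat_zero pmat_uminus pmat_alpha)

lemma differential_3_mult:
  assumes x: "x \<in> carrier_vec ((m - 1) * ((w - 1) * w))" and z: "z \<in> carrier_vec ((p - 1) * ((w - 1) * w))"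
    and y: "y \<in> carrier_vec (w * w)"
  shows "pmat (differential_lift m p 3) *\<^sub>v ((x @\<^sub>v z) @\<^sub>v y) =
    ((copies (m - 1) (pmat (phi1 m p)) *\<^sub>v x + U3 *\<^sub>v y) @\<^sub>v (V3 *\<^sub>v y + copies (p - 1) (pmat (phi1 m p)) *\<^sub>v z))
      @\<^sub>v ((- PhiT (w + 1)) *\<^sub>v (y :: 'k::field tpoly vec))"
proof -
  let ?P = "pmat (phi1 m p) :: 'k tpoly mat"
  have xz: "x @\<^sub>v z \<in> carrier_vec (w * ((w - 1) * w))" using x z unfolding block_sum(1)[symmetric, of "(w - 1) * w"] by simp
  note U = Amat_carrier[OF U3_Amat] and V = Amat_carrier[OF V3_Amat]
  have Q: "- PhiT (w + 1) \<in> carrier_mat (w + 1) (w * w)" using PhiT_carrier[of "w + 1"] by simp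
  note c = copies_carrier[OF pmat_carrier[OF linmat_carrier[OF phi1_linmat]]]
  note X = mult_mat_vec_carrier[OF c x] mult_mat_vec_carrier[OF c z] mult_mat_vec_carrier[OF U y] mult_mat_vec_carrier[OF V y]
  have "pmat (differential_lift m p 3) *\<^sub>v ((x @\<^sub>v z) @\<^sub>v y) =
      (copies w ?P *\<^sub>v (x @\<^sub>v z) + alT w *\<^sub>v y) @\<^sub>v (0\<^sub>m (w + 1) (w * ((w - 1) * w)) *\<^sub>v (x @\<^sub>v z) + (- PhiT (w + 1)) *\<^sub>v y)"
    unfolding pmat_differential_3
    by (rule four_block_mat_mult_vec[OF c alT_carrier zero_carrier_mat Q xz y])
  also have "copies w ?P *\<^sub>v (x @\<^sub>v z) = copies (m - 1) ?P *\<^sub>v x @\<^sub>v copies (p - 1) ?P *\<^sub>v z"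
    unfolding copies_w_blocks[OF pmat_carrier[OF linmat_carrier[OF phi1_linmat]]]
    by (rule block_diag_mult_vec[OF c c x z])
  also have "alT w *\<^sub>v y = U3 *\<^sub>v y @\<^sub>v V3 *\<^sub>v y"
    unfolding alT_w by (rule mat_mult_append[OF U V y])
  also have "(copies (m - 1) ?P *\<^sub>v x @\<^sub>v copies (p - 1) ?P *\<^sub>v z) + (U3 *\<^sub>v y @\<^sub>v V3 *\<^sub>v y) =
      (copies (m - 1) ?P *\<^sub>v x + U3 *\<^sub>v y) @\<^sub>v (copies (p - 1) ?P *\<^sub>v z + V3 *\<^sub>v y)"
    by (rule append_vec_add[OF X(1,3,2,4)])
  also have "copies (p - 1) ?P *\<^sub>v z + V3 *\<^sub>v y = V3 *\<^sub>v y + copies (p - 1) ?P *\<^sub>v z"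
    by (rule comm_add_vec[OF X(2,4)])
  also have "0\<^sub>m (w + 1) (w * ((w - 1) * w)) *\<^sub>v (x @\<^sub>v z) + (- PhiT (w + 1)) *\<^sub>v y = (- PhiT (w + 1)) *\<^sub>v y"
    unfolding zero_mult_mat_vec[OF xz] by (rule add_zero_left_vec[OF mult_mat_vec_carrier[OF Q y]])
  finally show ?thesis .
qed

lemma exact_differential_2_3:
  "exact (pmat (differential_lift m p 2) :: 'k::field tpoly mat) (pmat (differential_lift m p 3))"
proof (rule exactI[where r = "m + p"])
  show "pmat (differential_lift m p 2) \<in> (carrier_mat (m + p) ((m - 1) * w + (p - 1) * w + (w + 1)) :: 'k tpoly mat set)"
    by (rule pmat_carrier[OF linmat_carrier[OF differential_lift_2_linmat]])
  show "pmat (differential_lift m p 3) \<in> (Amat ((m - 1) * w + (p - 1) * w + (w + 1)) (w * ((w - 1) * w) + w * w) :: 'k tpoly mat set)"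
    unfolding block_sum(1) by (rule pmat_Amat[OF differential_3_linmat])
  fix v :: "'k tpoly vec" assume "v \<in> Avec ((m - 1) * w + (p - 1) * w + (w + 1))"
  then obtain x u z where v: "x \<in> Avec ((m - 1) * w)" "u \<in> Avec (w + 1)" "z \<in> Avec ((p - 1) * w)" "v = (x @\<^sub>v z) @\<^sub>v u"
    using Avec_split by metis
  note vc = v(1-3)[THEN Avec_carrier]
  let ?P = "pmat (phi1 m p) :: 'k tpoly mat"
  have "pmat (differential_lift m p 2) *\<^sub>v v = 0\<^sub>v (m + p) \<longleftrightarrow>
      PhiT m *\<^sub>v x + N1T m (w + 1) *\<^sub>v u = 0\<^sub>v m \<and> N2T p (w + 1) *\<^sub>v u + PhiT p *\<^sub>v z = 0\<^sub>v p"
    unfolding v(4) differential_2_mult[OF vc(1,3,2)] using vc PhiT_carrier[of m] PhiT_carrier[of p] N1T_carrier N2T_carrier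
    by (intro append_vec_eq_zero) (auto intro!: add_carrier_vec mult_mat_vec_carrier)
  also have "\<dots> \<longleftrightarrow> (\<exists>x'\<in>Avec ((m - 1) * ((w - 1) * w)). \<exists>y\<in>Avec (w * w). \<exists>z'\<in>Avec ((p - 1) * ((w - 1) * w)).
       x = copies (m - 1) ?P *\<^sub>v x' + U3 *\<^sub>v y \<and> u = (- PhiT (w + 1)) *\<^sub>v y \<and> z = V3 *\<^sub>v y + copies (p - 1) ?P *\<^sub>v z')"
    using glue_syzygies[OF large_glue copies_phi1_Amat exact_PhiT_copies copies_phi1_Amat exact_PhiT_copies,
      of U3 V3, unfolded add_diff_cancel_right', OF U3_Amat PhiT_U3 V3_Amat PhiT_V3 v(1-3)] .
  also have "\<dots> \<longleftrightarrow> (\<exists>x'\<in>Avec ((m - 1) * ((w - 1) * w)). \<exists>y\<in>Avec (w * w). \<exists>z'\<in>Avec ((p - 1) * ((w - 1) * w)).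
       v = pmat (differential_lift m p 3) *\<^sub>v ((x' @\<^sub>v z') @\<^sub>v y))"
  proof (intro bex_cong refl)
    fix x' y z' :: "'k tpoly vec"
    assume xyz: "x' \<in> Avec ((m - 1) * ((w - 1) * w))" "y \<in> Avec (w * w)" "z' \<in> Avec ((p - 1) * ((w - 1) * w))"
    note c = xyz[THEN Avec_carrier]
    have 1: "copies (m - 1) ?P *\<^sub>v x' + U3 *\<^sub>v y \<in> carrier_vec ((m - 1) * w)"
      using c Amat_carrier[OF U3_Amat] copies_phi1_Amat[THEN Amat_carrier] by (intro add_carrier_vec mult_mat_vec_carrier)
    have 2: "V3 *\<^sub>v y + copies (p - 1) ?P *\<^sub>v z' \<in> carrier_vec ((p - 1) * w)"
      using c Amat_carrier[OF V3_Amat] copies_phi1_Amat[THEN Amat_carrier] by (intro add_carrier_vec mult_mat_vec_carrier)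
    show "(x = copies (m - 1) ?P *\<^sub>v x' + U3 *\<^sub>v y \<and> u = (- PhiT (w + 1)) *\<^sub>v y \<and> z = V3 *\<^sub>v y + copies (p - 1) ?P *\<^sub>v z')
        \<longleftrightarrow> v = pmat (differential_lift m p 3) *\<^sub>v ((x' @\<^sub>v z') @\<^sub>v y)"
      unfolding v(4) differential_3_mult[OF c(1,3,2)]
        append_vec_eq[OF append_carrier_vec[OF vc(1,3)] append_carrier_vec[OF 1 2]] append_vec_eq[OF vc(1) 1] by blast
  qed
  also have "\<dots> \<longleftrightarrow> (\<exists>s\<in>Avec (w * ((w - 1) * w) + w * w). v = pmat (differential_lift m p 3) *\<^sub>v s)"
    unfolding block_sum(1)[symmetric, of "(w - 1) * w"] Avec_split3' ..
  finally show "pmat (differential_lift m p 2) *\<^sub>v v = 0\<^sub>v (m + p) \<longleftrightarrow>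
    (\<exists>s\<in>Avec (w * ((w - 1) * w) + w * w). v = pmat (differential_lift m p 3) *\<^sub>v s)" .
qed

lemma exact_differential_3_4:
  "exact (pmat (differential_lift m p 3) :: 'k::field tpoly mat) (pmat (differential_lift m p 4))"
proof -
  have 4: "pmat (differential_lift m p 4) = four_block_mat (copies w (pmat (phi m p (Suc (Suc 0))))) (alT (w * (w - 1)))
    (0\<^sub>m (w * w) (w * (w * (w - 1) ^ Suc (Suc 0)))) (- copies w (pmat (phi1 m p) :: 'k tpoly mat))"
    using pmat_differential_4[of 0] by (simp add: numeral_eq_Suc)
  have phi1: "pmat (phi1 m p) \<in> (Amat w (w * (w - 1)) :: 'k tpoly mat set)" using phi_Amat'[of 0] by simp
  have phi2: "pmat (phi m p (Suc (Suc 0))) \<in> (Amat (w * (w - 1)) (w * (w - 1) ^ Suc (Suc 0)) :: 'k tpoly mat set)"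
    using phi_Amat'[of 1] by simp
  have ex: "exact (pmat (phi1 m p)) (pmat (phi m p (Suc (Suc 0))) :: 'k tpoly mat)" using exact_phi[of 0] by simp
  have ex': "exact (PhiT (w + 1)) (copies w (pmat (phi1 m p) :: 'k tpoly mat))" using exact_PhiT_copies[of "w + 1"] by simp
  have P: "PhiT (w + 1) \<in> carrier_mat (w + 1) (w * w)" using PhiT_carrier[of "w + 1"] by simp
  note c1 = copies_carrier[OF Amat_carrier[OF phi1], of w]
  show ?thesis
    unfolding pmat_differential_3 4 mult.commute[of "w - 1" w]
    by (rule exact_cone[OF c1 Amat_copies[OF phi2] exact_copies[OF Amat_carrier[OF phi1] phi2 ex] P
        Amat_copies[OF phi1] ex' alT_Amat alT_Amat alT_commute[OF Amat_carrier[OF phi1]]])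
qed

lemma exact_differential_4_5:
  "exact (pmat (differential_lift m p (Suc (Suc (Suc (Suc i))))) :: 'k::field tpoly mat)
    (pmat (differential_lift m p (Suc (Suc (Suc (Suc (Suc i)))))))"
  unfolding pmat_differential_4
  by (rule exact_cone[OF copies_carrier[OF Amat_carrier[OF phi_Amat']] Amat_copies[OF phi_Amat']
      exact_copies[OF Amat_carrier[OF phi_Amat'] phi_Amat' exact_phi]
      copies_carrier[OF Amat_carrier[OF phi_Amat']] Amat_copies[OF phi_Amat']
      exact_copies[OF Amat_carrier[OF phi_Amat'] phi_Amat' exact_phi] alT_Amat alT_Amat
      alT_commute[OF Amat_carrier[OF phi_Amat']]])

lemma exact_differentials:
  "exact (pmat (differential_lift m p (Suc i)) :: 'k::field tpoly mat) (pmat (differential_lift m p (Suc (Suc i))))"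
proof -
  consider "i = 0" | "i = 1" | "i = 2" | j where "i = Suc (Suc (Suc j))"
    by (metis One_nat_def Suc_1 not0_implies_Suc)
  then show ?thesis
    using exact_differential_1_2 exact_differential_2_3 exact_differential_3_4 exact_differential_4_5
    by cases (simp_all only: numeral_eq_Suc One_nat_def pred_numeral_simps eval_nat_numeral BitM.simps)
qed

lemma scroll_rank_eq:
  "scroll_rank (m + p) 0 = 1" "scroll_rank (m + p) 1 = m + p"
  "scroll_rank (m + p) 2 = w * w + (w + 1)" "scroll_rank (m + p) (Suc (Suc (Suc i))) = w ^ 3 * (w - 1) ^ i"
proof -
  have n: "m + p = w + 2" using m2 p2 by (simp add: w_def)
  show "scroll_rank (m + p) 2 = w * w + (w + 1)"
    unfolding n using w_pos by (simp add: scroll_rank_def power2_eq_square)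
  show "scroll_rank (m + p) (Suc (Suc (Suc i))) = w ^ 3 * (w - 1) ^ i"
    unfolding n by (simp add: scroll_rank_def)
qed (simp_all add: scroll_rank_def)

lemma differential_lift_linmat:
  "differential_lift m p (Suc i) \<in> linmat (scroll_rank (m + p) i) (scroll_rank (m + p) (Suc i))"
proof -
  have w: "w = (w - 1) + 1" using w_pos by simp
  have e: "w * (w * (w - 1) ^ Suc j) + w * (w * (w - 1) ^ j) = w ^ 3 * (w - 1) ^ j" for j
  proof -
    have "w * (w * (w - 1) ^ Suc j) + w * (w * (w - 1) ^ j) = w * w * ((w - 1) + 1) * (w - 1) ^ j"
      by (simp add: algebra_simps del: One_nat_def)
    then show ?thesis using w by (simp add: power3_eq_cube)
  qed
  consider "i = 0" | "i = 1" | "i = 2" | j where "i = Suc (Suc (Suc j))"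
    by (metis One_nat_def Suc_1 not0_implies_Suc)
  then show ?thesis
  proof cases
    case 1 then show ?thesis using differential_lift_1(1) scroll_rank_eq(1,2) by simp
  next
    case 2 then show ?thesis using differential_lift_2_linmat[unfolded block_sum(1)] scroll_rank_eq(2,3)
      by (simp add: numeral_2_eq_2)
  next
    case 3
    have "w * ((w - 1) * w) + w * w = w ^ 3" using e[of 0] by (simp add: mult.commute mult.left_commute)
    then show ?thesis using 3 differential_3_linmat scroll_rank_eq(3) scroll_rank_eq(4)[of 0]
      by (simp add: numeral_2_eq_2 numeral_3_eq_3)
  next
    case 4 then show ?thesis using differential_4_linmat[of j] by (simp only: e scroll_rank_eq(4))
  qed
qed

section \<open>The scroll ring as a ring of polynomials in a, b and t\<close>

text \<open>
  The ring L 0.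
\<close>

definition L_ring :: "'k::field tpoly ring" where
  "L_ring = \<lparr>carrier = L 0, mult = (*), one = 1, zero = 0, add = (+)\<rparr>"

lemma L_ring_simps [simp]:
  "carrier L_ring = L 0" "mult L_ring = (*)" "one L_ring = 1" "zero L_ring = 0" "add L_ring = (+)"
  by (simp_all add: L_ring_def)

lemma cring_L_ring: "cring (L_ring :: 'k::field tpoly ring)"
proof (rule cringI)
  show "abelian_group (L_ring :: 'k tpoly ring)"
  proof (rule abelian_groupI)
    fix x :: "'k tpoly" assume "x \<in> carrier L_ring"
    then show "\<exists>y\<in>carrier L_ring. y \<oplus>\<^bsub>L_ring\<^esub> x = \<zero>\<^bsub>L_ring\<^esub>"
      by (intro bexI[of _ "- x"]) (auto intro: L_uminus)
  qed (auto intro: L_add simp: algebra_simps)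
  show "comm_monoid (L_ring :: 'k tpoly ring)"
    by (rule comm_monoidI) (auto intro: L0_mult L_one simp: algebra_simps)
qed (auto simp: algebra_simps)

lemma parametrization_ring_hom_ring:
  "ring_hom_ring (S_ring (m + p)) L_ring (parametrization :: 'k::field mpol \<Rightarrow> _)"
  using parametrization_image[where 'k = 'k]
  by (intro ring_hom_ringI cring.axioms(1)[OF cring_S_ring] cring.axioms(1)[OF cring_L_ring])
    (auto simp: parametrization_mult parametrization_add)

lemma a_kernel_parametrization: "a_kernel (S_ring (m + p)) L_ring (parametrization :: 'k::field mpol \<Rightarrow> _) = scroll_ideal m p"
  using parametrization_kernel[where 'k = 'k] by (auto simp: a_kernel_def')

text \<open>
  The isomorphism of the scroll ring with L 0 that is induced by the parametrization.
\<close>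

definition coordinate :: "'k::field mpol set \<Rightarrow> 'k tpoly" where
  "coordinate X = the_elem (parametrization ` X)"

lemma coordinate_iso: "coordinate \<in> ring_iso (scroll_ring m p) (L_ring :: 'k::field tpoly ring)"
  using ring_hom_ring.FactRing_iso_set[OF parametrization_ring_hom_ring[where 'k = 'k]] parametrization_image[where 'k = 'k]
  unfolding a_kernel_parametrization scroll_ring_def coordinate_def[abs_def] by simp

lemma coordinate_residue_class:
  "f \<in> carrier (S_ring (m + p)) \<Longrightarrow> coordinate (residue_class m p f) = parametrization (f :: 'k::field mpol)"
  using ring_hom_ring.the_elem_simp[OF parametrization_ring_hom_ring[where 'k = 'k], of f]
  unfolding a_kernel_parametrization residue_class_def coordinate_def by simp

lemma cring_scroll_ring: "cring (scroll_ring m p :: 'k::field mpol set ring)"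
  unfolding scroll_ring_def by (rule ideal.quotient_is_cring[OF ideal_scroll cring_S_ring])

lemma residue_class_hom: "residue_class m p \<in> ring_hom (S_ring (m + p)) (scroll_ring m p :: 'k::field mpol set ring)"
  using ideal.rcos_ring_hom[OF ideal_scroll] unfolding scroll_ring_def residue_class_def[abs_def] .

lemma residue_class_closed: "f \<in> carrier (S_ring (m + p)) \<Longrightarrow> residue_class m p f \<in> carrier (scroll_ring m p :: 'k::field mpol set ring)"
  by (rule ring_hom_closed[OF residue_class_hom])

lemma coordinate_closed: "X \<in> carrier (scroll_ring m p) \<Longrightarrow> coordinate X \<in> (L 0 :: 'k::field tpoly set)"
  using ring_iso_memE(1)[OF coordinate_iso] by simp

lemma coordinate_mult: "X \<in> carrier (scroll_ring m p) \<Longrightarrow> Y \<in> carrier (scroll_ring m p) \<Longrightarrow>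
    coordinate (X \<otimes>\<^bsub>scroll_ring m p\<^esub> Y) = coordinate X * (coordinate Y :: 'k::field tpoly)"
  using ring_iso_memE(2)[OF coordinate_iso, of X Y] by simp

lemma coordinate_add: "X \<in> carrier (scroll_ring m p) \<Longrightarrow> Y \<in> carrier (scroll_ring m p) \<Longrightarrow>
    coordinate (X \<oplus>\<^bsub>scroll_ring m p\<^esub> Y) = coordinate X + (coordinate Y :: 'k::field tpoly)"
  using ring_iso_memE(3)[OF coordinate_iso, of X Y] by simp

lemma coordinate_inj: "X \<in> carrier (scroll_ring m p) \<Longrightarrow> Y \<in> carrier (scroll_ring m p) \<Longrightarrow>
    coordinate X = (coordinate Y :: 'k::field tpoly) \<Longrightarrow> X = Y"
  using ring_iso_memE(5)[OF coordinate_iso] by (auto simp: bij_betw_def inj_on_def)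

lemma coordinate_surj: "f \<in> (L 0 :: 'k::field tpoly set) \<Longrightarrow> \<exists>X\<in>carrier (scroll_ring m p). coordinate X = f"
proof -
  assume "f \<in> (L 0 :: 'k tpoly set)"
  also have "(L 0 :: 'k tpoly set) = coordinate ` carrier (scroll_ring m p)"
    using ring_iso_memE(5)[OF coordinate_iso[where 'k = 'k]] by (simp add: bij_betw_def)
  finally show ?thesis by blast
qed

lemma coordinate_zero: "coordinate \<zero>\<^bsub>scroll_ring m p\<^esub> = (0 :: 'k::field tpoly)"
proof -
  interpret R: cring "scroll_ring m p :: 'k mpol set ring" by (rule cring_scroll_ring)
  have "coordinate \<zero>\<^bsub>scroll_ring m p\<^esub> + (coordinate \<zero>\<^bsub>scroll_ring m p\<^esub> :: 'k tpoly) = coordinate \<zero>\<^bsub>scroll_ring m p\<^esub>"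
    by (simp flip: coordinate_add)
  then show ?thesis by simp
qed

lemma coordinate_finsum:
  assumes "finite X" "\<And>i. i \<in> X \<Longrightarrow> f i \<in> carrier (scroll_ring m p)"
  shows "coordinate (finsum (scroll_ring m p) f X) = (\<Sum>i\<in>X. coordinate (f i) :: 'k::field tpoly)"
proof -
  interpret R: cring "scroll_ring m p :: 'k mpol set ring" by (rule cring_scroll_ring)
  show ?thesis using assms
    by (induction X rule: finite_induct)
      (auto simp: coordinate_zero R.finsum_insert coordinate_add R.finsum_closed Pi_iff)
qed

lemma residue_class_zero: "residue_class m p 0 = \<zero>\<^bsub>scroll_ring m p :: 'k::field mpol set ring\<^esub>"
  using ring_hom_zero[OF residue_class_hom cring.axioms(1)[OF cring_S_ring] cring.axioms(1)[OF cring_scroll_ring]] by simp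

lemma residue_class_finsum:
  assumes "finite X" "\<And>i. i \<in> X \<Longrightarrow> f i \<in> carrier (S_ring (m + p))"
  shows "finsum (scroll_ring m p) (\<lambda>i. residue_class m p (f i)) X = residue_class m p (\<Sum>i\<in>X. f i :: 'k::field mpol)"
proof -
  interpret R: cring "scroll_ring m p :: 'k mpol set ring" by (rule cring_scroll_ring)
  have add: "residue_class m p (g + h) = residue_class m p g \<oplus>\<^bsub>scroll_ring m p\<^esub> residue_class m p h"
    if "g \<in> carrier (S_ring (m + p))" "h \<in> carrier (S_ring (m + p))" for g h :: "'k mpol"
    using ring_hom_add[OF residue_class_hom that] by simp
  show ?thesis using assms
    by (induction X rule: finite_induct)
      (auto simp: residue_class_zero R.finsum_insert add residue_class_closed S_carrier_sum Pi_iff)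
qed

section \<open>Exactness over the scroll ring\<close>

text \<open>
  The free module of rank r over the scroll ring.
\<close>

abbreviation FM :: "nat \<Rightarrow> ('k::field mpol set, 'k mpol set vec) module" where
  "FM r \<equiv> free_module (scroll_ring m p) r"

text \<open>
  Reduction of a matrix modulo the scroll ideal.
\<close>

definition rmat :: "'k::field mpol mat \<Rightarrow> 'k mpol set mat" where
  "rmat M = map_mat (residue_class m p) M"

lemma carrier_FM: "carrier (FM r) = {v \<in> carrier_vec r. \<forall>j<r. v $ j \<in> carrier (scroll_ring m p)}"
  by (simp add: free_module_def)

lemma zero_FM: "\<zero>\<^bsub>FM r\<^esub> = vec r (\<lambda>_. \<zero>\<^bsub>scroll_ring m p\<^esub>)"
  by (simp add: free_module_def)

lemma lin_carrier: "lin \<subseteq> carrier (S_ring (m + p))"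
  by (auto simp: lin_def intro!: S_carrier_var S_carrier_uminus)

lemma linmat_entry: "M \<in> linmat r c \<Longrightarrow> i < r \<Longrightarrow> j < c \<Longrightarrow> M $$ (i, j) \<in> lin"
  by (simp add: linmat_def)

lemma rmat_entry:
  assumes "M \<in> linmat r c" "i < r" "j < c"
  shows "rmat M $$ (i, j) = residue_class m p (M $$ (i, j))" "M $$ (i, j) \<in> carrier (S_ring (m + p))"
    "rmat M $$ (i, j) \<in> carrier (scroll_ring m p)"
proof -
  show 1: "rmat M $$ (i, j) = residue_class m p (M $$ (i, j))"
    using linmat_carrier[OF assms(1)] assms by (simp add: rmat_def)
  show 2: "M $$ (i, j) \<in> carrier (S_ring (m + p))"
    using linmat_entry[OF assms] lin_carrier by blast
  show "rmat M $$ (i, j) \<in> carrier (scroll_ring m p)" unfolding 1 by (rule residue_class_closed[OF 2])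
qed

lemma mat_act_index:
  assumes "M \<in> linmat r c" "i < r"
  shows "mat_act (scroll_ring m p) (rmat M) v $ i =
    finsum (scroll_ring m p) (\<lambda>j. rmat M $$ (i, j) \<otimes>\<^bsub>scroll_ring m p\<^esub> v $ j) {..<c}"
  using linmat_carrier[OF assms(1)] assms(2) by (simp add: mat_act_def rmat_def)

lemma mat_act_dim: "M \<in> linmat r c \<Longrightarrow> mat_act (scroll_ring m p) (rmat M) v \<in> carrier_vec r"
  using linmat_carrier[of M r c] by (auto simp: mat_act_def rmat_def)

lemma mat_act_closed:
  assumes "M \<in> linmat r c" "v \<in> carrier (FM c)"
  shows "mat_act (scroll_ring m p) (rmat M) v \<in> carrier (FM r :: (_, 'k::field mpol set vec) module)"
proof -
  interpret R: cring "scroll_ring m p :: 'k mpol set ring" by (rule cring_scroll_ring)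
  show ?thesis using assms mat_act_dim[OF assms(1)]
    by (auto simp: carrier_FM mat_act_index[OF assms(1)] rmat_entry(3)[OF assms(1)] intro!: R.finsum_closed)
qed

lemma coordinate_mat_act:
  assumes "M \<in> linmat r c" "v \<in> carrier (FM c)"
  shows "map_vec coordinate (mat_act (scroll_ring m p) (rmat M) v) = pmat M *\<^sub>v (map_vec coordinate v :: 'k::field tpoly vec)"
proof (rule eq_vecI)
  interpret R: cring "scroll_ring m p :: 'k mpol set ring" by (rule cring_scroll_ring)
  show "dim_vec (map_vec coordinate (mat_act (scroll_ring m p) (rmat M) v)) = dim_vec (pmat M *\<^sub>v map_vec coordinate v)"
    by (simp add: mat_act_def rmat_def)
  fix i assume "i < dim_vec (pmat M *\<^sub>v (map_vec coordinate v :: 'k tpoly vec))"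
  then have i: "i < r" using linmat_carrier[OF assms(1)] by simp
  have v: "map_vec coordinate v \<in> carrier_vec c" "\<And>j. j < c \<Longrightarrow> v $ j \<in> carrier (scroll_ring m p)"
    using assms(2) by (auto simp: carrier_FM)
  have "map_vec coordinate (mat_act (scroll_ring m p) (rmat M) v) $ i = coordinate (mat_act (scroll_ring m p) (rmat M) v $ i)"
    using mat_act_dim[OF assms(1), of v] i by simp
  also have "\<dots> = (\<Sum>j<c. coordinate (rmat M $$ (i, j) \<otimes>\<^bsub>scroll_ring m p\<^esub> v $ j))"
    unfolding mat_act_index[OF assms(1) i] using v(2) rmat_entry(3)[OF assms(1) i]
    by (intro coordinate_finsum) auto
  also have "\<dots> = (\<Sum>j<c. pmat M $$ (i, j) * map_vec coordinate v $ j)"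
    using v rmat_entry[OF assms(1) i] linmat_carrier[OF assms(1)] i
    by (intro sum.cong) (auto simp: coordinate_mult coordinate_residue_class)
  also have "\<dots> = (pmat M *\<^sub>v map_vec coordinate v) $ i"
    by (rule mult_mat_vec_index[OF pmat_carrier[OF linmat_carrier[OF assms(1)]] v(1) i, symmetric])
  finally show "map_vec coordinate (mat_act (scroll_ring m p) (rmat M) v) $ i = (pmat M *\<^sub>v map_vec coordinate v) $ i" .
qed

lemma coordinate_vec_closed: "v \<in> carrier (FM c) \<Longrightarrow> map_vec coordinate v \<in> (Avec c :: 'k::field tpoly vec set)"
  by (auto simp: carrier_FM Avec_def coordinate_closed)

lemma coordinate_vec_surj:
  assumes "x \<in> (Avec c :: 'k::field tpoly vec set)" obtains v where "v \<in> carrier (FM c)" "map_vec coordinate v = x"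
proof -
  have "\<forall>i. \<exists>X. i < c \<longrightarrow> X \<in> carrier (scroll_ring m p) \<and> coordinate X = x $ i"
    using assms coordinate_surj by (auto simp: Avec_def)
  then obtain X where X: "\<And>i. i < c \<Longrightarrow> X i \<in> carrier (scroll_ring m p)" "\<And>i. i < c \<Longrightarrow> coordinate (X i) = x $ i"
    by metis
  show ?thesis
    using X assms by (intro that[of "vec c X"]) (auto simp: carrier_FM Avec_def)
qed

lemma coordinate_vec_inj:
  assumes "v \<in> carrier (FM c)" "u \<in> carrier (FM c)" "map_vec coordinate v = (map_vec coordinate u :: 'k::field tpoly vec)"
  shows "v = u"
proof (rule eq_vecI)
  show d: "dim_vec v = dim_vec u" using assms by (auto simp: carrier_FM)
  fix i assume i: "i < dim_vec u"
  then have "coordinate (v $ i) = (coordinate (u $ i) :: 'k tpoly)"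
    using arg_cong[OF assms(3), of "\<lambda>x. x $ i"] d by simp
  then show "v $ i = u $ i" using assms i by (intro coordinate_inj) (auto simp: carrier_FM)
qed

lemma zero_FM_closed: "\<zero>\<^bsub>FM r\<^esub> \<in> carrier (FM r :: (_, 'k::field mpol set vec) module)"
proof -
  interpret R: cring "scroll_ring m p :: 'k mpol set ring" by (rule cring_scroll_ring)
  show ?thesis by (simp add: carrier_FM zero_FM)
qed

lemma coordinate_zero_FM: "map_vec coordinate \<zero>\<^bsub>FM r\<^esub> = (0\<^sub>v r :: 'k::field tpoly vec)"
  by (intro eq_vecI) (auto simp: zero_FM coordinate_zero)

lemma exact_transport:
  assumes M: "M \<in> linmat r c" and N: "N \<in> linmat c e" and ex: "exact (pmat M) (pmat N :: 'k::field tpoly mat)"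
  shows "{v \<in> carrier (FM c). mat_act (scroll_ring m p) (rmat M) v = \<zero>\<^bsub>FM r\<^esub>} =
    mat_act (scroll_ring m p) (rmat N) ` carrier (FM e)"
proof -
  have iff: "mat_act (scroll_ring m p) (rmat M) v = \<zero>\<^bsub>FM r\<^esub> \<longleftrightarrow>
      (\<exists>x\<in>carrier (FM e). v = mat_act (scroll_ring m p) (rmat N) x)" if v: "v \<in> carrier (FM c)" for v
  proof -
    have "mat_act (scroll_ring m p) (rmat M) v = \<zero>\<^bsub>FM r\<^esub> \<longleftrightarrow> pmat M *\<^sub>v map_vec coordinate v = 0\<^sub>v r"
      using coordinate_vec_inj[OF mat_act_closed[OF M v] zero_FM_closed]
      unfolding coordinate_mat_act[OF M v, symmetric] coordinate_zero_FM by (metis coordinate_zero_FM)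
    also have "\<dots> \<longleftrightarrow> (\<exists>x\<in>Avec e. map_vec coordinate v = pmat N *\<^sub>v x)"
      by (rule exactD[OF ex pmat_carrier[OF linmat_carrier[OF M]] pmat_carrier[OF linmat_carrier[OF N]] coordinate_vec_closed[OF v]])
    also have "\<dots> \<longleftrightarrow> (\<exists>x\<in>carrier (FM e). map_vec coordinate v = pmat N *\<^sub>v map_vec coordinate x)"
      using coordinate_vec_surj coordinate_vec_closed by metis
    also have "\<dots> \<longleftrightarrow> (\<exists>x\<in>carrier (FM e). v = mat_act (scroll_ring m p) (rmat N) x)"
      using coordinate_vec_inj[OF v mat_act_closed[OF N]] coordinate_mat_act[OF N] by metis
    finally show ?thesis .
  qed
  show ?thesis using iff mat_act_closed[OF N] by auto
qed

section \<open>The maximal ideal and the residue field\<close>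

lemma lookup_zero_mult:
  "f \<in> L 0 \<Longrightarrow> g \<in> L 0 \<Longrightarrow> Poly_Mapping.lookup f 0 = 0 \<Longrightarrow> Poly_Mapping.lookup (f * g) 0 = (0 :: 'k::field)"
proof (rule ccontr)
  assume f: "Poly_Mapping.lookup f 0 = 0" and "Poly_Mapping.lookup (f * g) 0 \<noteq> (0 :: 'k)"
  then have "0 \<in> Poly_Mapping.keys (f * g)" by (simp add: in_keys_iff)
  then obtain k l where "k \<in> Poly_Mapping.keys f" "0 = k + l" using keys_mult[of f g] by blast
  moreover have "k = 0" using \<open>0 = k + l\<close> by (cases k, cases l) (auto simp: zero_prod_def)
  ultimately show False using f by (simp add: in_keys_iff)
qed

text \<open>
  The elements of L 0 without constant term are combinations of the images of the variables.
\<close>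

lemma no_constant_term:
  assumes f: "f \<in> (L 0 :: 'k::field tpoly set)" "Poly_Mapping.lookup f 0 = 0"
  shows "\<exists>v\<in>Avec (m + p). f = (rowT m p *\<^sub>v v) $ 0"
proof -
  let ?g = "\<lambda>j. if j < m then (1, 0, j) else (0, 1, j - m) :: nat \<times> nat \<times> nat"
  have "\<exists>c\<in>{..<m + p}. \<exists>l\<in>cone 0. r = ?g c + l" if r: "r \<in> Poly_Mapping.keys f" for r
  proof -
    obtain i j e where rr: "r = (i, j, e)" by (cases r)
    have "r \<in> cone 0" using r f by (auto simp: L_def)
    then have e: "e \<le> i * (m - 1) + j * (p - 1)" by (simp add: cone_def rr)
    have r0: "r \<noteq> 0" using r f(2) by (auto simp: in_keys_iff)
    show ?thesis
    proof (cases i)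
      case (Suc i')
      let ?c = "min e (m - 1)"
      have "e \<le> (m - 1) + (i' * (m - 1) + j * (p - 1))" using e Suc by simp
      then have "e - ?c \<le> i' * (m - 1) + j * (p - 1)" by linarith
      moreover have "?c < m" using m2 by auto
      ultimately show ?thesis using Suc
        by (intro bexI[of _ "?c"] bexI[of _ "(i', j, e - ?c)"]) (auto simp: rr cone_def)
    next
      case 0
      then obtain j' where j: "j = Suc j'" using e r0 by (cases j) (auto simp: rr zero_prod_def)
      let ?c = "min e (p - 1)"
      have "e \<le> (p - 1) + j' * (p - 1)" using e 0 j by simp
      then have "e - ?c \<le> j' * (p - 1)" by linarith
      moreover have "m + ?c < m + p" using p2 by auto
      ultimately show ?thesis using 0 j
        by (intro bexI[of _ "m + ?c"] bexI[of _ "(0, j', e - ?c)"]) (auto simp: rr cone_def)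
    qed
  qed
  then obtain y where y: "\<And>c. Poly_Mapping.keys (y c) \<subseteq> cone 0"
    "f = (\<Sum>c<m + p. Poly_Mapping.single (?g c) 1 * y c)"
    using split_by_monomials[of "{..<m + p}" f "cone 0" ?g, OF finite_lessThan] by auto
  have v: "vec (m + p) y \<in> Avec (m + p)" using y(1) by (auto simp: Avec_def L_def)
  have "(rowT m p *\<^sub>v vec (m + p) y) $ 0 = (\<Sum>j<m + p. rowT m p $$ (0, j) * vec (m + p) y $ j)"
    by (rule mult_mat_vec_index[OF rowT_carrier]) simp_all
  also have "\<dots> = f"
    unfolding y(2) by (intro sum.cong) (auto simp: rowT_def abt_def)
  finally have "f = (rowT m p *\<^sub>v vec (m + p) y) $ 0" by simp
  with v show ?thesis by blast
qed

abbreviation mx :: "'k::field mpol set set" where "mx \<equiv> scroll_maximal_ideal m p"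

lemma generators_carrier: "{residue_class m p (var i) | i. i \<in> {1..m + p}} \<subseteq> carrier (scroll_ring m p :: 'k::field mpol set ring)"
  by (auto intro!: residue_class_closed S_carrier_var)

lemma ideal_mx: "ideal mx (scroll_ring m p :: 'k::field mpol set ring)"
proof -
  interpret R: cring "scroll_ring m p :: 'k mpol set ring" by (rule cring_scroll_ring)
  show ?thesis unfolding scroll_maximal_ideal_def by (rule R.genideal_ideal[OF generators_carrier])
qed

lemma residue_class_uminus:
  "f \<in> carrier (S_ring (m + p)) \<Longrightarrow> residue_class m p (- f) = \<ominus>\<^bsub>scroll_ring m p\<^esub> residue_class m p (f :: 'k::field mpol)"
proof -
  interpret h: ring_hom_ring "S_ring (m + p) :: 'k mpol ring" "scroll_ring m p" "residue_class m p"
    by (intro ring_hom_ringI2 residue_class_hom cring.axioms(1)[OF cring_S_ring] cring.axioms(1)[OF cring_scroll_ring])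
  assume "f \<in> carrier (S_ring (m + p))"
  then show ?thesis using h.hom_a_inv[of f] S_a_inv[of f "m + p"] by simp
qed

lemma lin_mx: "f \<in> lin \<Longrightarrow> residue_class m p f \<in> (mx :: 'k::field mpol set set)"
proof -
  interpret R: cring "scroll_ring m p :: 'k mpol set ring" by (rule cring_scroll_ring)
  interpret I: ideal mx "scroll_ring m p :: 'k mpol set ring" by (rule ideal_mx)
  have var: "residue_class m p (var i) \<in> (mx :: 'k mpol set set)" if "i \<in> {1..m + p}" for i
    unfolding scroll_maximal_ideal_def using R.genideal_self[OF generators_carrier] that by blast
  assume "f \<in> lin"
  then show ?thesis
    by (auto simp: lin_def residue_class_zero residue_class_uminus S_carrier_var var)
qed

lemma finsum_mx:
  assumes "finite X" "\<And>i. i \<in> X \<Longrightarrow> f i \<in> mx"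
  shows "finsum (scroll_ring m p) f X \<in> (mx :: 'k::field mpol set set)"
proof -
  interpret R: cring "scroll_ring m p :: 'k mpol set ring" by (rule cring_scroll_ring)
  interpret I: ideal mx "scroll_ring m p :: 'k mpol set ring" by (rule ideal_mx)
  show ?thesis using assms
  proof (induction X rule: finite_induct)
    case (insert x F)
    then have "f \<in> F \<rightarrow> carrier (scroll_ring m p)" "f x \<in> carrier (scroll_ring m p)" by auto
    with insert show ?case by (simp add: R.finsum_insert)
  qed simp
qed

lemma mat_act_mx:
  assumes "M \<in> linmat r c" "v \<in> carrier (FM c)" "i < r"
  shows "mat_act (scroll_ring m p) (rmat M) v $ i \<in> (mx :: 'k::field mpol set set)"
proof -
  interpret R: cring "scroll_ring m p :: 'k mpol set ring" by (rule cring_scroll_ring)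
  interpret I: ideal mx "scroll_ring m p :: 'k mpol set ring" by (rule ideal_mx)
  show ?thesis unfolding mat_act_index[OF assms(1,3)]
  proof (rule finsum_mx)
    fix j assume "j \<in> {..<c}"
    then show "rmat M $$ (i, j) \<otimes>\<^bsub>scroll_ring m p\<^esub> v $ j \<in> mx"
      using assms rmat_entry(1)[OF assms(1,3)] linmat_entry[OF assms(1,3)]
      by (intro I.I_r_closed) (auto simp: carrier_FM lin_mx)
  qed simp
qed

lemma mx_constant_term: "mx \<subseteq> {X \<in> carrier (scroll_ring m p). Poly_Mapping.lookup (coordinate X) 0 = (0 :: 'k::field)}"
proof -
  interpret R: cring "scroll_ring m p :: 'k mpol set ring" by (rule cring_scroll_ring)
  let ?Z = "{X \<in> carrier (scroll_ring m p). Poly_Mapping.lookup (coordinate X) 0 = (0 :: 'k)}"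
  have inv: "coordinate (\<ominus>\<^bsub>scroll_ring m p\<^esub> X) = - (coordinate X :: 'k tpoly)" if X: "X \<in> carrier (scroll_ring m p)" for X
    using coordinate_add[OF R.a_inv_closed[OF X] X] R.l_neg[OF X] coordinate_zero[where 'k = 'k] by (simp add: eq_neg_iff_add_eq_0)
  have "ideal ?Z (scroll_ring m p)"
  proof (rule idealI)
    show "subgroup ?Z (add_monoid (scroll_ring m p))"
      by (rule R.add.subgroupI)
        (auto simp: coordinate_add lookup_add inv inv[unfolded a_inv_def] coordinate_zero intro!: exI[of _ "\<zero>\<^bsub>scroll_ring m p\<^esub>"])
  qed (auto simp: coordinate_mult coordinate_closed lookup_zero_mult mult.commute[of "coordinate _" "coordinate _"] intro: R.ring_axioms)
  moreover have "{residue_class m p (var i) | i. i \<in> {1..m + p}} \<subseteq> ?Z"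
    by (auto simp: coordinate_residue_class S_carrier_var parametrization_var lookup_single when_def zero_prod_def
        a_degree_def b_degree_def intro!: residue_class_closed)
  ultimately show ?thesis
    unfolding scroll_maximal_ideal_def by (rule R.genideal_minimal)
qed

lemma mx_mat_act: "mx = (\<lambda>v. mat_act (scroll_ring m p) (rmat (differential_lift m p 1)) v $ 0) ` carrier (FM (m + p) :: (_, 'k::field mpol set vec) module)"
proof
  have D: "differential_lift m p 1 \<in> (linmat 1 (m + p) :: 'k mpol mat set)" by (rule differential_lift_1)
  show "(\<lambda>v. mat_act (scroll_ring m p) (rmat (differential_lift m p 1)) v $ 0) ` carrier (FM (m + p)) \<subseteq> (mx :: 'k mpol set set)"
    using mat_act_mx[OF D] by auto
  show "(mx :: 'k mpol set set) \<subseteq> (\<lambda>v. mat_act (scroll_ring m p) (rmat (differential_lift m p 1)) v $ 0) ` carrier (FM (m + p))"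
  proof
    fix X assume X: "X \<in> (mx :: 'k mpol set set)"
    then have X': "X \<in> carrier (scroll_ring m p)" "Poly_Mapping.lookup (coordinate X) 0 = 0"
      using mx_constant_term by auto
    then obtain x where x: "x \<in> Avec (m + p)" "coordinate X = (rowT m p *\<^sub>v x) $ 0"
      using no_constant_term[of "coordinate X"] coordinate_closed by blast
    obtain v where v: "v \<in> carrier (FM (m + p))" "map_vec coordinate v = x" using coordinate_vec_surj[OF x(1)] .
    let ?y = "mat_act (scroll_ring m p) (rmat (differential_lift m p 1)) v"
    have "coordinate (?y $ 0) = map_vec coordinate ?y $ 0" using mat_act_dim[OF D, of v] by simp
    also have "\<dots> = coordinate X"
      unfolding coordinate_mat_act[OF D v(1)] differential_lift_1(2) v(2) x(2) ..
    finally have "X = ?y $ 0"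
      using X' mat_act_closed[OF D v(1)] by (intro coordinate_inj) (auto simp: carrier_FM)
    with v(1) show "X \<in> (\<lambda>v. mat_act (scroll_ring m p) (rmat (differential_lift m p 1)) v $ 0) ` carrier (FM (m + p))" by blast
  qed
qed

text \<open>
  The residue field, as the quotient of the scroll ring by its maximal ideal.
\<close>

abbreviation KR :: "'k::field mpol set set ring" where "KR \<equiv> scroll_ring m p Quot mx"

lemma residue_module_simps [simp]:
  "carrier (residue_module m p) = carrier KR" "zero (residue_module m p) = \<zero>\<^bsub>KR\<^esub>"
  "add (residue_module m p) = add KR" 
  "module.smult (residue_module m p) a X = residue_projection m p a \<otimes>\<^bsub>KR\<^esub> X"
  by (simp_all add: residue_module_def quotient_module_def residue_projection_def)

lemma cring_KR: "cring (KR :: 'k::field mpol set set ring)"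
  by (rule ideal.quotient_is_cring[OF ideal_mx cring_scroll_ring])

lemma residue_projection_hom: "residue_projection m p \<in> ring_hom (scroll_ring m p) (KR :: 'k::field mpol set set ring)"
  using ideal.rcos_ring_hom[OF ideal_mx] unfolding residue_projection_def[abs_def] .

lemma residue_projection_image: "residue_projection m p ` carrier (scroll_ring m p) = carrier (KR :: 'k::field mpol set set ring)"
  by (auto simp: FactRing_def A_RCOSETS_def' residue_projection_def)

lemma residue_projection_kernel:
  assumes "a \<in> carrier (scroll_ring m p)"
  shows "residue_projection m p a = \<zero>\<^bsub>KR\<^esub> \<longleftrightarrow> a \<in> (mx :: 'k::field mpol set set)"
proof -
  interpret I: ideal mx "scroll_ring m p :: 'k mpol set ring" by (rule ideal_mx)
  have "residue_projection m p a = mx \<longleftrightarrow> a \<in> mx"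
    unfolding residue_projection_def using assms I.a_rcos_zero[OF I.is_ideal] I.rcos_const_imp_mem
    by (metis I.a_rcos_const)
  then show ?thesis by (simp add: FactRing_def)
qed

lemma module_residue: "module (scroll_ring m p) (residue_module m p :: ('k::field mpol set, _) module)"
proof -
  interpret K: cring "KR :: 'k mpol set set ring" by (rule cring_KR)
  note hom = residue_projection_hom[where 'k = 'k]
  note closed = ring_hom_closed[OF hom]
  show ?thesis
  proof (rule moduleI)
    show "cring (scroll_ring m p :: 'k mpol set ring)" by (rule cring_scroll_ring)
    show "abelian_group (residue_module m p :: ('k mpol set, _) module)"
      by (rule abelian_groupI) (auto simp: K.a_ac intro: K.l_neg)
  qed (simp_all add: closed ring_hom_add[OF hom] ring_hom_mult[OF hom] ring_hom_one[OF hom] K.l_distr K.r_distr K.m_assoc)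
qed

section \<open>The grading and the resolution\<close>

lemma monomial_degree_wsum: "monomial_degree = wsum (\<lambda>_. 1)"
  by (simp add: fun_eq_iff monomial_degree_def wsum_def)

lemma S_component_add:
  "f \<in> S_component n d \<Longrightarrow> g \<in> S_component n d \<Longrightarrow> f + g \<in> S_component n d"
  using Poly_Mapping.keys_add[of f g] S_carrier_add[of f n g] unfolding S_component_def by blast

lemma S_component_zero: "0 \<in> S_component n d" by (simp add: S_component_def)

lemma S_component_sum: "(\<And>i. i \<in> X \<Longrightarrow> f i \<in> S_component n d) \<Longrightarrow> sum f X \<in> S_component n d"
  by (induction X rule: infinite_finite_induct) (auto intro: S_component_add S_component_zero)

lemma S_component_mult:
  assumes "f \<in> S_component n d" "g \<in> S_component n e" shows "f * g \<in> S_component n (d + e)"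
  using assms S_carrier_mult[of f n g] keys_mult[of f g]
  by (fastforce simp: S_component_def monomial_degree_wsum wsum_add)

lemma lin_S_component: "f \<in> lin \<Longrightarrow> f \<in> S_component (m + p) 1"
  using lin_carrier by (auto simp: lin_def S_component_def var_def monomial_degree_wsum)

text \<open>
  Matrices with linear entries raise the degree of the components by one.
\<close>

lemma mat_act_graded:
  assumes M: "M \<in> linmat r c"
    and v: "v \<in> free_module_component (scroll_ring m p) (scroll_component m p) c (\<lambda>_. d + 1) t"
  shows "mat_act (scroll_ring m p) (rmat M) v \<in>
    free_module_component (scroll_ring m p) (scroll_component m p :: int \<Rightarrow> 'k::field mpol set set) r (\<lambda>_. d) t"
proof -
  have vc: "v \<in> carrier (FM c)" using v by (simp add: free_module_component_def)
  have "\<forall>j. \<exists>f. j < c \<longrightarrow> f \<in> S_component (m + p) (t - (d + 1)) \<and> v $ j = residue_class m p f"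
    using v by (auto simp: free_module_component_def scroll_component_def)
  then obtain f where f: "\<And>j. j < c \<Longrightarrow> f j \<in> S_component (m + p) (t - (d + 1))"
    "\<And>j. j < c \<Longrightarrow> v $ j = residue_class m p (f j)" by metis
  have fc: "f j \<in> carrier (S_ring (m + p))" if "j < c" for j
    using f(1)[OF that] by (simp add: S_component_def)
  have "mat_act (scroll_ring m p) (rmat M) v $ i \<in> scroll_component m p (t - d)" if i: "i < r" for i
  proof -
    interpret R: cring "scroll_ring m p :: 'k mpol set ring" by (rule cring_scroll_ring)
    have "mat_act (scroll_ring m p) (rmat M) v $ i =
        finsum (scroll_ring m p) (\<lambda>j. residue_class m p (M $$ (i, j) * f j)) {..<c}"
      unfolding mat_act_index[OF M i]
    proof (rule R.finsum_cong')
      show "(\<lambda>j. residue_class m p (M $$ (i, j) * f j)) \<in> {..<c} \<rightarrow> carrier (scroll_ring m p)"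
        using fc rmat_entry(2)[OF M i] by (auto intro!: residue_class_closed S_carrier_mult)
      fix j assume "j \<in> {..<c}"
      then have j: "j < c" by simp
      show "rmat M $$ (i, j) \<otimes>\<^bsub>scroll_ring m p\<^esub> v $ j = residue_class m p (M $$ (i, j) * f j)"
        using ring_hom_mult[OF residue_class_hom rmat_entry(2)[OF M i j] fc[OF j]]
        by (simp add: rmat_entry(1)[OF M i j] f(2)[OF j])
    qed simp
    also have "\<dots> = residue_class m p (\<Sum>j<c. M $$ (i, j) * f j)"
      using fc rmat_entry(2)[OF M i] by (intro residue_class_finsum) (auto intro!: S_carrier_mult)
    finally have eq: "mat_act (scroll_ring m p) (rmat M) v $ i = residue_class m p (\<Sum>j<c. M $$ (i, j) * f j)" .
    have "M $$ (i, j) * f j \<in> S_component (m + p) (t - d)" if "j < c" for j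
      using S_component_mult[OF lin_S_component[OF linmat_entry[OF M i that]] f(1)[OF that]] by simp
    then show ?thesis unfolding eq scroll_component_def by (intro imageI S_component_sum) auto
  qed
  with mat_act_closed[OF M vc] show ?thesis by (simp add: free_module_component_def)
qed

lemma scroll_resolution:
  "minimal_graded_free_resolution
    (scroll_ring m p :: 'k::field mpol set ring) (scroll_component m p) (scroll_maximal_ideal m p)
    (residue_module m p) (residue_component m p)
    (scroll_rank (m + p)) (differential m p) (\<lambda>v. residue_projection m p (v $ 0))"
proof -
  let ?R = "scroll_ring m p :: 'k mpol set ring" and ?rk = "scroll_rank (m + p)"
  let ?aug = "\<lambda>v :: 'k mpol set vec. residue_projection m p (v $ 0)"
  have D: "differential m p i = rmat (differential_lift m p i :: 'k mpol mat)" for i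
    by (simp add: differential_def rmat_def)
  have lm: "differential_lift m p (Suc i) \<in> (linmat (?rk i) (?rk (Suc i)) :: 'k mpol mat set)" for i
    by (rule differential_lift_linmat)
  have rk0: "?rk 0 = 1" by (rule scroll_rank_eq)
  have FM1: "v $ 0 \<in> carrier ?R" if "v \<in> carrier (FM 1)" for v :: "'k mpol set vec"
    using that by (simp add: carrier_FM)
  have 1: "module ?R (residue_module m p)" by (rule module_residue)
  have 2: "\<forall>i. (differential m p (i + 1) :: 'k mpol set mat) \<in> carrier_mat (?rk i) (?rk (i + 1)) \<and>
      elements_mat (differential m p (i + 1)) \<subseteq> carrier ?R"
  proof (intro allI conjI subsetI)
    fix i
    show c: "differential m p (i + 1) \<in> (carrier_mat (?rk i) (?rk (i + 1)) :: 'k mpol set mat set)"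
      using linmat_carrier[OF lm[of i]] by (simp add: D rmat_def)
    fix x :: "'k mpol set" assume "x \<in> elements_mat (differential m p (i + 1))"
    then obtain r j where "r < ?rk i" "j < ?rk (Suc i)" "x = rmat (differential_lift m p (Suc i)) $$ (r, j)"
      using c by (auto simp: D dest!: elements_matD)
    then show "x \<in> carrier ?R" using rmat_entry(3)[OF lm[of i]] by simp
  qed
  have 3: "?aug \<in> module_homs ?R (free_module ?R (?rk 0)) (residue_module m p)"
  proof -
    note hom = residue_projection_hom[where 'k = 'k]
    have "?aug \<in> carrier (FM 1) \<rightarrow> carrier (residue_module m p)"
      using FM1 ring_hom_closed[OF hom] by auto
    moreover have "?aug (v \<oplus>\<^bsub>FM 1\<^esub> u) = ?aug v \<oplus>\<^bsub>residue_module m p\<^esub> ?aug u"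
      if "v \<in> carrier (FM 1)" "u \<in> carrier (FM 1)" for v u
      using ring_hom_add[OF hom FM1 FM1] that by (simp add: free_module_def)
    moreover have "?aug (a \<odot>\<^bsub>FM 1\<^esub> v) = a \<odot>\<^bsub>residue_module m p\<^esub> ?aug v"
      if "a \<in> carrier ?R" "v \<in> carrier (FM 1)" for a v
      using ring_hom_mult[OF hom that(1) FM1[OF that(2)]] by (simp add: free_module_def)
    ultimately show ?thesis unfolding module_homs_def rk0 by blast
  qed
  have 4: "?aug ` carrier (free_module ?R (?rk 0)) = carrier (residue_module m p)"
  proof -
    have "(\<lambda>v. v $ 0) ` carrier (FM 1) = carrier ?R"
    proof
      show "carrier ?R \<subseteq> (\<lambda>v. v $ 0) ` carrier (FM 1)"
      proof
        fix a assume "a \<in> carrier ?R"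
        then show "a \<in> (\<lambda>v. v $ 0) ` carrier (FM 1)"
          by (intro image_eqI[of _ _ "vec 1 (\<lambda>_. a)"]) (auto simp: carrier_FM)
      qed
    qed (auto simp: FM1)
    then show ?thesis
      unfolding rk0 residue_module_simps residue_projection_image[symmetric] by (metis image_image)
  qed
  have 5: "{v \<in> carrier (free_module ?R (?rk 0)). ?aug v = \<zero>\<^bsub>residue_module m p\<^esub>} =
      mat_act ?R (differential m p 1) ` carrier (free_module ?R (?rk 1))"
  proof -
    have D1: "differential_lift m p 1 \<in> (linmat 1 (m + p) :: 'k mpol mat set)" by (rule differential_lift_1)
    have "{v \<in> carrier (FM 1). ?aug v = \<zero>\<^bsub>residue_module m p\<^esub>} = {v \<in> carrier (FM 1). v $ 0 \<in> mx}"
      using residue_projection_kernel FM1 by auto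
    also have "\<dots> = mat_act ?R (rmat (differential_lift m p 1)) ` carrier (FM (m + p))"
    proof (intro equalityI subsetI)
      fix v :: "'k mpol set vec" assume "v \<in> {v \<in> carrier (FM 1). v $ 0 \<in> mx}"
      then have v: "v \<in> carrier (FM 1)" "v $ 0 \<in> mx" by auto
      from v(2) obtain x where x: "x \<in> carrier (FM (m + p))"
        "v $ 0 = mat_act ?R (rmat (differential_lift m p 1)) x $ 0"
        unfolding mx_mat_act by blast
      have "v = mat_act ?R (rmat (differential_lift m p 1)) x"
        using v(1) mat_act_dim[OF D1, of x] x(2) by (intro eq_vecI) (auto simp: carrier_FM)
      with x(1) show "v \<in> mat_act ?R (rmat (differential_lift m p 1)) ` carrier (FM (m + p))" by blast
    next
      fix v :: "'k mpol set vec" assume "v \<in> mat_act ?R (rmat (differential_lift m p 1)) ` carrier (FM (m + p))"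
      then show "v \<in> {v \<in> carrier (FM 1). v $ 0 \<in> mx}"
        using mat_act_closed[OF D1] mat_act_mx[OF D1] by auto
    qed
    finally show ?thesis unfolding D rk0 scroll_rank_eq(2) .
  qed
  have 6: "\<forall>i. {v \<in> carrier (free_module ?R (?rk (i + 1))).
            mat_act ?R (differential m p (i + 1)) v = \<zero>\<^bsub>free_module ?R (?rk i)\<^esub>} =
         mat_act ?R (differential m p (i + 2)) ` carrier (free_module ?R (?rk (i + 2)))"
    using exact_transport[OF lm lm exact_differentials] by (simp add: D)
  have 7: "\<exists>s. (\<forall>t. ?aug ` free_module_component ?R (scroll_component m p) (?rk 0) (s 0) t \<subseteq> residue_component m p t) \<and>
         (\<forall>i t. mat_act ?R (differential m p (i + 1)) ` free_module_component ?R (scroll_component m p) (?rk (i + 1)) (s (i + 1)) t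
                \<subseteq> free_module_component ?R (scroll_component m p) (?rk i) (s i) t)"
  proof (intro exI[of _ "\<lambda>i _. int i"] conjI allI)
    fix t
    show "?aug ` free_module_component ?R (scroll_component m p) (?rk 0) (\<lambda>_. int 0) t \<subseteq> residue_component m p t"
      by (auto simp: free_module_component_def residue_component_def rk0)
    fix i
    show "mat_act ?R (differential m p (i + 1)) ` free_module_component ?R (scroll_component m p) (?rk (i + 1)) (\<lambda>_. int (i + 1)) t
                \<subseteq> free_module_component ?R (scroll_component m p) (?rk i) (\<lambda>_. int i) t"
      using mat_act_graded[OF lm[of i], where d = "int i" and t = t] by (auto simp: D add.commute)
  qed
  have 8: "\<forall>i. mat_act ?R (differential m p (i + 1)) ` carrier (free_module ?R (?rk (i + 1)))
         \<subseteq> {v \<in> carrier (free_module ?R (?rk i)). \<forall>j<?rk i. v $ j \<in> mx}"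
    using mat_act_closed[OF lm] mat_act_mx[OF lm] by (auto simp: D)
  show ?thesis
    unfolding minimal_graded_free_resolution_def using 1 2 3 4 5 6 7 8 by blast
qed

end

theorem theorem4p1:
  fixes m n p :: nat
  assumes "m \<ge> 2" and "p \<ge> 2" and "n = m + p"
  shows "minimal_graded_free_resolution
    (scroll_ring m p :: 'k::field mpol set ring) (scroll_component m p) (scroll_maximal_ideal m p)
    (residue_module m p) (residue_component m p)
    (scroll_rank n) (differential m p) (\<lambda>v. residue_projection m p (v $ 0))"
proof -
  interpret scroll m p using assms by unfold_locales
  show ?thesis unfolding assms(3) by (rule scroll_resolution)
qed

end
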